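(* Let $Q\in\mathbb{C}[\xi_1,\ldots,\xi_n]$ be an elliptic polynomial of degree $m$ with principal part $Q_m$, let $r\in\mathbb{N}$ with $r<m$, and let $\alpha\in\mathbb{C}\setminus\{0\}$. Suppose that $\{Q_m(x): x\in\mathbb{R}^n\setminus\{0\}\}\cap\{\alpha t^r: t\in\mathbb{R}\}=\emptyset$. Consider the (hypoelliptic) differential operator $$P(D)=\alpha D_t^r-Q(D_x)$$ on $\mathbb{R}^{n+1}$. Let $G\subseteq\mathbb{R}^n$ be open. Let $K$ be a compact subset of $G$ that is the closure of an open set with continuous boundary. Suppose that $G$ does not contain a bounded connected component of $\mathbb{R}^n\setminus K$, and let $[t_1,t_2]\subseteq\mathbb{R}$ be an interval. Let $H\subseteq\mathbb{R}^n$ be open with $K\subseteq H\subseteq G$ and let $J\subseteq\mathbb{R}$ be an open interval with $[t_1,t_2]\subseteq J$. Then, for all compact $L\subseteq H$ with $K\subseteq\operatorname{int}L$, all $\delta>0$ with $[t_1-\delta,t_2+\delta]\subseteq J$, and all compact $M\subseteq\mathbb{R}\times G$ there are $s,C>0$ such that for all $f\in\mathscr{E}_P(J\times H)$ and all $\varepsilon\in(0,1)$ there exists $h_\varepsilon\in\mathscr{E}_P(\mathbb{R}\times G)$ with $$\|f-h_\varepsilon\|_{[t_1,t_2]\times K}\leq\varepsilon\|f\|_{[t_1-\delta,t_2+\delta]\times L}\quad\text{and}\quad\|h_\varepsilon\|_{M}\leq\frac{C}{\varepsilon^s}\|f\|_{[t_1-\delta,t_2+\delta]\times L}.$$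
   Context: Elements of $\mathbb{R}^{n+1}$ are written $(t,x)$ with $t\in\mathbb{R}$, $x\in\mathbb{R}^n$; $D_t=-i\frac{\partial}{\partial t}$ and $D_x=(-i\frac{\partial}{\partial x_1},\ldots,-i\frac{\partial}{\partial x_n})$; $\mathbb{N}=\{1,2,\ldots\}$. The polynomial $Q$ of degree $m$ is elliptic if its principal part (homogeneous part of degree $m$) satisfies $Q_m(\xi)\neq0$ for all $\xi\in\mathbb{R}^n\setminus\{0\}$. For $X$ open in $\mathbb{R}^{n+1}$, $\mathscr{E}_P(X)$ is the space of (complex-valued) smooth functions $f$ on $X$ with $P(D)f=0$. For $K\subseteq X$ compact, $\|f\|_K=\sup_{x\in K}|f(x)|$. An open set $U\subseteq\mathbb{R}^n$ has continuous boundary if for each $\xi\in\partial U$ there exists a homeomorphism $h$ from the closed unit ball $\overline{B}(0,1)$ of $\mathbb{R}^n$ onto a compact neighborhood $N$ of $\xi$ such that $h(0)=\xi$ and $\overline{U}\cap N=h(\{x\in\overline{B}(0,1): x_n\leq0\})$. *)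

theory Defs
  imports "HOL-Analysis.Analysis" "HOL-Library.Poly_Mapping"
begin

text \<open>
  Points of \<open>\<real>\<^sup>n\<^sup>+\<^sup>1\<close> are pairs \<open>(t, x)\<close> of type \<open>real \<times> real^'n\<close>. The index type \<open>'n\<close> is finite and
  linearly ordered, so that the coordinates \<open>x\<^sub>1, \<dots>, x\<^sub>n\<close> come in an order; every \<open>n \<ge> 1\<close> is the
  cardinality of such a type.
\<close>

type_synonym 'n spacetime = "real \<times> (real, 'n) vec"

subsection \<open>Polynomials in \<open>\<xi>\<^sub>1, \<dots>, \<xi>\<^sub>n\<close>\<close>

type_synonym 'n cpoly = "('n \<Rightarrow>\<^sub>0 nat) \<Rightarrow>\<^sub>0 complex"

definition mdegree :: "('n::finite \<Rightarrow>\<^sub>0 nat) \<Rightarrow> nat" where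
  "mdegree k = (\<Sum>j\<in>UNIV. Poly_Mapping.lookup k j)"

text \<open>The zero polynomial gets degree 0.\<close>

definition total_degree :: "'n::finite cpoly \<Rightarrow> nat" where
  "total_degree Q = Max (insert 0 (mdegree ` Poly_Mapping.keys Q))"

definition homogeneous_part :: "nat \<Rightarrow> 'n::finite cpoly \<Rightarrow> 'n cpoly" where
  "homogeneous_part d Q =
     (\<Sum>k\<in>{k \<in> Poly_Mapping.keys Q. mdegree k = d}.
        Poly_Mapping.single k (Poly_Mapping.lookup Q k))"

definition principal_part :: "'n::finite cpoly \<Rightarrow> 'n cpoly" where
  "principal_part Q = homogeneous_part (total_degree Q) Q"

definition eval_poly :: "'n::finite cpoly \<Rightarrow> real^'n \<Rightarrow> complex" where
  "eval_poly Q \<xi> =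
     (\<Sum>k\<in>Poly_Mapping.keys Q.
        Poly_Mapping.lookup Q k * (\<Prod>j\<in>UNIV. complex_of_real (\<xi> $ j) ^ Poly_Mapping.lookup k j))"

definition elliptic :: "'n::finite cpoly \<Rightarrow> bool" where
  "elliptic Q \<longleftrightarrow> (\<forall>\<xi>. \<xi> \<noteq> 0 \<longrightarrow> eval_poly (principal_part Q) \<xi> \<noteq> 0)"

subsection \<open>Smooth functions and differential operators\<close>

text \<open>
  Functions on an open set \<open>X\<close> are represented by total functions whose values outside \<open>X\<close> are
  irrelevant: for open \<open>X\<close>, the notions below depend, at points of \<open>X\<close>, only on the values in \<open>X\<close>.
\<close>

primrec Ck_on :: "nat \<Rightarrow> 'a::euclidean_space set \<Rightarrow> ('a \<Rightarrow> complex) \<Rightarrow> bool" where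
  "Ck_on 0 X f \<longleftrightarrow> continuous_on X f"
| "Ck_on (Suc k) X f \<longleftrightarrow>
     (\<forall>x\<in>X. f differentiable (at x)) \<and>
     (\<forall>b\<in>Basis. Ck_on k X (\<lambda>x. frechet_derivative f (at x) b))"

definition smooth_on :: "'a::euclidean_space set \<Rightarrow> ('a \<Rightarrow> complex) \<Rightarrow> bool" where
  "smooth_on X f \<longleftrightarrow> (\<forall>k. Ck_on k X f)"

definition D_t :: "('n::finite spacetime \<Rightarrow> complex) \<Rightarrow> 'n spacetime \<Rightarrow> complex" where
  "D_t f = (\<lambda>z. - \<i> * frechet_derivative f (at z) (1, 0))"

definition D_x :: "'n::finite \<Rightarrow> ('n spacetime \<Rightarrow> complex) \<Rightarrow> 'n spacetime \<Rightarrow> complex" where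
  "D_x j f = (\<lambda>z. - \<i> * frechet_derivative f (at z) (0, axis j 1))"

text \<open>\<open>D_x_power k\<close> is \<open>D\<^sub>1\<^bsup>k\<^sub>1\<^esup> \<circ> \<dots> \<circ> D\<^sub>n\<^bsup>k\<^sub>n\<^esup>\<close>.\<close>

definition D_x_power :: "('n::{finite,linorder} \<Rightarrow>\<^sub>0 nat) \<Rightarrow>
    ('n spacetime \<Rightarrow> complex) \<Rightarrow> 'n spacetime \<Rightarrow> complex" where
  "D_x_power k = foldr (\<lambda>j. D_x j ^^ Poly_Mapping.lookup k j) (sorted_list_of_set UNIV)"

definition poly_D_x :: "'n::{finite,linorder} cpoly \<Rightarrow>
    ('n spacetime \<Rightarrow> complex) \<Rightarrow> 'n spacetime \<Rightarrow> complex" where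
  "poly_D_x Q f = (\<lambda>z. \<Sum>k\<in>Poly_Mapping.keys Q. Poly_Mapping.lookup Q k * D_x_power k f z)"

definition P_op :: "complex \<Rightarrow> nat \<Rightarrow> 'n::{finite,linorder} cpoly \<Rightarrow>
    ('n spacetime \<Rightarrow> complex) \<Rightarrow> 'n spacetime \<Rightarrow> complex" where
  "P_op \<alpha> r Q f = (\<lambda>z. \<alpha> * (D_t ^^ r) f z - poly_D_x Q f z)"

definition kernel_on :: "(('a::euclidean_space \<Rightarrow> complex) \<Rightarrow> 'a \<Rightarrow> complex) \<Rightarrow>
    'a set \<Rightarrow> ('a \<Rightarrow> complex) set" where
  "kernel_on A X = {f. smooth_on X f \<and> (\<forall>z\<in>X. A f z = 0)}"

subsection \<open>Sup norms and continuous boundary\<close>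

text \<open>The supremum over the empty set is taken to be 0; \<open>Sup {}\<close> is unspecified on \<open>real\<close>.\<close>

definition sup_norm :: "'a set \<Rightarrow> ('a \<Rightarrow> complex) \<Rightarrow> real" where
  "sup_norm K f = (if K = {} then 0 else (SUP x\<in>K. cmod (f x)))"

text \<open>The last coordinate \<open>x\<^sub>n\<close> is \<open>x $ Max UNIV\<close>.\<close>

definition continuous_boundary :: "(real^'n::{finite,linorder}) set \<Rightarrow> bool" where
  "continuous_boundary U \<longleftrightarrow>
     (\<forall>\<xi>\<in>frontier U. \<exists>N (h :: (real, 'n) vec \<Rightarrow> (real, 'n) vec) g.
        compact N \<and> \<xi> \<in> interior N \<and>
        homeomorphism (cball 0 1) N h g \<and> h 0 = \<xi> \<and>
        closure U \<inter> N = h ` {x \<in> cball 0 1. x $ Max UNIV \<le> 0})"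

end

theory Submission
  imports Defs "HOL-Computational_Algebra.Polynomial"
begin

text \<open>
  Give \<open>t\<close> the weight \<open>m / r\<close> and every \<open>x\<^sub>j\<close> the weight 1. The hypothesis on \<open>Q\<^sub>m\<close> says that the
  quasi-homogeneous principal symbol has no real zero except 0, so commuting a cutoff past \<open>P(D)\<close> gains
  one power of the weighted frequency in the Fourier coefficients. Iterating the gain bounds the gradient of a
  solution by its supremum, uniformly under the quasi-homogeneous dilations by \<open>\<eta> \<le> 1\<close>. Applying
  this \<open>k\<close> times on cubes of size \<open>\<eta> = c / k\<close> shows that solutions are real analytic in \<open>x\<close>;
  the time spent is at most \<open>k \<eta>\<^sup>m\<^sup>/\<^sup>r \<le> c\<close> because \<open>r < m\<close>.

  Near \<open>[t\<^sub>1, t\<^sub>2] \<times> K\<close> a solution is a finite sum of solutions with singularities in small balls,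
  obtained by solving \<open>P u\<^sub>p = \<psi>\<^sub>p P(\<eta> f)\<close> with Fourier series on a large cube whose frequency lattice is
  shifted off the zeros of the symbol. A Taylor polynomial of \<open>u\<^sub>p\<close> in the direction \<open>v\<close>, evaluated at
  \<open>z - v\<close>, moves the singularity by \<open>v\<close> with error \<open>2\<^sup>-\<^sup>p\<close> and growth \<open>R\<^sup>p\<close>, which is the asserted
  trade-off between \<open>\<epsilon>\<close> and \<open>\<epsilon>\<^sup>-\<^sup>s\<close>. Poles over points outside \<open>K\<close> travel inside their component of
  the complement of \<open>K\<close>. Poles at times outside \<open>[t\<^sub>1, t\<^sub>2]\<close> may travel through \<open>K\<close>, since analyticity in \<open>x\<close> only
  needs distance in time. All poles are thus moved out of a neighbourhood of \<open>M\<close>, and a Mittag-Leffler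
  limit over an exhaustion of \<open>G\<close> yields a solution on \<open>\<real> \<times> G\<close>.
\<close>

subsection \<open>Directional derivatives of smooth functions\<close>

text \<open>The estimates must be uniform over a family of operators. Dilating a small cube to unit
  size replaces P(D) by an operator whose lower order terms carry powers of the scale; as the scale
  is at most 1, these coefficients stay bounded and one constant serves all scales. The choices in
  the pole pushing depend on each other: the radius of a pole on its escape path, the finite set of
  poles on the radii, the number of translations on the poles, and every translation shrinks the
  cube on which a piece is a solution. The circle is broken because the poles are found before the
  cube: the equation is then solved on a cube as large as the paths demand. Composing approximations
  with polynomial growth gives polynomial growth again, and the number of translations depends on
  the geometry alone, neither on the solution nor on \<epsilon>; so a single exponent s results. The
  correction made in the limit is small on a compact set containing M and changes only the
  constant.\<close>

definition pd :: "'a::euclidean_space \<Rightarrow> ('a \<Rightarrow> complex) \<Rightarrow> 'a \<Rightarrow> complex" where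
  "pd b f z = frechet_derivative f (at z) b"

primrec pdw :: "'a::euclidean_space list \<Rightarrow> ('a \<Rightarrow> complex) \<Rightarrow> 'a \<Rightarrow> complex" where
  "pdw [] f = f"
| "pdw (b # w) f = pd b (pdw w f)"

lemma pd_eqI:
  assumes "(f has_derivative D) (at z)"
  shows "pd b f z = D b"
  using frechet_derivative_at[OF assms] by (simp add: pd_def)

lemma has_derivative_pd:
  assumes "f differentiable (at z)"
  shows "(f has_derivative (\<lambda>h. pd h f z)) (at z)"
  using assms frechet_derivative_works[of f "at z"] by (simp add: pd_def[abs_def])

text \<open>\<open>frechet_derivative\<close> chooses one of the derivatives at \<open>z\<close>.
  Functions that agree near \<open>z\<close> have the same derivatives there, so the choices agree
  even at points without a derivative.\<close>

lemma frechet_derivative_cong_open: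
  assumes "open X" "\<And>x. x \<in> X \<Longrightarrow> f x = g x" "z \<in> X"
  shows "frechet_derivative f (at z) = frechet_derivative g (at z)"
proof -
  have "(f has_derivative D) (at z) \<longleftrightarrow> (g has_derivative D) (at z)" for D
    using assms by (auto intro: has_derivative_transform_within_open[of _ _ z UNIV X])
  then show ?thesis by (simp add: frechet_derivative_def)
qed

lemma pd_cong:
  assumes "open X" "\<And>x. x \<in> X \<Longrightarrow> f x = g x" "z \<in> X"
  shows "pd b f z = pd b g z"
  using frechet_derivative_cong_open[OF assms] by (simp add: pd_def)

lemma pdw_cong:
  assumes "open X" "\<And>x. x \<in> X \<Longrightarrow> f x = g x" "z \<in> X"
  shows "pdw w f z = pdw w g z"
  using assms(3)
proof (induction w arbitrary: z)
  case (Cons b w)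
  then show ?case by (simp add: pd_cong[OF assms(1) Cons.IH])
qed (use assms in auto)

lemma differentiable_cong_open:
  assumes "open X" "\<And>x. x \<in> X \<Longrightarrow> f x = g x" "z \<in> X" "f differentiable (at z)"
  shows "g differentiable (at z)"
  using assms unfolding differentiable_def
  by (meson has_derivative_transform_within_open)

lemma Ck_on_Suc_iff:
  "Ck_on (Suc k) X f \<longleftrightarrow> (\<forall>x\<in>X. f differentiable (at x)) \<and> (\<forall>b\<in>Basis. Ck_on k X (pd b f))"
  by (simp add: pd_def[abs_def])

lemma Ck_on_cong1:
  assumes "open X"
  shows "\<lbrakk>\<And>x. x \<in> X \<Longrightarrow> f x = g x; Ck_on k X f\<rbrakk> \<Longrightarrow> Ck_on k X g"
proof (induction k arbitrary: f g)
  case 0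
  then show ?case using continuous_on_cong by force
next
  case (Suc k)
  have "Ck_on k X (pd b g)" if "b \<in> Basis" for b
  proof (rule Suc.IH[of "pd b f"])
    show "pd b f x = pd b g x" if "x \<in> X" for x
      by (rule pd_cong[OF assms _ that]) (use Suc in auto)
    show "Ck_on k X (pd b f)"
      using Suc(3) that by (simp add: pd_def[abs_def])
  qed
  then show ?case
    using Suc differentiable_cong_open[OF assms, of f g] by (auto simp: Ck_on_Suc_iff simp del: Ck_on.simps)
qed

lemma Ck_on_SucD: "Ck_on (Suc k) X f \<Longrightarrow> Ck_on k X f"
proof (induction k arbitrary: f)
  case 0
  then have "\<forall>x\<in>X. f differentiable (at x)" by simp
  then show ?case
    by (auto intro!: differentiable_imp_continuous_on differentiable_at_imp_differentiable_on)
next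
  case (Suc k)
  show ?case
    unfolding Ck_on_Suc_iff using Suc.prems Suc.IH[of "pd _ f"]
    by (auto simp: pd_def[abs_def])
qed

lemma Ck_on_subset: "Ck_on k X f \<Longrightarrow> Y \<subseteq> X \<Longrightarrow> Ck_on k Y f"
  by (induction k arbitrary: f) (auto intro: continuous_on_subset)

lemma smooth_on_subset: "smooth_on X f \<Longrightarrow> Y \<subseteq> X \<Longrightarrow> smooth_on Y f"
  unfolding smooth_on_def using Ck_on_subset by blast

lemma smooth_on_cong:
  assumes "open X" "\<And>x. x \<in> X \<Longrightarrow> f x = g x" "smooth_on X f"
  shows "smooth_on X g"
  using assms(3) Ck_on_cong1[OF assms(1), of f g] assms(2) unfolding smooth_on_def by simp

lemma smooth_on_differentiable: "smooth_on X f \<Longrightarrow> x \<in> X \<Longrightarrow> f differentiable (at x)"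
  unfolding smooth_on_def by (metis Ck_on_Suc_iff)

lemma smooth_on_continuous_on: "smooth_on X f \<Longrightarrow> continuous_on X f"
  unfolding smooth_on_def by (metis Ck_on.simps(1))

lemma smooth_on_pd: "smooth_on X f \<Longrightarrow> b \<in> Basis \<Longrightarrow> smooth_on X (pd b f)"
  unfolding smooth_on_def by (metis Ck_on_Suc_iff)

lemma smooth_on_pdw: "smooth_on X f \<Longrightarrow> set w \<subseteq> Basis \<Longrightarrow> smooth_on X (pdw w f)"
  by (induction w) (auto intro: smooth_on_pd)

lemma Ck_onI:
  assumes "\<And>f x. f \<in> F \<Longrightarrow> x \<in> X \<Longrightarrow> f differentiable (at x)"
    and "\<And>f b. f \<in> F \<Longrightarrow> b \<in> Basis \<Longrightarrow> \<exists>g\<in>F. \<forall>x\<in>X. g x = pd b f x"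
    and "open X" "f \<in> F"
  shows "Ck_on k X f"
  using assms(4)
proof (induction k arbitrary: f)
  case 0
  then show ?case using assms(1)
    by (auto intro!: differentiable_imp_continuous_on differentiable_at_imp_differentiable_on)
next
  case (Suc k)
  then show ?case unfolding Ck_on_Suc_iff
    using assms(1,2) Ck_on_cong1[OF assms(3)] by metis
qed

text \<open>A coinduction principle for smoothness; \<open>smooth_on_limit\<close> applies it to the
  family of the limits of all derivatives.\<close>

lemma smooth_onI:
  assumes "\<And>f x. f \<in> F \<Longrightarrow> x \<in> X \<Longrightarrow> f differentiable (at x)"
    and "\<And>f b. f \<in> F \<Longrightarrow> b \<in> Basis \<Longrightarrow> \<exists>g\<in>F. \<forall>x\<in>X. g x = pd b f x"
    and "open X" "f \<in> F"
  shows "smooth_on X f"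
  using Ck_onI[of F X f, OF assms(1,2,3,4)] by (auto simp: smooth_on_def)

section \<open>Linearity and the product rule\<close>

lemma pd_const [simp]: "pd b (\<lambda>z. c) = (\<lambda>z. 0)"
  by (rule ext, rule pd_eqI[where D = "\<lambda>_. 0"]) simp

lemma pd_add:
  "f differentiable (at z) \<Longrightarrow> g differentiable (at z) \<Longrightarrow>
    pd b (\<lambda>z. f z + g z) z = pd b f z + pd b g z"
  by (rule pd_eqI) (intro has_derivative_add has_derivative_pd)

lemma pd_diff:
  "f differentiable (at z) \<Longrightarrow> g differentiable (at z) \<Longrightarrow>
    pd b (\<lambda>z. f z - g z) z = pd b f z - pd b g z"
  by (rule pd_eqI) (intro has_derivative_diff has_derivative_pd)

lemma pd_mult:
  "f differentiable (at z) \<Longrightarrow> g differentiable (at z) \<Longrightarrow>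
    pd b (\<lambda>z. f z * g z) z = f z * pd b g z + pd b f z * g z"
  by (rule pd_eqI) (intro has_derivative_mult has_derivative_pd)

lemma pd_cmult:
  "f differentiable (at z) \<Longrightarrow> pd b (\<lambda>z. c * f z) z = c * pd b f z"
  by (rule pd_eqI) (intro has_derivative_mult_right has_derivative_pd)

lemma pd_sum:
  "(\<And>i. i \<in> I \<Longrightarrow> f i differentiable (at z)) \<Longrightarrow>
    pd b (\<lambda>z. \<Sum>i\<in>I. f i z) z = (\<Sum>i\<in>I. pd b (f i) z)"
  by (rule pd_eqI) (intro has_derivative_sum has_derivative_pd)

lemma linear_pd:
  assumes "f differentiable (at z)"
  shows "linear (\<lambda>h. pd h f z)"
  using has_derivative_linear[OF has_derivative_pd[OF assms]] .

lemma pd_expand: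
  assumes "f differentiable (at z)"
  shows "pd v f z = (\<Sum>b\<in>Basis. of_real (v \<bullet> b) * pd b f z)"
proof -
  have "pd (\<Sum>b\<in>Basis. (v \<bullet> b) *\<^sub>R b) f z = (\<Sum>b\<in>Basis. (v \<bullet> b) *\<^sub>R pd b f z)"
    by (simp only: linear_sum[OF linear_pd[OF assms]] linear_scale[OF linear_pd[OF assms]])
  then show ?thesis by (simp add: euclidean_representation scaleR_conv_of_real)
qed

lemma smooth_on_const [simp]: "smooth_on X (\<lambda>z. c)"
proof -
  have "Ck_on k X (\<lambda>z. c)" for k
    by (induction k arbitrary: c) (auto simp: Ck_on_Suc_iff simp del: Ck_on.simps(2))
  then show ?thesis by (simp add: smooth_on_def)
qed

lemma Ck_on_add:
  assumes "open X"
  shows "Ck_on k X f \<Longrightarrow> Ck_on k X g \<Longrightarrow> Ck_on k X (\<lambda>z. f z + g z)"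
proof (induction k arbitrary: f g)
  case 0
  then show ?case by (auto intro: continuous_on_add)
next
  case (Suc k)
  have "Ck_on k X (pd b (\<lambda>z. f z + g z))" if "b \<in> Basis" for b
    by (rule Ck_on_cong1[OF assms, where f = "\<lambda>z. pd b f z + pd b g z"])
       (use Suc that in \<open>auto simp: pd_add Ck_on_Suc_iff simp del: Ck_on.simps\<close>)
  then show ?case using Suc.prems unfolding Ck_on_Suc_iff by auto
qed

lemma Ck_on_mult:
  assumes "open X"
  shows "Ck_on k X f \<Longrightarrow> Ck_on k X g \<Longrightarrow> Ck_on k X (\<lambda>z. f z * g z)"
proof (induction k arbitrary: f g)
  case 0
  then show ?case by (auto intro: continuous_on_mult)
next
  case (Suc k)
  have "Ck_on k X (pd b (\<lambda>z. f z * g z))" if "b \<in> Basis" for b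
  proof (rule Ck_on_cong1[OF assms, where f = "\<lambda>z. f z * pd b g z + pd b f z * g z"])
    show "Ck_on k X (\<lambda>z. f z * pd b g z + pd b f z * g z)"
      using Suc.prems that Ck_on_SucD[OF Suc.prems(1)] Ck_on_SucD[OF Suc.prems(2)]
      unfolding Ck_on_Suc_iff by (intro Ck_on_add Suc.IH assms) auto
  qed (use Suc.prems in \<open>auto simp: pd_mult\<close>)
  then show ?case using Suc.prems unfolding Ck_on_Suc_iff by auto
qed

lemma smooth_on_add:
  "open X \<Longrightarrow> smooth_on X f \<Longrightarrow> smooth_on X g \<Longrightarrow> smooth_on X (\<lambda>z. f z + g z)"
  by (auto simp: smooth_on_def intro: Ck_on_add)

lemma smooth_on_mult:
  "open X \<Longrightarrow> smooth_on X f \<Longrightarrow> smooth_on X g \<Longrightarrow> smooth_on X (\<lambda>z. f z * g z)"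
  by (auto simp: smooth_on_def intro: Ck_on_mult)

lemma smooth_on_diff:
  "open X \<Longrightarrow> smooth_on X f \<Longrightarrow> smooth_on X g \<Longrightarrow> smooth_on X (\<lambda>z. f z - g z)"
  using smooth_on_add[of X f "\<lambda>z. (-1) * g z"] smooth_on_mult[of X "\<lambda>z. -1" g] by auto

lemma smooth_on_sum:
  "open X \<Longrightarrow> (\<And>i. i \<in> I \<Longrightarrow> smooth_on X (f i)) \<Longrightarrow> smooth_on X (\<lambda>z. \<Sum>i\<in>I. f i z)"
  by (induction I rule: infinite_finite_induct) (auto intro: smooth_on_add)

lemma pdw_diff:
  assumes "open X" "smooth_on X f" "smooth_on X g" "set w \<subseteq> Basis" "z \<in> X"
  shows "pdw w (\<lambda>z. f z - g z) z = pdw w f z - pdw w g z"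
  using assms(4,5)
proof (induction w arbitrary: z)
  case (Cons b w)
  then have "pd b (pdw w (\<lambda>z. f z - g z)) z = pd b (\<lambda>z. pdw w f z - pdw w g z) z"
    by (intro pd_cong[OF assms(1)]) auto
  also have "\<dots> = pd b (pdw w f) z - pd b (pdw w g) z"
    using Cons.prems assms by (intro pd_diff) (auto intro!: smooth_on_differentiable[of X] smooth_on_pdw)
  finally show ?case by simp
qed auto

lemma pdw_add:
  assumes "open X" "smooth_on X f" "smooth_on X g" "set w \<subseteq> Basis" "z \<in> X"
  shows "pdw w (\<lambda>z. f z + g z) z = pdw w f z + pdw w g z"
  using assms(4,5)
proof (induction w arbitrary: z)
  case (Cons b w)
  then have "pd b (pdw w (\<lambda>z. f z + g z)) z = pd b (\<lambda>z. pdw w f z + pdw w g z) z"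
    by (intro pd_cong[OF assms(1)]) auto
  also have "\<dots> = pd b (pdw w f) z + pd b (pdw w g) z"
    using Cons.prems assms by (intro pd_add) (auto intro!: smooth_on_differentiable[of X] smooth_on_pdw)
  finally show ?case by simp
qed auto

lemma pdw_cmult:
  assumes "open X" "smooth_on X f" "set w \<subseteq> Basis" "z \<in> X"
  shows "pdw w (\<lambda>z. c * f z) z = c * pdw w f z"
  using assms(3,4)
proof (induction w arbitrary: z)
  case (Cons b w)
  then have "pd b (pdw w (\<lambda>z. c * f z)) z = pd b (\<lambda>z. c * pdw w f z) z"
    by (intro pd_cong[OF assms(1)]) auto
  also have "\<dots> = c * pd b (pdw w f) z"
    using Cons.prems assms by (intro pd_cmult) (auto intro!: smooth_on_differentiable[of X] smooth_on_pdw)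
  finally show ?case by simp
qed auto

lemma pdw_const_0 [simp]: "pdw w (\<lambda>z. 0) = (\<lambda>z. 0)"
  by (induction w) auto

lemma pdw_sum:
  assumes "open X" "\<And>i. i \<in> I \<Longrightarrow> smooth_on X (f i)" "set w \<subseteq> Basis" "z \<in> X"
  shows "pdw w (\<lambda>z. \<Sum>i\<in>I. f i z) z = (\<Sum>i\<in>I. pdw w (f i) z)"
  using assms(2)
proof (induction I rule: infinite_finite_induct)
  case (insert i I)
  then have "pdw w (\<lambda>z. f i z + (\<Sum>i\<in>I. f i z)) z = pdw w (f i) z + pdw w (\<lambda>z. \<Sum>i\<in>I. f i z) z"
    using assms by (intro pdw_add smooth_on_sum) auto
  then show ?case using insert by simp
qed auto

text \<open>The basis directions may be rescaled independently, as needed for quasi-homogeneity.\<close>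

definition dil :: "('a \<Rightarrow> real) \<Rightarrow> 'a::euclidean_space \<Rightarrow> 'a" where
  "dil l y = (\<Sum>b\<in>Basis. (l b * (y \<bullet> b)) *\<^sub>R b)"

lemma dil_inner [simp]: "b \<in> Basis \<Longrightarrow> dil l y \<bullet> b = l b * (y \<bullet> b)"
  by (simp add: dil_def)

lemma dil_Basis: "b \<in> Basis \<Longrightarrow> dil l b = l b *\<^sub>R b"
  by (rule euclidean_eqI) (auto simp: inner_Basis)

lemma dil_one [simp]: "dil (\<lambda>b. 1) y = y"
  by (simp add: dil_def euclidean_representation)

lemma bounded_linear_dil: "bounded_linear (dil l)"
  unfolding dil_def[abs_def]
  by (intro bounded_linear_sum bounded_linear_scaleR_const bounded_linear_mult_const
      bounded_linear_const_mult bounded_linear_inner_left)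

lemma affine_dil_has_derivative:
  assumes "f differentiable (at (a + dil l y))"
  shows "((\<lambda>y. f (a + dil l y)) has_derivative (\<lambda>h. pd (dil l h) f (a + dil l y))) (at y)"
proof -
  have "((\<lambda>y. a + dil l y) has_derivative (\<lambda>h. dil l h)) (at y)"
    by (auto intro!: derivative_eq_intros bounded_linear.has_derivative[OF bounded_linear_dil])
  from has_derivative_compose[OF this has_derivative_pd[OF assms]] show ?thesis .
qed

lemma pd_affine_dil:
  assumes "f differentiable (at (a + dil l y))" "b \<in> Basis"
  shows "pd b (\<lambda>y. f (a + dil l y)) y = of_real (l b) * pd b f (a + dil l y)"
proof -
  have "pd b (\<lambda>y. f (a + dil l y)) y = pd (l b *\<^sub>R b) f (a + dil l y)"
    using pd_eqI[OF affine_dil_has_derivative[OF assms(1)]] assms(2) by (simp add: dil_Basis)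
  then show ?thesis
    using linear_scale[OF linear_pd[OF assms(1)]] by (simp add: scaleR_conv_of_real)
qed

lemma Ck_on_cmult: "open X \<Longrightarrow> Ck_on k X f \<Longrightarrow> Ck_on k X (\<lambda>z. c * f z)"
  using Ck_on_mult[of X k "\<lambda>z. c" f] smooth_on_const[of X c] by (simp add: smooth_on_def del: smooth_on_const)

lemma continuous_dil: "continuous_on S (\<lambda>y. a + dil l y)"
  by (intro continuous_intros bounded_linear.continuous_on[OF bounded_linear_dil])

lemma Ck_on_affine_dil:
  assumes "open X" "open Y" "\<And>y. y \<in> Y \<Longrightarrow> a + dil l y \<in> X"
  shows "Ck_on k X f \<Longrightarrow> Ck_on k Y (\<lambda>y. f (a + dil l y))"
proof (induction k arbitrary: f)
  case 0
  then show ?case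
    using assms(3) by (auto intro!: continuous_on_compose2[OF _ continuous_dil[of Y a l]])
next
  case (Suc k)
  have d: "f differentiable (at (a + dil l y))" if "y \<in> Y" for y
    using Suc.prems assms(3) that by auto
  have "Ck_on k Y (pd b (\<lambda>y. f (a + dil l y)))" if "b \<in> Basis" for b
    by (rule Ck_on_cong1[OF assms(2), where f = "\<lambda>y. of_real (l b) * pd b f (a + dil l y)"])
       (use that d Suc in \<open>auto simp: pd_affine_dil Ck_on_Suc_iff assms(2) intro!: Ck_on_cmult simp del: Ck_on.simps\<close>)
  then show ?case unfolding Ck_on_Suc_iff
    using affine_dil_has_derivative[OF d] unfolding differentiable_def by blast
qed

lemma smooth_on_affine_dil:
  assumes "open X" "open Y" "\<And>y. y \<in> Y \<Longrightarrow> a + dil l y \<in> X" "smooth_on X f"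
  shows "smooth_on Y (\<lambda>y. f (a + dil l y))"
  using assms(4) Ck_on_affine_dil[OF assms(1-3)] by (auto simp: smooth_on_def)

lemma pdw_affine_dil:
  assumes "open X" "open Y" "\<And>y. y \<in> Y \<Longrightarrow> a + dil l y \<in> X" "smooth_on X f"
    and "set w \<subseteq> Basis" "y \<in> Y"
  shows "pdw w (\<lambda>y. f (a + dil l y)) y = of_real (prod_list (map l w)) * pdw w f (a + dil l y)"
  using assms(5,6)
proof (induction w arbitrary: y)
  case (Cons b w)
  then have s: "smooth_on X (pdw w f)" by (auto intro: smooth_on_pdw assms)
  have d: "pdw w f differentiable (at (a + dil l y))"
    using Cons.prems assms(3) smooth_on_differentiable[OF s] by auto
  have "pd b (pdw w (\<lambda>y. f (a + dil l y))) y =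
      pd b (\<lambda>y. of_real (prod_list (map l w)) * pdw w f (a + dil l y)) y"
    using Cons by (intro pd_cong[OF assms(2)]) auto
  also have "\<dots> = of_real (prod_list (map l w)) * pd b (\<lambda>y. pdw w f (a + dil l y)) y"
    using affine_dil_has_derivative[OF d] by (intro pd_cmult) (auto simp: differentiable_def)
  also have "\<dots> = of_real (prod_list (map l (b # w))) * pd b (pdw w f) (a + dil l y)"
    using Cons.prems by (subst pd_affine_dil[OF d]) auto
  finally show ?case by simp
qed auto

text \<open>The chain rule turns a derivative of \<open>F j (g z)\<close> into
  \<open>F (Suc j) (g z)\<close> times a derivative of \<open>g\<close>. Carrying the whole sequence
  of derivatives of the outer function lets the induction on the order close.\<close>

lemma smooth_on_comp_real:
  fixes F :: "nat \<Rightarrow> real \<Rightarrow> complex" and g :: "'a::euclidean_space \<Rightarrow> real"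
  assumes "open X" and F: "\<And>j s. (F j has_vector_derivative F (Suc j) s) (at s)"
    and g: "smooth_on X (\<lambda>z. complex_of_real (g z))"
  shows "smooth_on X (\<lambda>z. F j (g z))"
proof -
  have der: "((\<lambda>z. F j (g z)) has_derivative
      (\<lambda>h. F (Suc j) (g z) * pd h (\<lambda>z. complex_of_real (g z)) z)) (at z)" if "z \<in> X" for z j
  proof -
    have d: "((\<lambda>z. complex_of_real (g z)) has_derivative (\<lambda>h. pd h (\<lambda>z. complex_of_real (g z)) z)) (at z)"
      by (rule has_derivative_pd[OF smooth_on_differentiable[OF g that]])
    have gr: "(g has_derivative (\<lambda>h. Re (pd h (\<lambda>z. complex_of_real (g z)) z))) (at z)"
      using has_derivative_Re[OF d] by simp
    have eq: "pd h (\<lambda>z. complex_of_real (g z)) z = of_real (Re (pd h (\<lambda>z. complex_of_real (g z)) z))" for h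
      by (rule pd_eqI) (rule has_derivative_of_real[OF gr])
    have "((\<lambda>z. F j (g z)) has_derivative
      (\<lambda>h. Re (pd h (\<lambda>z. complex_of_real (g z)) z) *\<^sub>R F (Suc j) (g z))) (at z)"
      using has_derivative_compose[OF gr F[unfolded has_vector_derivative_def]] .
    moreover have "Re (pd h (\<lambda>z. complex_of_real (g z)) z) *\<^sub>R F (Suc j) (g z) = F (Suc j) (g z) * pd h (\<lambda>z. complex_of_real (g z)) z" for h
      by (subst (2) eq) (simp add: scaleR_conv_of_real)
    ultimately show ?thesis by simp
  qed
  have "Ck_on k X (\<lambda>z. F j (g z))" for k j
  proof (induction k arbitrary: j)
    case 0
    show ?case using der
      by (auto intro!: differentiable_imp_continuous_on differentiable_at_imp_differentiable_on simp: differentiable_def) blast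
  next
    case (Suc k)
    have "Ck_on k X (pd b (\<lambda>z. F j (g z)))" if "b \<in> Basis" for b
      by (rule Ck_on_cong1[OF assms(1), where f = "\<lambda>z. F (Suc j) (g z) * pd b (\<lambda>z. complex_of_real (g z)) z"])
         (use pd_eqI[OF der] smooth_on_pd[OF g that] in
           \<open>auto intro!: Ck_on_mult assms(1) Suc.IH simp: smooth_on_def\<close>)
    then show ?case unfolding Ck_on_Suc_iff using der by (auto simp: differentiable_def)
  qed
  then show ?thesis by (simp add: smooth_on_def)
qed

lemma smooth_on_of_real_inner [simp]: "smooth_on X (\<lambda>z. complex_of_real (z \<bullet> c))"
proof -
  have d: "((\<lambda>z. complex_of_real (z \<bullet> c)) has_derivative (\<lambda>h. complex_of_real (h \<bullet> c))) (at z)" for z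
    by (auto intro!: derivative_eq_intros)
  have "pd b (\<lambda>z. complex_of_real (z \<bullet> c)) = (\<lambda>z. complex_of_real (b \<bullet> c))" for b
    using pd_eqI[OF d] by auto
  then have "Ck_on k X (\<lambda>z. complex_of_real (z \<bullet> c))" for k
    using smooth_on_const[of X] differentiableI[OF d]
    by (cases k) (auto simp: Ck_on_Suc_iff smooth_on_def intro!: continuous_intros simp del: Ck_on.simps(2) smooth_on_const)
  then show ?thesis by (simp add: smooth_on_def)
qed

text \<open>Every derivative converges locally uniformly, so limit and differentiation can be
  interchanged for each word. The limits \<open>g w\<close> then form a family closed under
  derivatives in the basis directions.\<close>

lemma smooth_on_limit:
  fixes f :: "nat \<Rightarrow> 'a::euclidean_space \<Rightarrow> complex"
  assumes "open X" and sm: "\<And>n. smooth_on X (f n)"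
    and cauchy: "\<And>w x. set w \<subseteq> Basis \<Longrightarrow> x \<in> X \<Longrightarrow>
      \<exists>e>0. uniformly_Cauchy_on (ball x e) (\<lambda>n. pdw w (f n))"
  obtains g where "smooth_on X g"
    and "\<And>w x. set w \<subseteq> Basis \<Longrightarrow> x \<in> X \<Longrightarrow> (\<lambda>n. pdw w (f n) x) \<longlonglongrightarrow> pdw w g x"
proof -
  define g where "g w x = lim (\<lambda>n. pdw w (f n) x)" for w x
  have lim: "(\<lambda>n. pdw w (f n) x) \<longlonglongrightarrow> g w x" if wx: "set w \<subseteq> Basis" "x \<in> X" for w x
  proof -
    obtain e where "e > 0" "uniformly_Cauchy_on (ball x e) (\<lambda>n. pdw w (f n))"
      using cauchy[OF wx] by blast
    then have "Cauchy (\<lambda>n. pdw w (f n) x)"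
      by (intro uniformly_Cauchy_imp_Cauchy[of "ball x e"]) auto
    then show ?thesis unfolding g_def by (simp add: Cauchy_convergent convergent_LIMSEQ_iff[symmetric])
  qed
  have der: "(g w has_derivative (\<lambda>h. \<Sum>b\<in>Basis. (h \<bullet> b) *\<^sub>R g (b # w) x)) (at x)"
    if w: "set w \<subseteq> Basis" and x: "x \<in> X" for w x
  proof -
    have "\<exists>e>0. ball x e \<subseteq> X \<and> (\<forall>b\<in>Basis. uniformly_Cauchy_on (ball x e) (\<lambda>n. pdw (b # w) (f n)))"
    proof -
      have "\<forall>b\<in>Basis. \<exists>e>0. uniformly_Cauchy_on (ball x e) (\<lambda>n. pdw (b # w) (f n))"
        using cauchy[of "_ # w" x] w x by simp
      then obtain e where e: "\<And>b. b \<in> Basis \<Longrightarrow> e b > 0 \<and> uniformly_Cauchy_on (ball x (e b)) (\<lambda>n. pdw (b # w) (f n))"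
        by metis
      obtain e0 where e0: "e0 > 0" "ball x e0 \<subseteq> X" using \<open>open X\<close> x openE by blast
      define e' where "e' = Min (insert e0 (e ` Basis))"
      have "e' > 0" using e e0 by (auto simp: e'_def)
      moreover have "ball x e' \<subseteq> X" using e0 by (auto simp: e'_def)
      moreover have "uniformly_Cauchy_on (ball x e') (\<lambda>n. pdw (b # w) (f n))" if "b \<in> Basis" for b
      proof -
        have "e' \<le> e b" unfolding e'_def using that by (intro Min_le) auto
        then show ?thesis using e[OF that] unfolding uniformly_Cauchy_on_def
          by (meson dual_order.strict_trans1 mem_ball)
      qed
      ultimately show ?thesis by blast
    qed
    then obtain e where e: "e > 0" "ball x e \<subseteq> X"
      "\<And>b. b \<in> Basis \<Longrightarrow> uniformly_Cauchy_on (ball x e) (\<lambda>n. pdw (b # w) (f n))" by blast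
    have ul: "uniform_limit (ball x e) (\<lambda>n. pdw (b # w) (f n)) (g (b # w)) sequentially" if "b \<in> Basis" for b
    proof -
      from e(3)[OF that] obtain l where l: "uniform_limit (ball x e) (\<lambda>n. pdw (b # w) (f n)) l sequentially"
        using Cauchy_uniformly_convergent[of "ball x e" "\<lambda>n. pdw (b # w) (f n)"]
        by (auto simp: uniformly_convergent_on_def)
      have "l y = g (b # w) y" if y: "y \<in> ball x e" for y
      proof (rule LIMSEQ_unique)
        show "(\<lambda>n. pdw (b # w) (f n) y) \<longlonglongrightarrow> l y" using tendsto_uniform_limitI[OF l y] .
        show "(\<lambda>n. pdw (b # w) (f n) y) \<longlonglongrightarrow> g (b # w) y"
          using lim[of "b # w" y] w y e(2) \<open>b \<in> Basis\<close> by auto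
      qed
      then show ?thesis
        by (intro uniform_limit_cong'[THEN iffD1, OF _ _ l]) auto
    qed
    have ex: "\<exists>h. \<forall>y\<in>ball x e. (\<lambda>n. pdw w (f n) y) \<longlonglongrightarrow> h y \<and>
        (h has_derivative (\<lambda>h. \<Sum>b\<in>Basis. (h \<bullet> b) *\<^sub>R g (b # w) y)) (at y within ball x e)"
    proof (rule has_derivative_sequence[where ?x0.0 = x and l = "g w x"])
      show "(pdw w (f n) has_derivative (\<lambda>h. \<Sum>b\<in>Basis. (h \<bullet> b) *\<^sub>R pdw (b # w) (f n) y)) (at y within ball x e)"
        if "y \<in> ball x e" for n y
      proof -
        have d: "pdw w (f n) differentiable (at y)"
          using that e(2) w sm smooth_on_differentiable smooth_on_pdw by blast
        have "(\<lambda>h. pd h (pdw w (f n)) y) = (\<lambda>h. \<Sum>b\<in>Basis. (h \<bullet> b) *\<^sub>R pdw (b # w) (f n) y)"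
          by (rule ext, subst pd_expand[OF d]) (simp add: scaleR_conv_of_real)
        then show ?thesis using has_derivative_at_withinI[OF has_derivative_pd[OF d]] by simp
      qed
      show "convex (ball x e)" by simp
      show "x \<in> ball x e" using e by simp
      show "(\<lambda>n. pdw w (f n) x) \<longlonglongrightarrow> g w x" by (rule lim[OF w x])
      fix r :: real assume "r > 0"
      define D where "D = real DIM('a)"
      have D: "D > 0" by (simp add: D_def)
      have "\<forall>\<^sub>F n in sequentially. \<forall>y\<in>ball x e. dist (pdw (b # w) (f n) y) (g (b # w) y) < r / D" if "b \<in> Basis" for b
        using ul[OF that] \<open>r > 0\<close> D unfolding uniform_limit_iff by simp
      then have "\<forall>\<^sub>F n in sequentially. \<forall>b\<in>Basis. \<forall>y\<in>ball x e. dist (pdw (b # w) (f n) y) (g (b # w) y) < r / D"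
        by (simp add: eventually_ball_finite)
      then show "\<forall>\<^sub>F n in sequentially. \<forall>y\<in>ball x e. \<forall>h.
          norm ((\<Sum>b\<in>Basis. (h \<bullet> b) *\<^sub>R pdw (b # w) (f n) y) - (\<Sum>b\<in>Basis. (h \<bullet> b) *\<^sub>R g (b # w) y)) \<le> r * norm h"
      proof (eventually_elim, intro ballI allI)
        fix n y h
        assume A: "\<forall>b\<in>Basis. \<forall>y\<in>ball x e. dist (pdw (b # w) (f n) y) (g (b # w) y) < r / D" and y: "y \<in> ball x e"
        have "norm ((\<Sum>b\<in>Basis. (h \<bullet> b) *\<^sub>R pdw (b # w) (f n) y) - (\<Sum>b\<in>Basis. (h \<bullet> b) *\<^sub>R g (b # w) y)) =
            norm (\<Sum>b\<in>Basis. (h \<bullet> b) *\<^sub>R (pdw (b # w) (f n) y - g (b # w) y))"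
          by (simp add: sum_subtractf scaleR_diff_right)
        also have "\<dots> \<le> (\<Sum>b\<in>(Basis::'a set). norm h * (r / D))"
        proof (rule sum_norm_le)
          fix b :: 'a assume b: "b \<in> Basis"
          have "norm (pdw (b # w) (f n) y - g (b # w) y) \<le> r / D"
            using A b y by (auto simp: dist_norm less_imp_le)
          then show "norm ((h \<bullet> b) *\<^sub>R (pdw (b # w) (f n) y - g (b # w) y)) \<le> norm h * (r / D)"
            unfolding norm_scaleR using Basis_le_norm[OF b, of h] by (intro mult_mono) auto
        qed
        also have "\<dots> = r * norm h" using D by (simp add: D_def)
        finally show "norm ((\<Sum>b\<in>Basis. (h \<bullet> b) *\<^sub>R pdw (b # w) (f n) y) - (\<Sum>b\<in>Basis. (h \<bullet> b) *\<^sub>R g (b # w) y)) \<le> r * norm h" .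
      qed
    qed
    have "x \<in> ball x e" using e(1) by simp
    obtain h where h': "\<And>y. y \<in> ball x e \<Longrightarrow> (\<lambda>n. pdw w (f n) y) \<longlonglongrightarrow> h y \<and>
        (h has_derivative (\<lambda>h. \<Sum>b\<in>Basis. (h \<bullet> b) *\<^sub>R g (b # w) y)) (at y within ball x e)"
      using ex by blast
    have h: "\<And>y. y \<in> ball x e \<Longrightarrow> (\<lambda>n. pdw w (f n) y) \<longlonglongrightarrow> h y"
      "(h has_derivative (\<lambda>h. \<Sum>b\<in>Basis. (h \<bullet> b) *\<^sub>R g (b # w) x)) (at x within ball x e)"
      using h' \<open>x \<in> ball x e\<close> by (blast, blast)
    have "h y = g w y" if "y \<in> ball x e" for y
      using LIMSEQ_unique[OF h(1)[OF that] lim[OF w subsetD[OF e(2) that]]] .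
    moreover have "(h has_derivative (\<lambda>h. \<Sum>b\<in>Basis. (h \<bullet> b) *\<^sub>R g (b # w) x)) (at x)"
      using h(2) by (simp only: at_within_open[OF \<open>x \<in> ball x e\<close> open_ball])
    ultimately show ?thesis
      using has_derivative_transform_within_open[of h _ x UNIV "ball x e"] \<open>x \<in> ball x e\<close> open_ball by blast
  qed
  have pdg: "pd b (g w) x = g (b # w) x" if "b \<in> Basis" "set w \<subseteq> Basis" "x \<in> X" for b w x
  proof -
    have "(\<Sum>a\<in>Basis. (b \<bullet> a) *\<^sub>R g (a # w) x) = (\<Sum>a\<in>Basis. if a = b then g (a # w) x else 0)"
      using that(1) by (intro sum.cong) (auto simp: inner_Basis)
    then show ?thesis using pd_eqI[OF der[OF that(2,3)], of b] that(1) by simp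
  qed
  have smg: "smooth_on X (g [])"
  proof (rule smooth_onI[of "g ` {w. set w \<subseteq> Basis}"])
    show "f differentiable (at x)" if "f \<in> g ` {w. set w \<subseteq> Basis}" "x \<in> X" for f x
      using differentiableI[OF der] that by blast
    show "\<exists>h\<in>g ` {w. set w \<subseteq> Basis}. \<forall>x\<in>X. h x = pd b f x" if "f \<in> g ` {w. set w \<subseteq> Basis}" "b \<in> Basis" for f b
    proof -
      from that obtain w where w: "set w \<subseteq> Basis" "f = g w" by blast
      show ?thesis using w pdg[OF that(2) w(1)] that(2) by (intro bexI[of _ "g (b # w)"]) auto
    qed
    show "g [] \<in> g ` {w. set w \<subseteq> Basis}" by (intro imageI) simp
  qed (rule assms)
  have "pdw w (g []) x = g w x" if "set w \<subseteq> Basis" "x \<in> X" for w x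
    using that
  proof (induction w arbitrary: x)
    case (Cons b w)
    then have "pd b (pdw w (g [])) x = pd b (g w) x"
      by (intro pd_cong[OF \<open>open X\<close>]) auto
    then show ?case using pdg[of b w x] Cons.prems by simp
  qed simp
  then show ?thesis using lim by (intro that[OF smg]) simp
qed

subsection \<open>Test functions\<close>

text \<open>For \<open>p = 1\<close> this is the flat function exp (- 1 / s), extended by 0. The
  polynomial factor makes the class closed under differentiation.\<close>

definition ebump :: "real poly \<Rightarrow> real \<Rightarrow> real" where
  "ebump p s = (if s > 0 then poly p (1 / s) * exp (- (1 / s)) else 0)"

lemma ebump_tendsto_0: "(ebump p \<longlongrightarrow> 0) (at 0)"
proof -
  have "((\<lambda>y. poly p y * exp (- y)) \<longlongrightarrow> 0) at_top"
  proof -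
    have "((\<lambda>y::real. \<Sum>i\<le>degree p. coeff p i * (y ^ i / exp y)) \<longlongrightarrow> (\<Sum>i\<le>degree p. coeff p i * 0)) at_top"
      by (intro tendsto_sum tendsto_mult tendsto_const tendsto_power_div_exp_0)
    then show ?thesis
      by (simp add: poly_altdef exp_minus sum_distrib_right field_simps sum_divide_distrib)
  qed
  moreover have "filterlim (\<lambda>s::real. 1 / s) at_top (at_right 0)"
    using filterlim_inverse_at_top_right by (simp add: inverse_eq_divide)
  ultimately have "((\<lambda>s. poly p (1 / s) * exp (- (1 / s))) \<longlongrightarrow> 0) (at_right 0)"
    by (rule filterlim_compose)
  then have "(ebump p \<longlongrightarrow> 0) (at_right 0)"
    by (rule Lim_transform_eventually) (auto simp: ebump_def eventually_at_right_field intro!: exI[of _ 1])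
  moreover have "(ebump p \<longlongrightarrow> 0) (at_left 0)"
    by (rule Lim_transform_eventually[OF tendsto_const])
       (auto simp: ebump_def eventually_at_left_field intro!: exI[of _ "-1"])
  ultimately show ?thesis by (simp add: filterlim_at_split)
qed

lemma ebump_has_derivative:
  "(ebump p has_real_derivative ebump ([:0, 0, 1:] * (p - pderiv p)) s) (at s)"
proof -
  consider "s > 0" | "s < 0" | "s = 0" by linarith
  then show ?thesis
  proof cases
    case 1
    have "((\<lambda>s. poly p (1 / s) * exp (- (1 / s))) has_real_derivative
        ebump ([:0, 0, 1:] * (p - pderiv p)) s) (at s)"
      using 1 by (auto intro!: derivative_eq_intros simp: ebump_def field_simps power2_eq_square)
    then show ?thesis
      by (rule has_field_derivative_transform_within_open[where S = "{0<..}"]) (use 1 in \<open>auto simp: ebump_def\<close>)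
  next
    case 2
    have "((\<lambda>s. 0) has_real_derivative ebump ([:0, 0, 1:] * (p - pderiv p)) s) (at s)"
      using 2 by (simp add: ebump_def)
    then show ?thesis
      by (rule has_field_derivative_transform_within_open[where S = "{..<0}"]) (use 2 in \<open>auto simp: ebump_def\<close>)
  next
    case 3
    \<comment> \<open>The difference quotient of \<open>ebump p\<close> at 0 is of the same kind:
      dividing by \<open>s\<close> multiplies the polynomial by its variable 1 / s, which gives
      \<open>pCons 0 p\<close>.\<close>
    have "(ebump (pCons 0 p) \<longlongrightarrow> 0) (at 0)" by (rule ebump_tendsto_0)
    then have "((\<lambda>h. (ebump p (0 + h) - ebump p 0) / h) \<longlongrightarrow> 0) (at 0)"
      by (rule Lim_transform_eventually) (auto simp: ebump_def eventually_at_filter)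
    then show ?thesis unfolding 3 DERIV_def by (simp add: ebump_def)
  qed
qed

lemma smooth_on_ebump:
  assumes "open X" "smooth_on X (\<lambda>z. complex_of_real (g z))"
  shows "smooth_on X (\<lambda>z. complex_of_real (ebump p (g z)))"
proof -
  define P where "P = rec_nat p (\<lambda>_ q. [:0, 0, 1:] * (q - pderiv q))"
  have "smooth_on X (\<lambda>z. complex_of_real (ebump (P 0) (g z)))"
  proof (rule smooth_on_comp_real[of X "\<lambda>j s. complex_of_real (ebump (P j) s)" g 0, OF assms(1) _ assms(2)])
    fix j s
    have "P (Suc j) = [:0, 0, 1:] * (P j - pderiv (P j))" by (simp add: P_def)
    then have "(ebump (P j) has_vector_derivative ebump (P (Suc j)) s) (at s)"
      using ebump_has_derivative[of "P j" s] by (simp add: has_real_derivative_iff_has_vector_derivative)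
    then show "((\<lambda>s. complex_of_real (ebump (P j) s)) has_vector_derivative complex_of_real (ebump (P (Suc j)) s)) (at s)"
      by (rule bounded_linear.has_vector_derivative[OF bounded_linear_of_real])
  qed
  then show ?thesis by (simp add: P_def)
qed

lemma ball_bump:
  fixes p :: "'a::euclidean_space"
  assumes "r > 0"
  obtains \<eta> where "smooth_on UNIV \<eta>" "\<And>z. z \<in> ball p (r / 2) \<Longrightarrow> \<eta> z = 1"
    "\<And>z. z \<notin> ball p r \<Longrightarrow> \<eta> z = 0"
proof -
  define e where "e = ebump 1"
  \<comment> \<open>\<open>q\<close> is at most 0 on the ball of radius r / 2 and at least 1 / 2 off
    the ball of radius r. As \<open>e\<close> vanishes on nonpositive numbers and is increasing on
    positive ones, \<open>e (c - e (q z))\<close> is \<open>e c\<close> on the former set and 0 on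
    the latter; division by \<open>e c\<close> normalises.\<close>
  define c where "c = e (1 / 2)"
  define q where "q z = (z - p) \<bullet> (z - p) / r\<^sup>2 - 1 / 4" for z
  define \<eta> where "\<eta> z = complex_of_real (1 / e c) * complex_of_real (e (c - e (q z)))" for z
  have c: "c > 0" and ec: "e c > 0" by (auto simp: c_def e_def ebump_def)
  have q: "smooth_on UNIV (\<lambda>z. complex_of_real (q z))"
  proof -
    have "(\<lambda>z. complex_of_real (q z)) = (\<lambda>z. complex_of_real (1 / r\<^sup>2) *
        (\<Sum>b\<in>Basis. (complex_of_real (z \<bullet> b) - complex_of_real (p \<bullet> b)) * (complex_of_real (z \<bullet> b) - complex_of_real (p \<bullet> b))) - 1 / 4)"
    proof
      fix z
      have "(z - p) \<bullet> (z - p) = (\<Sum>b\<in>Basis. (z \<bullet> b - p \<bullet> b) * (z \<bullet> b - p \<bullet> b))"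
        by (subst euclidean_inner) (simp add: inner_diff_left)
      then show "complex_of_real (q z) = complex_of_real (1 / r\<^sup>2) *
        (\<Sum>b\<in>Basis. (complex_of_real (z \<bullet> b) - complex_of_real (p \<bullet> b)) * (complex_of_real (z \<bullet> b) - complex_of_real (p \<bullet> b))) - 1 / 4"
        by (simp add: q_def)
    qed
    then show ?thesis
      by (simp only:) (intro smooth_on_diff smooth_on_mult smooth_on_sum smooth_on_of_real_inner smooth_on_const open_UNIV)
  qed
  have "smooth_on UNIV (\<lambda>z. complex_of_real (c - e (q z)))"
    using smooth_on_diff[OF open_UNIV smooth_on_const smooth_on_ebump[OF open_UNIV q, of 1], of "complex_of_real c"]
    by (simp add: e_def)
  then have "smooth_on UNIV \<eta>"
    unfolding \<eta>_def e_def by (intro smooth_on_mult smooth_on_ebump smooth_on_const) auto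
  moreover have "\<eta> z = 1" if "z \<in> ball p (r / 2)" for z
  proof -
    have "norm (z - p) ^ 2 \<le> (r / 2)\<^sup>2"
      using that by (intro power_mono) (auto simp: dist_norm norm_minus_commute)
    then have "q z \<le> 0" using assms
      by (auto simp: q_def dot_square_norm field_simps power2_eq_square)
    then have "e (q z) = 0" by (simp add: e_def ebump_def)
    then show ?thesis using ec by (simp add: \<eta>_def)
  qed
  moreover have "\<eta> z = 0" if "z \<notin> ball p r" for z
  proof -
    have "r\<^sup>2 \<le> norm (z - p) ^ 2"
      using that assms by (intro power_mono) (auto simp: dist_norm norm_minus_commute)
    then have "1 \<le> (z - p) \<bullet> (z - p) / r\<^sup>2" using assms by (simp add: dot_square_norm)
    then have "1 / 2 \<le> q z" by (simp add: q_def)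
    then have "c \<le> e (q z)" by (auto simp: c_def e_def ebump_def field_simps)
    then show ?thesis by (simp add: \<eta>_def e_def ebump_def)
  qed
  ultimately show ?thesis by (rule that)
qed

section \<open>Compactly supported smooth functions and partitions of unity\<close>

definition test :: "'a::euclidean_space set \<Rightarrow> ('a \<Rightarrow> complex) \<Rightarrow> bool" where
  "test U \<eta> \<longleftrightarrow> smooth_on UNIV \<eta> \<and> (\<exists>S. compact S \<and> S \<subseteq> U \<and> (\<forall>z. z \<notin> S \<longrightarrow> \<eta> z = 0))"

lemma test_mono: "test U \<eta> \<Longrightarrow> U \<subseteq> V \<Longrightarrow> test V \<eta>"
  unfolding test_def by blast

lemma test_smooth: "test U \<eta> \<Longrightarrow> smooth_on X \<eta>"
  unfolding test_def using smooth_on_subset by blast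

text \<open>The product is smooth on \<open>U\<close> and vanishes on the complement of the support,
  and these two open sets cover the space. In this way a solution, whose values off its domain are
  arbitrary, enters the Fourier analysis.\<close>

lemma test_mult:
  assumes "open U" "test U \<eta>" "smooth_on U f"
  shows "test U (\<lambda>z. \<eta> z * f z)"
proof -
  obtain S where S: "compact S" "S \<subseteq> U" "\<And>z. z \<notin> S \<Longrightarrow> \<eta> z = 0"
    using assms(2) unfolding test_def by blast
  have "open (- S)" using S(1) compact_imp_closed by auto
  have 1: "smooth_on U (\<lambda>z. \<eta> z * f z)"
    by (intro smooth_on_mult assms test_smooth[OF assms(2)])
  have 2: "smooth_on (- S) (\<lambda>z. \<eta> z * f z)"
    by (rule smooth_on_cong[OF \<open>open (- S)\<close>, of "\<lambda>z. 0"]) (use S in auto)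
  have "smooth_on (U \<union> (- S)) (\<lambda>z. \<eta> z * f z)"
  proof -
    have "Ck_on k U g \<Longrightarrow> Ck_on k (- S) g \<Longrightarrow> Ck_on k (U \<union> - S) g" for k and g :: "'a \<Rightarrow> complex"
      by (induction k arbitrary: g) (use assms(1) \<open>open (- S)\<close> in \<open>auto intro: continuous_on_open_Un\<close>)
    then show ?thesis using 1 2 by (auto simp: smooth_on_def)
  qed
  moreover have "U \<union> (- S) = UNIV" using S by auto
  ultimately show ?thesis unfolding test_def using S by auto
qed

lemma test_mult_test: "test U \<eta> \<Longrightarrow> test V \<psi> \<Longrightarrow> test U (\<lambda>z. \<eta> z * \<psi> z)"
  unfolding test_def by (auto intro: smooth_on_mult)

lemma test_add:
  assumes "test U \<eta>" "test U \<psi>" shows "test U (\<lambda>z. \<eta> z + \<psi> z)"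
proof -
  obtain S T where "compact S" "S \<subseteq> U" "\<forall>z. z \<notin> S \<longrightarrow> \<eta> z = 0" "compact T" "T \<subseteq> U" "\<forall>z. z \<notin> T \<longrightarrow> \<psi> z = 0"
    using assms unfolding test_def by blast
  moreover have "smooth_on UNIV (\<lambda>z. \<eta> z + \<psi> z)"
    using assms by (auto simp: test_def intro: smooth_on_add)
  ultimately show ?thesis unfolding test_def by (auto intro!: exI[of _ "S \<union> T"])
qed

lemma test_cmult: "test U \<eta> \<Longrightarrow> test U (\<lambda>z. c * \<eta> z)"
  unfolding test_def by (auto intro!: smooth_on_mult[OF open_UNIV smooth_on_const])

lemma test_diff: "test U \<eta> \<Longrightarrow> test U \<psi> \<Longrightarrow> test U (\<lambda>z. \<eta> z - \<psi> z)"
  using test_add[of U \<eta> "\<lambda>z. -1 * \<psi> z"] test_cmult[of U \<psi> "-1"] by simp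

lemma test_zero: "test U (\<lambda>z. 0)"
  unfolding test_def by (auto intro!: exI[of _ "{}"])

lemma test_sum: "(\<And>i. i \<in> I \<Longrightarrow> test U (f i)) \<Longrightarrow> test U (\<lambda>z. \<Sum>i\<in>I. f i z)"
  by (induction I rule: infinite_finite_induct) (auto intro: test_add test_zero)

lemma test_pd:
  assumes "test U \<eta>" "b \<in> Basis"
  shows "test U (pd b \<eta>)"
proof -
  obtain S where S: "compact S" "S \<subseteq> U" "\<And>z. z \<notin> S \<Longrightarrow> \<eta> z = 0"
    using assms(1) unfolding test_def by blast
  have "open (- S)" using S(1) compact_imp_closed by auto
  then have "pd b \<eta> z = 0" if "z \<notin> S" for z
    using pd_cong[of "- S" \<eta> "\<lambda>_. 0" z b] S that by auto
  moreover have "smooth_on UNIV (pd b \<eta>)" using assms by (auto simp: test_def intro: smooth_on_pd)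
  ultimately show ?thesis unfolding test_def using S by blast
qed

lemma test_pdw: "test U \<eta> \<Longrightarrow> set w \<subseteq> Basis \<Longrightarrow> test U (pdw w \<eta>)"
  by (induction w) (auto intro: test_pd)

text \<open>Each new function is its bump times what the earlier ones leave of 1. This keeps 1 minus
  the sum equal to the product of the \<open>1 - \<eta> p z\<close>, which vanishes wherever one
  bump is 1. The radii are prescribed because each point will dictate how large the singular set
  around it may be.\<close>

lemma partition_of_compact:
  fixes Y :: "'a::euclidean_space set"
  assumes "compact Y" and r: "\<And>p. p \<in> Y \<Longrightarrow> r p > 0"
  obtains F \<psi> N where "finite F" "F \<subseteq> Y" "\<And>p. smooth_on UNIV (\<psi> p)"
    "\<And>p z. z \<notin> ball p (r p) \<Longrightarrow> p \<in> F \<Longrightarrow> \<psi> p z = 0" "open N" "Y \<subseteq> N" "\<And>z. z \<in> N \<Longrightarrow> (\<Sum>p\<in>F. \<psi> p z) = 1"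
proof -
  have "\<exists>\<eta>. smooth_on UNIV \<eta> \<and> (\<forall>z\<in>ball p (r p / 2). \<eta> z = 1) \<and> (\<forall>z. z \<notin> ball p (r p) \<longrightarrow> \<eta> z = 0)" if "p \<in> Y" for p
    using ball_bump[OF r[OF that], of p] by metis
  then obtain \<eta> where \<eta>: "\<And>p. p \<in> Y \<Longrightarrow> smooth_on UNIV (\<eta> p) \<and> (\<forall>z\<in>ball p (r p / 2). \<eta> p z = 1) \<and> (\<forall>z. z \<notin> ball p (r p) \<longrightarrow> \<eta> p z = 0)"
    by metis
  have "Y \<subseteq> (\<Union>p\<in>Y. ball p (r p / 2))" using r by force
  then obtain F where F: "F \<subseteq> Y" "finite F" "Y \<subseteq> (\<Union>p\<in>F. ball p (r p / 2))"
    using compactE_image[OF assms(1), of Y "\<lambda>p. ball p (r p / 2)"] by auto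
  have "\<exists>\<psi>. (\<forall>p. smooth_on UNIV (\<psi> p)) \<and> (\<forall>p\<in>F. \<forall>z. z \<notin> ball p (r p) \<longrightarrow> \<psi> p z = 0) \<and>
      (\<forall>z. 1 - (\<Sum>p\<in>F. \<psi> p z) = (\<Prod>p\<in>F. 1 - \<eta> p z))"
    using F(2,1)
  proof (induction F rule: finite_induct)
    case empty
    then show ?case by (auto intro!: exI[of _ "\<lambda>_ _. 0"])
  next
    case (insert a F)
    have "F \<subseteq> Y" using insert.prems by simp
    from insert.IH[OF this] obtain \<psi> where \<psi>0: "(\<forall>p. smooth_on UNIV (\<psi> p)) \<and> (\<forall>p\<in>F. \<forall>z. z \<notin> ball p (r p) \<longrightarrow> \<psi> p z = 0) \<and>
      (\<forall>z. 1 - (\<Sum>p\<in>F. \<psi> p z) = (\<Prod>p\<in>F. 1 - \<eta> p z))" ..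
    have \<psi>: "\<And>p. smooth_on UNIV (\<psi> p)" "\<And>p z. p \<in> F \<Longrightarrow> z \<notin> ball p (r p) \<Longrightarrow> \<psi> p z = 0"
      "\<And>z. 1 - (\<Sum>p\<in>F. \<psi> p z) = (\<Prod>p\<in>F. 1 - \<eta> p z)" using \<psi>0 by blast+
    define \<psi>' where "\<psi>' = \<psi>(a := \<lambda>z. \<eta> a z * (1 - (\<Sum>p\<in>F. \<psi> p z)))"
    have "smooth_on UNIV (\<psi>' p)" for p
      using \<psi>(1) \<eta>[of a] insert.prems unfolding \<psi>'_def
      by (auto intro!: smooth_on_mult smooth_on_diff smooth_on_sum)
    moreover have "\<psi>' p z = 0" if "p \<in> insert a F" "z \<notin> ball p (r p)" for p z
      using \<psi>(2)[of p z] \<eta>[of a] insert.prems that by (auto simp: \<psi>'_def)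
    moreover have "1 - (\<Sum>p\<in>insert a F. \<psi>' p z) = (\<Prod>p\<in>insert a F. 1 - \<eta> p z)" for z
    proof -
      have "(\<Sum>p\<in>F. \<psi>' p z) = (\<Sum>p\<in>F. \<psi> p z)"
        using insert.hyps by (intro sum.cong) (auto simp: \<psi>'_def)
      then show ?thesis using insert.hyps
        by (simp add: \<psi>(3)[symmetric]) (simp add: \<psi>'_def algebra_simps)
    qed
    ultimately show ?case by blast
  qed
  then obtain \<psi> where \<psi>: "\<And>p. smooth_on UNIV (\<psi> p)" "\<And>p z. p \<in> F \<Longrightarrow> z \<notin> ball p (r p) \<Longrightarrow> \<psi> p z = 0"
      "\<And>z. 1 - (\<Sum>p\<in>F. \<psi> p z) = (\<Prod>p\<in>F. 1 - \<eta> p z)" by auto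
  show ?thesis
  proof (rule that)
    show "finite F" "F \<subseteq> Y" "open (\<Union>p\<in>F. ball p (r p / 2))" "Y \<subseteq> (\<Union>p\<in>F. ball p (r p / 2))"
      using F by auto
    show "smooth_on UNIV (\<psi> p)" for p by (rule \<psi>(1))
    show "\<psi> p z = 0" if "z \<notin> ball p (r p)" "p \<in> F" for p z using \<psi>(2) that by blast
    show "(\<Sum>p\<in>F. \<psi> p z) = 1" if z: "z \<in> (\<Union>p\<in>F. ball p (r p / 2))" for z
    proof -
      obtain p where "p \<in> F" "z \<in> ball p (r p / 2)" using z by blast
      then have "(\<Prod>p\<in>F. 1 - \<eta> p z) = 0" using \<eta>[of p] F
        by (intro prod_zero[OF F(2)] bexI[of _ p]) (auto simp: subset_eq)
      then show ?thesis using \<psi>(3)[of z] by simp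
    qed
  qed
qed

lemma test_one_near_compact:
  fixes E :: "'a::euclidean_space set"
  assumes "compact E" "E \<subseteq> W" "open W"
  obtains \<eta> N where "test W \<eta>" "open N" "E \<subseteq> N" "\<And>z. z \<in> N \<Longrightarrow> \<eta> z = 1"
proof -
  have "\<exists>r>0. cball p r \<subseteq> W" if "p \<in> E" for p
    using assms(2,3) that open_contains_cball by blast
  then obtain r where r: "\<And>p. p \<in> E \<Longrightarrow> r p > 0 \<and> cball p (r p) \<subseteq> W" by metis
  obtain F \<psi> N where F: "finite F" "F \<subseteq> E" "\<And>p. smooth_on UNIV (\<psi> p)"
    "\<And>p z. z \<notin> ball p (r p) \<Longrightarrow> p \<in> F \<Longrightarrow> \<psi> p z = 0" "open N" "E \<subseteq> N" "\<And>z. z \<in> N \<Longrightarrow> (\<Sum>p\<in>F. \<psi> p z) = 1"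
    by (rule partition_of_compact[OF assms(1), of r]) (use r in auto)
  have "test W (\<psi> p)" if "p \<in> F" for p
  proof -
    have "\<psi> p z = 0" if "z \<notin> cball p (r p)" for z
      using F(4)[of z p] that \<open>p \<in> F\<close> by auto
    moreover have "cball p (r p) \<subseteq> W" using F(2) r that by blast
    ultimately show ?thesis unfolding test_def using F(3)
      by (intro conjI exI[of _ "cball p (r p)"]) (simp_all add: subset_eq)
  qed
  then have "test W (\<lambda>z. \<Sum>p\<in>F. \<psi> p z)" by (rule test_sum)
  then show ?thesis using that F by blast
qed

subsection \<open>Fourier coefficients\<close>

text \<open>The unnormalised Fourier transform. For a function supported in a cube, its values on
  the dual lattice are the Fourier coefficients times the volume of the cube.\<close>

definition hat :: "('a::euclidean_space \<Rightarrow> complex) \<Rightarrow> 'a \<Rightarrow> complex" where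
  "hat \<phi> \<zeta> = (\<integral>z. \<phi> z * cis (- (\<zeta> \<bullet> z)) \<partial>lborel)"

lemma integrable_cont_compact_support:
  fixes f :: "'a::euclidean_space \<Rightarrow> complex"
  assumes "continuous_on UNIV f" "compact S" "\<And>z. z \<notin> S \<Longrightarrow> f z = 0"
  shows "integrable lborel f"
proof -
  have "integrable lborel (\<lambda>x. indicator S x *\<^sub>R f x)"
    using assms by (intro borel_integrable_compact) (auto intro: continuous_on_subset)
  moreover have "(\<lambda>x. indicator S x *\<^sub>R f x) = f"
    using assms(3) by (auto simp: indicator_def)
  ultimately show ?thesis by simp
qed

lemma test_integrable: "test U \<phi> \<Longrightarrow> integrable lborel \<phi>"
  unfolding test_def by (auto intro: integrable_cont_compact_support smooth_on_continuous_on)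

lemma test_bounded:
  assumes "test U \<phi>"
  obtains M where "M \<ge> 0" "\<And>z. cmod (\<phi> z) \<le> M"
proof -
  obtain S where S: "compact S" "\<And>z. z \<notin> S \<Longrightarrow> \<phi> z = 0" and c: "continuous_on UNIV \<phi>"
    using assms unfolding test_def using smooth_on_continuous_on by blast
  have "bounded (\<phi> ` S)"
    using S c by (intro compact_imp_bounded compact_continuous_image) (auto intro: continuous_on_subset)
  then obtain M where "M > 0" "\<And>z. z \<in> S \<Longrightarrow> cmod (\<phi> z) \<le> M" by (auto simp: bounded_pos)
  then show ?thesis using S(2) by (intro that[of M]) (metis norm_zero order_le_less)+
qed

lemma test_lipschitz:
  fixes \<phi> :: "'a::euclidean_space \<Rightarrow> complex"
  assumes "test U \<phi>"
  obtains M where "M \<ge> 0" "\<And>x y. cmod (\<phi> x - \<phi> y) \<le> M * norm (x - y)"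
proof -
  have "\<exists>M. \<forall>z. cmod (pd b \<phi> z) \<le> M" if "b \<in> Basis" for b
    using test_bounded[OF test_pd[OF assms that]] by metis
  then obtain M where M: "\<And>b z. b \<in> Basis \<Longrightarrow> cmod (pd b \<phi> z) \<le> M b" by metis
  have M0: "M b \<ge> 0" if "b \<in> Basis" for b using order_trans[OF norm_ge_zero M[OF that]] .
  define B where "B = sum M Basis"
  have d: "\<phi> differentiable (at z)" for z
    using assms smooth_on_differentiable[of UNIV \<phi>] by (simp add: test_def)
  have "cmod (pd h \<phi> z) \<le> B * norm h" for h z
  proof -
    have "cmod (\<Sum>b\<in>Basis. complex_of_real (h \<bullet> b) * pd b \<phi> z) \<le> (\<Sum>b\<in>Basis. norm h * M b)"
    proof (rule sum_norm_le)
      show "cmod (complex_of_real (h \<bullet> b) * pd b \<phi> z) \<le> norm h * M b" if "b \<in> Basis" for b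
        unfolding norm_mult norm_of_real using Basis_le_norm[OF that, of h] M[OF that]
        by (intro mult_mono) auto
    qed
    then show ?thesis by (subst pd_expand[OF d]) (simp add: B_def sum_distrib_left mult.commute)
  qed
  then have "onorm (\<lambda>h. pd h \<phi> z) \<le> B" for z
    by (intro onorm_bound) (auto simp: B_def intro!: sum_nonneg M0)
  then have "cmod (\<phi> x - \<phi> y) \<le> B * norm (x - y)" for x y
    by (intro differentiable_bound[of UNIV \<phi> "\<lambda>z h. pd h \<phi> z"]) (auto intro: has_derivative_pd d)
  moreover have "B \<ge> 0" unfolding B_def by (intro sum_nonneg M0)
  ultimately show ?thesis by (rule that[rotated])
qed

section \<open>Integration by parts\<close>

lemma integral_lborel_translate:
  fixes f :: "'a::euclidean_space \<Rightarrow> complex"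
  assumes "f \<in> borel_measurable borel"
  shows "(\<integral>z. f (z + a) \<partial>lborel) = (\<integral>z. f z \<partial>lborel)"
proof -
  have "(\<integral>z. f z \<partial>(distr lborel borel ((+) a))) = (\<integral>z. f (a + z) \<partial>lborel)"
    using assms by (intro integral_distr) auto
  then show ?thesis by (simp add: lborel_distr_plus add.commute)
qed

text \<open>Translation preserves the integral, so all difference quotients integrate to 0.
  Increments of length at most 1 keep their supports in a fixed ball, and the Lipschitz constant
  bounds them there, so dominated convergence passes to the derivative.\<close>

lemma integral_pd_eq_0:
  fixes \<phi> :: "'a::euclidean_space \<Rightarrow> complex"
  assumes "test U \<phi>" "b \<in> Basis"
  shows "(\<integral>z. pd b \<phi> z \<partial>lborel) = 0"
proof -
  obtain S where S: "compact S" "\<And>z. z \<notin> S \<Longrightarrow> \<phi> z = 0" using assms unfolding test_def by blast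
  obtain R where R: "\<And>z. z \<in> S \<Longrightarrow> norm z \<le> R" using compact_imp_bounded[OF S(1)] by (auto simp: bounded_iff)
  obtain M where M: "M \<ge> 0" "\<And>x y. cmod (\<phi> x - \<phi> y) \<le> M * norm (x - y)" using test_lipschitz[OF assms(1)] by blast
  have d: "\<phi> differentiable (at z)" for z
    using assms smooth_on_differentiable[of UNIV \<phi>] by (simp add: test_def)
  have m: "\<phi> \<in> borel_measurable borel"
    using test_integrable[OF assms(1)] by auto
  have nb: "norm b = 1" using assms(2) by simp
  define f where "f n z = (\<phi> (z + (1 / real (Suc n)) *\<^sub>R b) - \<phi> z) * real (Suc n)" for n z
  have "(\<lambda>n. \<integral>z. f n z \<partial>lborel) \<longlonglongrightarrow> (\<integral>z. pd b \<phi> z \<partial>lborel)"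
  proof (rule integral_dominated_convergence[where w = "\<lambda>z. indicator (cball 0 (R + 1)) z * M"])
    show "integrable lborel (\<lambda>z. indicator (cball 0 (R + 1)) z * M :: real)"
      by (auto intro!: integrable_mult_left integrable_real_indicator simp: emeasure_lborel_cball_finite[unfolded infinity_ennreal_def])
    show "pd b \<phi> \<in> borel_measurable lborel"
      using test_integrable[OF test_pd[OF assms]] by auto
    show "f n \<in> borel_measurable lborel" for n unfolding f_def using m by measurable
    show "AE z in lborel. (\<lambda>n. f n z) \<longlonglongrightarrow> pd b \<phi> z"
    proof (rule AE_I2)
      fix z
      have "((\<lambda>s. \<phi> (z + s *\<^sub>R b)) has_vector_derivative pd b \<phi> z) (at 0)"
      proof -
        have "((\<lambda>s. z + s *\<^sub>R b) has_derivative (\<lambda>s. s *\<^sub>R b)) (at 0)"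
          by (auto intro!: derivative_eq_intros)
        from has_derivative_compose[OF this, of \<phi> "\<lambda>h. pd h \<phi> z"] has_derivative_pd[OF d]
        show ?thesis unfolding has_vector_derivative_def
          using linear_scale[OF linear_pd[OF d]] by simp
      qed
      then have "(\<lambda>h. norm (\<phi> (z + h *\<^sub>R b) - \<phi> z - h *\<^sub>R pd b \<phi> z) / norm h) \<midarrow>0\<rightarrow> 0"
        unfolding has_vector_derivative_def has_derivative_at by simp
      then have "(\<lambda>h. norm (inverse h *\<^sub>R (\<phi> (z + h *\<^sub>R b) - \<phi> z) - pd b \<phi> z)) \<midarrow>0\<rightarrow> 0"
      proof (rule Lim_transform_eventually)
        have "norm (\<phi> (z + h *\<^sub>R b) - \<phi> z - h *\<^sub>R pd b \<phi> z) / norm h =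
            norm (inverse h *\<^sub>R (\<phi> (z + h *\<^sub>R b) - \<phi> z) - pd b \<phi> z)" if "h \<noteq> 0" for h
        proof -
          have "inverse h *\<^sub>R (\<phi> (z + h *\<^sub>R b) - \<phi> z) - pd b \<phi> z =
              inverse h *\<^sub>R (\<phi> (z + h *\<^sub>R b) - \<phi> z - h *\<^sub>R pd b \<phi> z)"
            using that by (simp add: scaleR_diff_right)
          then show ?thesis by (simp add: divide_inverse mult.commute)
        qed
        then show "\<forall>\<^sub>F h in at 0. norm (\<phi> (z + h *\<^sub>R b) - \<phi> z - h *\<^sub>R pd b \<phi> z) / norm h =
            norm (inverse h *\<^sub>R (\<phi> (z + h *\<^sub>R b) - \<phi> z) - pd b \<phi> z)"
          by (auto simp: eventually_at_filter)
      qed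
      then have "((\<lambda>h. inverse h *\<^sub>R (\<phi> (z + h *\<^sub>R b) - \<phi> z)) \<longlongrightarrow> pd b \<phi> z) (at 0)"
        unfolding tendsto_norm_zero_iff by (subst Lim_null)
      moreover have "filterlim (\<lambda>n. 1 / real (Suc n)) (at 0) sequentially"
        unfolding filterlim_at using LIMSEQ_inverse_real_of_nat by (simp add: inverse_eq_divide)
      ultimately have "(\<lambda>n. inverse (1 / real (Suc n)) *\<^sub>R (\<phi> (z + (1 / real (Suc n)) *\<^sub>R b) - \<phi> z)) \<longlonglongrightarrow> pd b \<phi> z"
        by (rule filterlim_compose)
      then show "(\<lambda>n. f n z) \<longlonglongrightarrow> pd b \<phi> z"
        by (simp add: f_def scaleR_conv_of_real mult.commute)
    qed
    show "AE z in lborel. norm (f n z) \<le> indicator (cball 0 (R + 1)) z * M" for n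
    proof (rule AE_I2)
      fix z
      have *: "norm ((1 / real (Suc n)) *\<^sub>R b) \<le> 1" using nb by simp
      show "norm (f n z) \<le> indicator (cball 0 (R + 1)) z * M"
      proof (cases "norm z \<le> R + 1")
        case True
        have "norm (f n z) \<le> (M * norm ((1 / real (Suc n)) *\<^sub>R b)) * real (Suc n)"
          unfolding f_def norm_mult using M(2)[of "z + (1 / real (Suc n)) *\<^sub>R b" z]
          M(1) by (intro mult_mono) (simp_all del: of_nat_Suc)
        then show ?thesis using True nb by simp
      next
        case False
        have "z \<notin> S" using R False by force
        moreover have "z + (1 / real (Suc n)) *\<^sub>R b \<notin> S"
          using R[of "z + (1 / real (Suc n)) *\<^sub>R b"] False * norm_diff_ineq[of z "(1 / real (Suc n)) *\<^sub>R b"] by linarith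
        ultimately show ?thesis using M(1) by (simp add: f_def S(2) indicator_def)
      qed
    qed
  qed
  moreover have "(\<integral>z. f n z \<partial>lborel) = 0" for n
  proof -
    have "integrable lborel (\<lambda>z. \<phi> (z + (1 / real (Suc n)) *\<^sub>R b))"
      using integrable_distr_eq[of "(+) ((1 / real (Suc n)) *\<^sub>R b)" lborel borel \<phi>] m test_integrable[OF assms(1)]
      by (simp add: lborel_distr_plus add.commute)
    then show ?thesis unfolding f_def
      using integral_lborel_translate[OF m, of "(1 / real (Suc n)) *\<^sub>R b"] test_integrable[OF assms(1)]
      by (simp del: of_nat_Suc)
  qed
  ultimately show ?thesis by (simp add: LIMSEQ_const_iff)
qed

lemma cis_inner_has_derivative:
  "((\<lambda>z. cis (\<zeta> \<bullet> z)) has_derivative (\<lambda>h. \<i> * of_real (\<zeta> \<bullet> h) * cis (\<zeta> \<bullet> z))) (at z)"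
  by (auto intro!: derivative_eq_intros simp: algebra_simps scaleR_conv_of_real)

lemma smooth_on_cis_inner: "smooth_on X (\<lambda>z::'a::euclidean_space. cis (\<zeta> \<bullet> z))"
proof -
  have "smooth_on UNIV (\<lambda>z::'a. \<i> ^ 0 * cis (\<zeta> \<bullet> z))"
  proof (rule smooth_on_comp_real[where F = "\<lambda>j s. \<i> ^ j * cis s" and j = 0])
    show "((\<lambda>s. \<i> ^ j * cis s) has_vector_derivative \<i> ^ Suc j * cis s) (at s)" for j s
      unfolding has_vector_derivative_def
      by (auto intro!: derivative_eq_intros simp: algebra_simps scaleR_conv_of_real)
    show "smooth_on UNIV (\<lambda>z. complex_of_real (\<zeta> \<bullet> z))"
      using smooth_on_of_real_inner[of UNIV \<zeta>] by (simp add: inner_commute)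
  qed simp
  then show ?thesis using smooth_on_subset by auto
qed

lemma pd_cis_inner: "pd b (\<lambda>z. cis (\<zeta> \<bullet> z)) = (\<lambda>z. \<i> * of_real (\<zeta> \<bullet> b) * cis (\<zeta> \<bullet> z))"
  by (rule ext, rule pd_eqI, rule cis_inner_has_derivative)

text \<open>Apply \<open>integral_pd_eq_0\<close> to the product of \<phi> with the character and
  expand by the product rule.\<close>

lemma hat_pd:
  assumes "test U \<phi>" "b \<in> Basis"
  shows "hat (pd b \<phi>) \<zeta> = \<i> * of_real (\<zeta> \<bullet> b) * hat \<phi> \<zeta>"
proof -
  let ?e = "\<lambda>z. cis ((- \<zeta>) \<bullet> z)"
  have se: "smooth_on UNIV ?e" by (rule smooth_on_cis_inner)
  have t: "test UNIV \<phi>" using assms test_mono by blast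
  have t1: "test UNIV (\<lambda>z. \<phi> z * ?e z)" by (rule test_mult[OF open_UNIV t se])
  have t2: "test UNIV (\<lambda>z. pd b \<phi> z * ?e z)" by (rule test_mult[OF open_UNIV test_pd[OF t assms(2)] se])
  have "pd b (\<lambda>z. \<phi> z * ?e z) = (\<lambda>z. pd b \<phi> z * ?e z - \<i> * of_real (\<zeta> \<bullet> b) * (\<phi> z * ?e z))"
    using pd_mult[of \<phi> _ ?e b] smooth_on_differentiable[OF test_smooth[OF t, of UNIV]] smooth_on_differentiable[OF se]
    unfolding pd_cis_inner by (auto simp: fun_eq_iff algebra_simps)
  then have "0 = (\<integral>z. pd b \<phi> z * ?e z - \<i> * of_real (\<zeta> \<bullet> b) * (\<phi> z * ?e z) \<partial>lborel)"
    using integral_pd_eq_0[OF t1 assms(2)] by simp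
  also have "\<dots> = (\<integral>z. pd b \<phi> z * ?e z \<partial>lborel) - (\<integral>z. \<i> * of_real (\<zeta> \<bullet> b) * (\<phi> z * ?e z) \<partial>lborel)"
    by (intro Bochner_Integration.integral_diff test_integrable[OF t2] integrable_mult_right test_integrable[OF t1])
  finally show ?thesis by (simp add: hat_def)
qed

lemma hat_pdw:
  assumes "test U \<phi>" "set w \<subseteq> Basis"
  shows "hat (pdw w \<phi>) \<zeta> = prod_list (map (\<lambda>b. \<i> * of_real (\<zeta> \<bullet> b)) w) * hat \<phi> \<zeta>"
  using assms(2) by (induction w) (auto simp: hat_pd[OF test_pdw[OF assms(1)]])

lemma test_cis_integrable: "test U \<phi> \<Longrightarrow> integrable lborel (\<lambda>z. \<phi> z * cis (\<zeta> \<bullet> z))"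
  using test_integrable[OF test_mult[OF open_UNIV test_mono[of U \<phi> UNIV] smooth_on_cis_inner]] by blast

lemma hat_diff: "test U \<phi> \<Longrightarrow> test V \<psi> \<Longrightarrow> hat (\<lambda>z. \<phi> z - \<psi> z) \<zeta> = hat \<phi> \<zeta> - hat \<psi> \<zeta>"
  unfolding hat_def using test_cis_integrable[of _ _ "- \<zeta>"] by (simp add: left_diff_distrib)

lemma hat_cmult: "hat (\<lambda>z. c * \<phi> z) \<zeta> = c * hat \<phi> \<zeta>"
  unfolding hat_def by (simp add: mult.assoc)

lemma hat_sum: "(\<And>i. i \<in> I \<Longrightarrow> test U (f i)) \<Longrightarrow> hat (\<lambda>z. \<Sum>i\<in>I. f i z) \<zeta> = (\<Sum>i\<in>I. hat (f i) \<zeta>)"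
  unfolding hat_def using test_cis_integrable[of U _ "- \<zeta>"]
  by (simp add: sum_distrib_right Bochner_Integration.integral_sum)

lemma hat_bound:
  "cmod (hat \<phi> \<zeta>) \<le> (\<integral>z. cmod (\<phi> z) \<partial>lborel)"
  unfolding hat_def by (rule order_trans[OF integral_norm_bound]) (simp add: norm_mult)

subsection \<open>The lattice of frequencies\<close>

definition qube :: "real \<Rightarrow> 'a::euclidean_space \<Rightarrow> 'a set" where
  "qube c z = {y. \<forall>b\<in>Basis. \<bar>(y - z) \<bullet> b\<bar> \<le> c}"

lemma qube_cbox: "qube c z = cbox (z - c *\<^sub>R One) (z + c *\<^sub>R One)"
  by (auto simp: qube_def cbox_def algebra_simps abs_le_iff)

lemma compact_qube [simp]: "compact (qube c z)"
  by (simp add: qube_cbox)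

lemma qube_sets [simp]: "qube c z \<in> sets borel"
  by (simp add: qube_cbox)

lemma qube_center [simp]: "0 \<le> c \<Longrightarrow> z \<in> qube c z"
  by (simp add: qube_def)

definition Lat :: "'a::euclidean_space set" where
  "Lat = {k. \<forall>b\<in>Basis. k \<bullet> b \<in> \<int>}"

lemma Lat_eq: "Lat = (\<lambda>f. \<Sum>b\<in>Basis. f b *\<^sub>R b) ` (Basis \<rightarrow>\<^sub>E (\<int> :: real set))"
proof (intro set_eqI iffI)
  fix k :: 'a assume "k \<in> Lat"
  then have "k = (\<Sum>b\<in>Basis. (\<lambda>b\<in>Basis. k \<bullet> b) b *\<^sub>R b)" "(\<lambda>b\<in>Basis. k \<bullet> b) \<in> Basis \<rightarrow>\<^sub>E \<int>"
    by (auto simp: Lat_def euclidean_representation)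
  then show "k \<in> (\<lambda>f. \<Sum>b\<in>Basis. f b *\<^sub>R b) ` (Basis \<rightarrow>\<^sub>E (\<int> :: real set))" by blast
qed (auto simp: Lat_def)

text \<open>The lattice is countable and infinite, so all of \<open>nat\<close> can index it and
  sums over it become ordinary series.\<close>

lemma Lat_enum:
  obtains kk :: "nat \<Rightarrow> 'a::euclidean_space" where "bij_betw kk UNIV Lat"
proof -
  have "countable (\<int> :: real set)" by (simp add: Ints_def)
  then have c: "countable (Lat :: 'a set)" unfolding Lat_eq
    by (intro countable_image countable_PiE) auto
  obtain b :: 'a where b: "b \<in> Basis" using nonempty_Basis by blast
  have "inj (\<lambda>n. real n *\<^sub>R b)" using b by (auto intro!: injI)
  moreover have "range (\<lambda>n. real n *\<^sub>R b) \<subseteq> Lat" using b by (auto simp: Lat_def inner_Basis)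
  ultimately have "infinite (Lat :: 'a set)" using finite_subset range_inj_infinite by blast
  then show ?thesis using c bij_betw_from_nat_into that by blast
qed

lemma sum_inverse_square_Ints_bound:
  obtains B :: real where "\<And>I. finite I \<Longrightarrow> I \<subseteq> \<int> \<Longrightarrow> (\<Sum>x\<in>I. 1 / (1 + x\<^sup>2)) \<le> B"
proof -
  have "summable (\<lambda>n. 2 * inverse (real (Suc n) ^ 2))"
    using inverse_power_summable[of 2, where 'a = real]
    by (intro summable_mult) (subst summable_Suc_iff[of "\<lambda>n. inverse ((real n)\<^sup>2)"], simp)
  then have s: "summable (\<lambda>n. 1 / (1 + (real n)\<^sup>2))"
  proof (rule summable_comparison_test'[where N = 0])
    show "norm (1 / (1 + (real n)\<^sup>2)) \<le> 2 * inverse (real (Suc n) ^ 2)" for n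
    proof -
      have "(real (Suc n))\<^sup>2 \<le> 2 * (1 + (real n)\<^sup>2)"
        using sum_squares_bound[of "real n" 1] by (simp add: power2_eq_square algebra_simps)
      moreover have "0 < 1 + (real n)\<^sup>2" by (simp add: add_pos_nonneg)
      moreover have "0 < (real (Suc n))\<^sup>2" by simp
      ultimately have "1 \<le> (2 * inverse ((real (Suc n))\<^sup>2)) * (1 + (real n)\<^sup>2)"
        by (simp add: divide_inverse[symmetric] pos_le_divide_eq del: of_nat_Suc)
      then show ?thesis using \<open>0 < 1 + (real n)\<^sup>2\<close> by (simp add: pos_divide_le_eq del: of_nat_Suc)
    qed
  qed
  define B where "B = (suminf (\<lambda>n. 1 / (1 + (real n)\<^sup>2)))"
  have "(\<Sum>x\<in>I. 1 / (1 + x\<^sup>2)) \<le> B + B" if I: "finite I" "I \<subseteq> \<int>" for I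
  proof -
    let ?h = "\<lambda>x::real. 1 / (1 + x\<^sup>2)"
    have pos: "0 \<le> ?h x" for x by (simp add: add_nonneg_nonneg)
    obtain J :: "int set" where J: "I = of_int ` J" using I(2) unfolding Ints_def by (meson subset_imageE)
    have inj: "inj_on (of_int :: int \<Rightarrow> real) J" by (auto intro: inj_onI)
    then have fJ: "finite J" using J I(1) finite_image_iff by blast
    have half: "(\<Sum>j\<in>A. ?h (of_int j)) \<le> B" if A: "A \<subseteq> J" "inj_on (\<lambda>j. nat \<bar>j\<bar>) A" for A
    proof -
      have "(\<Sum>j\<in>A. ?h (of_int j)) = (\<Sum>n\<in>(\<lambda>j. nat \<bar>j\<bar>) ` A. ?h (real n))"
        using A(2) by (subst sum.reindex) (auto simp: o_def)
      also have "\<dots> \<le> B" unfolding B_def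
        using A(1) fJ pos by (intro sum_le_suminf s) (auto intro: finite_subset)
      finally show ?thesis .
    qed
    have "(\<Sum>x\<in>I. ?h x) = (\<Sum>j\<in>J. ?h (of_int j))"
      unfolding J using inj by (subst sum.reindex) auto
    also have "\<dots> = (\<Sum>j\<in>{j\<in>J. j \<ge> 0}. ?h (of_int j)) + (\<Sum>j\<in>{j\<in>J. \<not> j \<ge> 0}. ?h (of_int j))"
      using fJ by (subst sum.union_disjoint[symmetric]) (auto intro!: sum.cong)
    also have "\<dots> \<le> B + B" by (intro add_mono half) (auto intro!: inj_onI)
    finally show ?thesis .
  qed
  then show ?thesis by (rule that)
qed

text \<open>Finitely many lattice points lie in a product of finite sets of integers, over which the
  sum of the products factors. The partial sums are therefore at most a power of the one-dimensional
  bound.\<close>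

lemma summable_Lat:
  assumes "bij_betw kk UNIV (Lat :: 'a::euclidean_space set)"
  shows "summable (\<lambda>n. \<Prod>b\<in>Basis. 1 / (1 + (kk n \<bullet> b)\<^sup>2))"
proof -
  obtain B where B: "\<And>I. finite I \<Longrightarrow> I \<subseteq> \<int> \<Longrightarrow> (\<Sum>x\<in>I. 1 / (1 + x\<^sup>2)) \<le> (B::real)"
    using sum_inverse_square_Ints_bound by blast
  let ?h = "\<lambda>x::real. 1 / (1 + x\<^sup>2)"
  have pos: "0 \<le> ?h x" for x by (simp add: add_nonneg_nonneg)
  have "(\<Sum>n<N. \<Prod>b\<in>Basis. ?h (kk n \<bullet> b)) \<le> B ^ DIM('a)" for N
  proof -
    define I where "I = (\<Union>b\<in>Basis. (\<lambda>n. kk n \<bullet> b) ` {..<N})"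
    have kkL: "kk n \<in> Lat" for n using assms bij_betwE by blast
    have I: "finite I" "I \<subseteq> \<int>" using kkL by (auto simp: I_def Lat_def)
    define r where "r n = (\<lambda>b\<in>Basis. kk n \<bullet> b)" for n
    have inj: "inj_on r {..<N}"
    proof (rule inj_onI)
      fix m n assume "r m = r n"
      then have "kk m \<bullet> b = kk n \<bullet> b" if "b \<in> Basis" for b
      proof -
        have "r m b = r n b" using \<open>r m = r n\<close> by simp
        then show ?thesis using that by (simp add: r_def)
      qed
      then have "kk m = kk n" by (rule euclidean_eqI)
      then show "m = n" using assms by (auto simp: bij_betw_def inj_def)
    qed
    have "(\<Sum>n<N. \<Prod>b\<in>Basis. ?h (kk n \<bullet> b)) = (\<Sum>n<N. \<Prod>b\<in>Basis. ?h (r n b))"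
      by (intro sum.cong prod.cong) (auto simp: r_def)
    also have "\<dots> = (\<Sum>f\<in>r ` {..<N}. \<Prod>b\<in>Basis. ?h (f b))"
      using inj by (subst sum.reindex) auto
    also have "\<dots> \<le> (\<Sum>f\<in>(Basis :: 'a set) \<rightarrow>\<^sub>E I. \<Prod>b\<in>Basis. ?h (f b))"
    proof (rule sum_mono2)
      show "finite (Basis \<rightarrow>\<^sub>E I :: ('a \<Rightarrow> real) set)" using I by (intro finite_PiE) auto
      show "r ` {..<N} \<subseteq> Basis \<rightarrow>\<^sub>E I" by (auto simp: r_def I_def)
    qed (use pos in \<open>auto intro!: prod_nonneg\<close>)
    also have "\<dots> = (\<Prod>b\<in>(Basis :: 'a set). \<Sum>x\<in>I. ?h x)"
      using I by (subst prod_sum_PiE) auto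
    also have "\<dots> = (\<Sum>x\<in>I. ?h x) ^ DIM('a)" by simp
    also have "\<dots> \<le> B ^ DIM('a)" using B[OF I] pos by (intro power_mono sum_nonneg) auto
    finally show ?thesis .
  qed
  from this[of "Suc _"] have "(\<Sum>n\<le>N. \<Prod>b\<in>Basis. ?h (kk n \<bullet> b)) \<le> B ^ DIM('a)" for N
    by (simp only: lessThan_Suc_atMost)
  then show ?thesis using pos
    by (intro bounded_imp_summable[where B = "B ^ DIM('a)"] prod_nonneg) auto
qed

lemma summable_shifted_Lat:
  fixes kk :: "nat \<Rightarrow> 'a::euclidean_space"
  assumes "bij_betw kk UNIV Lat" "l > 0"
  shows "summable (\<lambda>n. \<Prod>b\<in>Basis. 1 / (1 + ((kk n /\<^sub>R l + \<theta>) \<bullet> b)\<^sup>2))"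
proof -
  \<comment> \<open>With x the shifted coordinate and t that of \<theta>, the lattice coordinate is
    l (x - t), and (x - t)^2 is at most 2 x^2 + 2 t^2. This constant makes 1 + l^2 (2 x^2 + 2 t^2)
    at most \<open>C b\<close> times 1 + x^2.\<close>
  define C where "C b = 1 + 2 * l\<^sup>2 * (1 + (\<theta> \<bullet> b)\<^sup>2)" for b
  have C: "C b \<ge> 1" for b by (simp add: C_def)
  have "norm (\<Prod>b\<in>Basis. 1 / (1 + ((kk n /\<^sub>R l + \<theta>) \<bullet> b)\<^sup>2)) \<le> (\<Prod>b\<in>Basis. C b) * (\<Prod>b\<in>Basis. 1 / (1 + (kk n \<bullet> b)\<^sup>2))" for n
  proof -
    have "1 / (1 + ((kk n /\<^sub>R l + \<theta>) \<bullet> b)\<^sup>2) \<le> C b * (1 / (1 + (kk n \<bullet> b)\<^sup>2))" for b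
    proof -
      define x where "x = (kk n /\<^sub>R l + \<theta>) \<bullet> b"
      define t where "t = \<theta> \<bullet> b"
      have k: "kk n \<bullet> b = l * (x - t)" using assms(2) by (simp add: x_def t_def inner_add_left field_simps)
      have "(x - t)\<^sup>2 \<le> 2 * x\<^sup>2 + 2 * t\<^sup>2"
        using zero_le_power2[of "x + t"] by (simp add: power2_eq_square algebra_simps)
      then have "1 + (kk n \<bullet> b)\<^sup>2 \<le> 1 + l\<^sup>2 * (2 * x\<^sup>2 + 2 * t\<^sup>2)"
        unfolding k power_mult_distrib by (intro add_left_mono mult_left_mono) auto
      also have "\<dots> \<le> C b * (1 + x\<^sup>2)"
        unfolding C_def t_def[symmetric] by (simp add: algebra_simps)
      finally have "1 + (kk n \<bullet> b)\<^sup>2 \<le> C b * (1 + x\<^sup>2)" .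
      moreover have "0 < 1 + (kk n \<bullet> b)\<^sup>2" "0 < 1 + x\<^sup>2" by (simp_all add: add_pos_nonneg)
      ultimately show ?thesis unfolding x_def[symmetric] by (simp add: divide_simps mult.commute)
    qed
    then have "(\<Prod>b\<in>Basis. 1 / (1 + ((kk n /\<^sub>R l + \<theta>) \<bullet> b)\<^sup>2)) \<le> (\<Prod>b\<in>Basis. C b * (1 / (1 + (kk n \<bullet> b)\<^sup>2)))"
      by (intro prod_mono) (auto simp: add_nonneg_nonneg)
    moreover have "0 \<le> (\<Prod>b\<in>Basis. 1 / (1 + ((kk n /\<^sub>R l + \<theta>) \<bullet> b)\<^sup>2))"
      by (intro prod_nonneg) (auto simp: add_nonneg_nonneg)
    ultimately show ?thesis by (simp only: prod.distrib real_norm_def abs_of_nonneg)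
  qed
  then show ?thesis
    by (intro summable_comparison_test'[OF summable_mult[OF summable_Lat[OF assms(1)]], where N = 0])
qed

subsection \<open>Fourier inversion on a cube\<close>

lemma lborel_integral_prod:
  fixes f :: "'a::euclidean_space \<Rightarrow> real \<Rightarrow> complex"
  assumes "\<And>b. b \<in> Basis \<Longrightarrow> integrable lborel (f b)"
  shows "(\<integral>z. (\<Prod>b\<in>Basis. f b (z \<bullet> b)) \<partial>lborel) = (\<Prod>b\<in>Basis. \<integral>s. f b s \<partial>lborel)"
proof -
  interpret product_sigma_finite "\<lambda>_::'a. lborel :: real measure"
    by standard
  have m: "f b \<in> borel_measurable borel" if "b \<in> Basis" for b using assms[OF that] by auto
  have "(\<integral>z. (\<Prod>b\<in>Basis. f b (z \<bullet> b)) \<partial>lborel) =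
      (\<integral>z. (\<Prod>b\<in>Basis. f b (z \<bullet> b)) \<partial>(distr (\<Pi>\<^sub>M b\<in>Basis. lborel) borel (\<lambda>f. \<Sum>b\<in>Basis. f b *\<^sub>R b)))"
    by (subst lborel_eq) simp
  also have "\<dots> = (\<integral>x. (\<Prod>b\<in>Basis. f b ((\<Sum>a\<in>Basis. x a *\<^sub>R a) \<bullet> b)) \<partial>(\<Pi>\<^sub>M b\<in>(Basis::'a set). lborel))"
    by (intro integral_distr borel_measurable_prod measurable_compose[OF borel_measurable_inner m]) auto
  also have "\<dots> = (\<integral>x. (\<Prod>b\<in>Basis. f b (x b)) \<partial>(\<Pi>\<^sub>M b\<in>(Basis::'a set). lborel))"
    by (intro Bochner_Integration.integral_cong prod.cong) auto
  also have "\<dots> = (\<Prod>b\<in>Basis. \<integral>s. f b s \<partial>lborel)"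
    by (intro product_integral_prod assms) auto
  finally show ?thesis .
qed

lemma cis_sum: "cis (\<Sum>i\<in>I. f i) = (\<Prod>i\<in>I. cis (f i))"
  by (induction I rule: infinite_finite_induct) (auto simp: cis_mult[symmetric])

lemma integral_cis_period:
  assumes "l > 0" "j \<in> \<int>" "j \<noteq> 0"
  shows "(\<integral>s. indicator {- (pi * l)..pi * l} s *\<^sub>R cis (j / l * s) \<partial>lborel) = 0"
proof -
  define F where "F s = cis (j / l * s) / (\<i> * of_real (j / l))" for s
  have "(\<integral>s. indicator {- (pi * l)..pi * l} s *\<^sub>R cis (j / l * s) \<partial>lborel) = F (pi * l) - F (- (pi * l))"
  proof (rule integral_FTC_atLeastAtMost)
    show "(F has_vector_derivative cis (j / l * x)) (at x within {- (pi * l)..pi * l})" for x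
      unfolding F_def has_vector_derivative_def
      using assms by (auto intro!: derivative_eq_intros simp: scaleR_conv_of_real field_simps)
  qed (use assms in \<open>auto intro!: continuous_intros\<close>)
  also have "\<dots> = 0"
  proof -
    obtain i where "j = of_int i" using assms(2) by (auto simp: Ints_def)
    then have "cis (j * pi) = cis (- (j * pi))"
      by (auto simp: complex_eq_iff sin_npi_int mult.commute)
    then show ?thesis using assms(1) by (simp add: F_def)
  qed
  finally show ?thesis .
qed

lemma integral_cis_qube:
  fixes k :: "'a::euclidean_space"
  assumes "l > 0" "k \<in> Lat"
  shows "(\<integral>z. indicator (qube (pi * l) 0) z *\<^sub>R cis ((k /\<^sub>R l) \<bullet> z) \<partial>lborel) =
    (if k = 0 then of_real ((2 * pi * l) ^ DIM('a)) else 0)"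
proof -
  define f where "f b s = indicator {- (pi * l)..pi * l} s *\<^sub>R cis (k \<bullet> b / l * s)" for b s
  have "(\<integral>z. indicator (qube (pi * l) 0) z *\<^sub>R cis ((k /\<^sub>R l) \<bullet> z) \<partial>lborel) =
      (\<integral>z. (\<Prod>b\<in>Basis. f b (z \<bullet> b)) \<partial>lborel)"
  proof (intro Bochner_Integration.integral_cong refl)
    fix z :: 'a
    have "cis ((k /\<^sub>R l) \<bullet> z) = (\<Prod>b\<in>Basis. cis (k \<bullet> b / l * (z \<bullet> b)))"
      unfolding cis_sum[symmetric] by (subst euclidean_inner) (simp add: field_simps)
    moreover have "(\<Prod>b\<in>Basis. indicator {- (pi * l)..pi * l} (z \<bullet> b)) = (indicator (qube (pi * l) 0) z :: real)"
    proof (cases "z \<in> qube (pi * l) 0")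
      case True
      then have "z \<bullet> b \<in> {- (pi * l)..pi * l}" if "b \<in> Basis" for b
        using that by (auto simp: qube_def abs_le_iff)
      then show ?thesis using True by simp
    next
      case False
      then obtain b where "b \<in> Basis" "z \<bullet> b \<notin> {- (pi * l)..pi * l}"
        by (auto simp: qube_def abs_le_iff not_le)
      then show ?thesis using False by (auto simp: indicator_def)
    qed
    ultimately show "indicator (qube (pi * l) 0) z *\<^sub>R cis ((k /\<^sub>R l) \<bullet> z) = (\<Prod>b\<in>Basis. f b (z \<bullet> b))"
      by (simp add: f_def scaleR_conv_of_real prod.distrib of_real_prod[symmetric] del: of_real_prod)
  qed
  also have "\<dots> = (\<Prod>b\<in>Basis. \<integral>s. f b s \<partial>lborel)"
    unfolding f_def using assms(1) by (intro lborel_integral_prod borel_integrable_compact) (auto intro!: continuous_intros)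
  also have "\<dots> = (if k = 0 then of_real ((2 * pi * l) ^ DIM('a)) else 0)"
  proof (cases "k = 0")
    case True
    have "(\<integral>s. f b s \<partial>lborel) = of_real (2 * pi * l)" if "b \<in> Basis" for b
      using assms(1) by (simp add: f_def True scaleR_conv_of_real)
    then show ?thesis using True by simp
  next
    case False
    then obtain b where b: "b \<in> Basis" "k \<bullet> b \<noteq> 0" using euclidean_all_zero_iff[of k] by auto
    then have "(\<integral>s. f b s \<partial>lborel) = 0"
      unfolding f_def using assms by (intro integral_cis_period) (auto simp: Lat_def)
    then show ?thesis using b False by auto
  qed
  finally show ?thesis .
qed

text \<open>Test \<open>D\<close> against powers of a trigonometric polynomial that peaks at \<open>w\<close>.\<close>

lemma trig_complete:
  fixes D :: "'a::euclidean_space \<Rightarrow> complex"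
  assumes l: "l > 0" and D: "continuous_on (qube (pi * l) 0) D"
    and orth: "\<And>k. k \<in> Lat \<Longrightarrow> (\<integral>z. indicator (qube (pi * l) 0) z *\<^sub>R (D z * cis ((k /\<^sub>R l) \<bullet> z)) \<partial>lborel) = 0"
    and w: "\<And>b. b \<in> Basis \<Longrightarrow> \<bar>w \<bullet> b\<bar> < pi * l"
  shows "D w = 0"
proof (rule ccontr)
  assume nz: "D w \<noteq> 0"
  let ?X = "qube (pi * l) (0 :: 'a)"
  define d where "d = real DIM('a)"
  have d: "d > 0" by (simp add: d_def)
  have wX: "w \<in> ?X" using w by (auto simp: qube_def less_imp_le)
  define r where "r z = Re (D z * cnj (D w))" for z
  have r: "continuous_on ?X r" unfolding r_def by (intro continuous_intros D)
  have "r w = (cmod (D w))\<^sup>2" unfolding r_def complex_norm_square[symmetric] by (simp flip: of_real_power)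
  then have rw: "r w > 0" using nz by simp
  define \<kappa> where "\<kappa> = r w / 2"
  have k0: "\<kappa> > 0" using rw by (simp add: \<kappa>_def)
  obtain e where e: "e > 0" "\<And>z. z \<in> ?X \<Longrightarrow> dist z w < e \<Longrightarrow> \<bar>r z - r w\<bar> < \<kappa>"
    using r wX k0 unfolding continuous_on_iff dist_real_def by metis
  have small: "norm y \<le> d * c" if "\<And>b. b \<in> Basis \<Longrightarrow> \<bar>y \<bullet> b\<bar> \<le> c" for y :: 'a and c
    using norm_le_l1[of y] sum_mono[of Basis "\<lambda>b. \<bar>y \<bullet> b\<bar>" "\<lambda>_. c"] that by (simp add: d_def)
  \<comment> \<open>The distances to the faces enter because the cosines below are periodic: for z
    in the period cube they keep each coordinate of \<open>z - w\<close> at least \<eta> below the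
    period 2 pi l. The other entry keeps \<open>r\<close> above \<kappa> on the cube around
    \<open>w\<close>.\<close>
  define \<eta> where "\<eta> = Min (insert (e / (2 * d)) ((\<lambda>b. pi * l - \<bar>w \<bullet> b\<bar>) ` Basis))"
  have \<eta>: "\<eta> > 0" using e(1) d w by (simp add: \<eta>_def)
  have \<eta>b: "\<eta> \<le> pi * l - \<bar>w \<bullet> b\<bar>" if "b \<in> Basis" for b unfolding \<eta>_def using that by (intro Min_le) auto
  have \<eta>e: "\<eta> \<le> e / (2 * d)" unfolding \<eta>_def by (intro Min_le) auto
  obtain b0 :: 'a where b0: "b0 \<in> Basis" using nonempty_Basis by blast
  have \<eta>l: "\<eta> \<le> pi * l" using \<eta>b[OF b0] by linarith
  have sub: "qube \<eta> w \<subseteq> ?X"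
  proof
    fix y assume y: "y \<in> qube \<eta> w"
    show "y \<in> ?X" unfolding qube_def
    proof (intro CollectI ballI)
      fix b :: 'a assume b: "b \<in> Basis"
      have "\<bar>(y - w) \<bullet> b\<bar> \<le> \<eta>" using y b by (auto simp: qube_def)
      then show "\<bar>(y - 0) \<bullet> b\<bar> \<le> pi * l" using \<eta>b[OF b] by (simp add: inner_diff_left)
    qed
  qed
  have rk: "r z \<ge> \<kappa>" if "z \<in> qube \<eta> w" for z
  proof -
    have "norm (z - w) \<le> d * \<eta>" using that by (intro small) (auto simp: qube_def)
    also have "\<dots> \<le> e / 2" using \<eta>e d by (simp add: field_simps)
    finally have "dist z w < e" using e(1) by (simp add: dist_norm)
    then have "\<bar>r z - r w\<bar> < \<kappa>" using e(2) sub that by blast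
    then have "r w - r z < \<kappa>" by (simp add: abs_less_iff)
    moreover have "r w = 2 * \<kappa>" by (simp add: \<kappa>_def)
    ultimately show ?thesis by linarith
  qed
  \<comment> \<open>With this \<open>c\<close> the trigonometric polynomial \<open>T\<close> is 1 +
    c at \<open>w\<close>. Off \<open>qube \<eta> w\<close>, but inside the period cube, one cosine
    is at most 1 - 2 d c, hence \<open>T\<close> is at most 1 - c there.\<close>
  define c where "c = (1 - cos (\<eta> / l)) / (2 * d)"
  have "cos (\<eta> / l) < cos 0" using \<eta> l \<eta>l by (intro cos_monotone_0_pi) (auto simp: field_simps)
  then have c: "c > 0" using d by (simp add: c_def)
  define T where "T z = c + (\<Sum>b\<in>Basis. cos ((z - w) \<bullet> b / l)) / d" for z :: 'a
  have contT: "continuous_on S T" for S unfolding T_def by (intro continuous_intros) (use l d in auto)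
  have Tout: "\<bar>T z\<bar> \<le> 1" if z: "z \<in> ?X" "z \<notin> qube \<eta> w" for z
  proof -
    obtain b where b: "b \<in> Basis" "\<bar>(z - w) \<bullet> b\<bar> > \<eta>" using z(2) by (auto simp: qube_def not_le)
    have zb: "\<bar>z \<bullet> b\<bar> \<le> pi * l" using z(1) b(1) by (auto simp: qube_def)
    define x where "x = \<bar>(z - w) \<bullet> b\<bar> / l"
    have x1: "x \<ge> \<eta> / l" using b(2) l by (simp add: x_def divide_right_mono)
    have "\<bar>(z - w) \<bullet> b\<bar> \<le> 2 * (pi * l) - \<eta>" using zb \<eta>b[OF b(1)] by (simp add: inner_diff_left)
    then have x2: "x \<le> 2 * pi - \<eta> / l" using l by (simp add: x_def field_simps)
    have "cos x \<le> cos (\<eta> / l)"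
    proof (cases "x \<le> pi")
      case True
      then show ?thesis using x1 \<eta> l by (intro cos_monotone_0_pi_le) (auto simp: less_imp_le)
    next
      case False
      have "cos (2 * pi - x) \<le> cos (\<eta> / l)"
        using False x2 \<eta> l by (intro cos_monotone_0_pi_le) (auto simp: less_imp_le)
      then show ?thesis by (simp add: cos_diff)
    qed
    moreover have "cos x = cos ((z - w) \<bullet> b / l)"
      using cos_abs_real[of "(z - w) \<bullet> b / l"] l by (simp add: x_def abs_divide)
    ultimately have cb: "cos ((z - w) \<bullet> b / l) \<le> 1 - 2 * d * c" using d by (simp add: c_def field_simps)
    have "(\<Sum>a\<in>Basis. cos ((z - w) \<bullet> a / l)) = cos ((z - w) \<bullet> b / l) + (\<Sum>a\<in>Basis - {b}. cos ((z - w) \<bullet> a / l))"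
      using b(1) by (simp add: sum.remove)
    also have "(\<Sum>a\<in>Basis - {b}. cos ((z - w) \<bullet> a / l)) \<le> (\<Sum>a\<in>Basis - {b}. 1)"
      by (intro sum_mono) auto
    also have "(\<Sum>a\<in>Basis - {b}. 1) = d - 1" using b(1) by (simp add: d_def of_nat_diff Suc_leI)
    finally have "(\<Sum>a\<in>Basis. cos ((z - w) \<bullet> a / l)) \<le> d - 2 * d * c" using cb by simp
    then have "T z \<le> 1 - c" unfolding T_def using d by (simp add: field_simps)
    moreover have "T z \<ge> c - 1"
    proof -
      have "(\<Sum>a\<in>(Basis::'a set). - 1) \<le> (\<Sum>a\<in>Basis. cos ((z - w) \<bullet> a / l))" by (intro sum_mono) auto
      then have "- d \<le> (\<Sum>a\<in>Basis. cos ((z - w) \<bullet> a / l))" by (simp add: d_def)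
      then show ?thesis unfolding T_def using d by (simp add: field_simps)
    qed
    ultimately show ?thesis using c by (simp add: abs_le_iff)
  qed
  have Tw: "T w = 1 + c" using d by (simp add: T_def d_def)
  obtain e' where e': "e' > 0" "\<And>z. dist z w < e' \<Longrightarrow> \<bar>T z - T w\<bar> < c / 2"
    using contT[of UNIV] c unfolding continuous_on_iff dist_real_def by (metis UNIV_I half_gt_zero)
  define \<delta> where "\<delta> = min \<eta> (e' / (2 * d))"
  have \<delta>: "\<delta> > 0" using \<eta> e' d by (simp add: \<delta>_def)
  have Tin: "T z \<ge> 1 + c / 2" if "z \<in> qube \<delta> w" for z
  proof -
    have "norm (z - w) \<le> d * \<delta>" using that by (intro small) (auto simp: qube_def)
    also have "\<dots> \<le> d * (e' / (2 * d))" using d by (intro mult_left_mono) (auto simp: \<delta>_def)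
    also have "\<dots> < e'" using e' d by simp
    finally have "\<bar>T z - T w\<bar> < c / 2" using e'(2) by (simp add: dist_norm)
    then have "T w - T z < c / 2" by linarith
    then show ?thesis unfolding Tw by linarith
  qed
  have sub2: "qube \<delta> w \<subseteq> qube \<eta> w" by (auto simp: qube_def \<delta>_def)
  have int: "integrable lborel (\<lambda>z. indicator ?X z *\<^sub>R f z)" if "continuous_on ?X f" for f :: "'a \<Rightarrow> complex"
    using that by (intro borel_integrable_compact) auto
  \<comment> \<open>\<open>T\<close> combines the constant with characters of frequencies b / l and
    - b / l. Multiplying by it moves \<open>k\<close> only to neighbouring lattice points, so
    orthogonality is inherited.\<close>
  have zero: "(\<integral>z. indicator ?X z *\<^sub>R (D z * of_real (T z) ^ N * cis ((k /\<^sub>R l) \<bullet> z)) \<partial>lborel) = 0"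
    if "k \<in> Lat" for N k
    using that
  proof (induction N arbitrary: k)
    case 0
    then show ?case using orth by simp
  next
    case (Suc N)
    define J where "J k = (\<lambda>z. indicator ?X z *\<^sub>R (D z * of_real (T z) ^ N * cis ((k /\<^sub>R l) \<bullet> z)))" for k
    have intJ: "integrable lborel (J k)" for k
      unfolding J_def by (intro int continuous_intros D contT continuous_on_of_real)
    have J0: "integral\<^sup>L lborel (J k) = 0" if "k \<in> Lat" for k using Suc.IH[OF that] by (simp add: J_def)
    have T': "complex_of_real (T z) = of_real c + (\<Sum>b\<in>Basis. of_real (1 / (2 * d)) *
        (cis (- (w \<bullet> b) / l) * cis ((b /\<^sub>R l) \<bullet> z) + cis (w \<bullet> b / l) * cis ((- b /\<^sub>R l) \<bullet> z)))" for z
    proof -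
      have "complex_of_real (cos x) = (cis x + cis (- x)) / 2" for x by (simp add: complex_eq_iff)
      moreover have "cis ((z - w) \<bullet> b / l) = cis (- (w \<bullet> b) / l) * cis ((b /\<^sub>R l) \<bullet> z)" for b
        by (simp add: cis_mult inner_diff_left inner_commute[of b] diff_divide_distrib divide_inverse algebra_simps)
      moreover have "cis (- ((z - w) \<bullet> b / l)) = cis (w \<bullet> b / l) * cis ((- b /\<^sub>R l) \<bullet> z)" for b
        by (simp add: cis_mult inner_diff_left inner_commute[of b] diff_divide_distrib divide_inverse algebra_simps)
      ultimately have cosb: "complex_of_real (cos ((z - w) \<bullet> b / l)) =
          (cis (- (w \<bullet> b) / l) * cis ((b /\<^sub>R l) \<bullet> z) + cis (w \<bullet> b / l) * cis ((- b /\<^sub>R l) \<bullet> z)) / 2" for b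
        by presburger
      have "complex_of_real (T z) = of_real c + (\<Sum>b\<in>Basis. complex_of_real (cos ((z - w) \<bullet> b / l))) / of_real d"
        by (simp add: T_def)
      then show ?thesis
        unfolding cosb sum_divide_distrib by simp
    qed
    have "indicator ?X z *\<^sub>R (D z * of_real (T z) ^ Suc N * cis ((k /\<^sub>R l) \<bullet> z)) = of_real c * J k z +
        (\<Sum>b\<in>Basis. of_real (1 / (2 * d)) * (cis (- (w \<bullet> b) / l) * J (k + b) z + cis (w \<bullet> b / l) * J (k - b) z))" for z
    proof -
      have Jb: "cis ((b /\<^sub>R l) \<bullet> z) * J k z = J (k + b) z" "cis ((- b /\<^sub>R l) \<bullet> z) * J k z = J (k - b) z" for b
        unfolding J_def by (simp_all add: cis_mult[symmetric] inner_add_left inner_diff_left scaleR_add_right scaleR_diff_right cis_divide[symmetric] cis_inverse[symmetric] divide_inverse del: cis_inverse)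
      have "indicator ?X z *\<^sub>R (D z * of_real (T z) ^ Suc N * cis ((k /\<^sub>R l) \<bullet> z)) = of_real (T z) * J k z"
        by (simp add: J_def)
      also have "\<dots> = of_real c * J k z + (\<Sum>b\<in>Basis. of_real (1 / (2 * d)) *
          (cis (- (w \<bullet> b) / l) * (cis ((b /\<^sub>R l) \<bullet> z) * J k z) + cis (w \<bullet> b / l) * (cis ((- b /\<^sub>R l) \<bullet> z) * J k z)))"
        by (subst T') (simp only: distrib_right sum_distrib_right mult.assoc)
      finally show ?thesis by (simp only: Jb(1) add_uminus_conv_diff)
    qed
    then show ?case
      using Suc.prems J0 by (simp add: intJ Lat_def inner_add_left inner_diff_left inner_Basis)
  qed
  obtain M where M: "M > 0" "\<And>z. z \<in> ?X \<Longrightarrow> \<bar>r z\<bar> \<le> M"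
    using compact_imp_bounded[OF compact_continuous_image[OF r compact_qube]] by (auto simp: bounded_pos)
  define V where "V = measure lborel (qube \<delta> w)"
  define V' where "V' = measure lborel ?X"
  have "V = (\<Prod>b\<in>(Basis::'a set). 2 * \<delta>)"
    unfolding V_def qube_cbox using \<delta> by (subst measure_lborel_cbox) (auto simp: inner_diff_left inner_add_left intro!: prod.cong)
  then have V: "V > 0" using \<delta> by simp
  have fin: "emeasure lborel (qube c w) < top" for c and w :: 'a
    using emeasure_lborel_cbox_finite[of "w - c *\<^sub>R One" "w + c *\<^sub>R One"] by (simp add: qube_cbox)
  \<comment> \<open>The integral against the even power is 0, yet the small cube contributes at
    least the first term. On the rest of \<open>qube \<eta> w\<close> the integrand is nonnegative,
    and elsewhere it is at least - M since \<open>T\<close> has modulus at most 1.\<close>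
  have key: "\<kappa> * (1 + c / 2) ^ (2 * N) * V - M * V' \<le> 0" for N
  proof -
    let ?I = "\<lambda>z. indicator ?X z *\<^sub>R (D z * of_real (T z) ^ (2 * N))"
    have iI: "integrable lborel ?I" by (intro int continuous_intros D contT continuous_on_of_real)
    have "(\<integral>z. ?I z \<partial>lborel) = 0" using zero[of 0 "2 * N"] by (simp add: Lat_def)
    then have "0 = Re (cnj (D w) * (\<integral>z. ?I z \<partial>lborel))" by simp
    also have "\<dots> = Re (\<integral>z. cnj (D w) * ?I z \<partial>lborel)" by (subst integral_mult_right_zero) (rule refl)
    also have "\<dots> = (\<integral>z. Re (cnj (D w) * ?I z) \<partial>lborel)"
      using iI by (intro integral_Re[symmetric] integrable_mult_right)
    also have "\<dots> = (\<integral>z. indicator ?X z * (r z * T z ^ (2 * N)) \<partial>lborel)"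
      by (intro Bochner_Integration.integral_cong refl) (simp add: r_def indicator_def algebra_simps flip: of_real_power)
    finally have z: "(\<integral>z. indicator ?X z * (r z * T z ^ (2 * N)) \<partial>lborel) = 0" by simp
    have "(\<integral>z. indicator (qube \<delta> w) z * (\<kappa> * (1 + c / 2) ^ (2 * N)) - indicator ?X z * M \<partial>lborel)
        \<le> (\<integral>z. indicator ?X z * (r z * T z ^ (2 * N)) \<partial>lborel)"
    proof (rule integral_mono)
      show "integrable lborel (\<lambda>z. indicator (qube \<delta> w) z * (\<kappa> * (1 + c / 2) ^ (2 * N)) - indicator ?X z * M)"
        using fin by (intro Bochner_Integration.integrable_diff integrable_mult_left integrable_real_indicator) auto
      have "integrable lborel (\<lambda>z. indicator ?X z *\<^sub>R (r z * T z ^ (2 * N)))"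
        by (intro borel_integrable_compact continuous_intros r contT) auto
      then show "integrable lborel (\<lambda>z. indicator ?X z * (r z * T z ^ (2 * N)))" by simp
      fix z :: 'a
      have ev: "0 \<le> T z ^ (2 * N)" by simp
      consider "z \<in> qube \<delta> w" | "z \<notin> qube \<delta> w" "z \<in> qube \<eta> w" | "z \<notin> qube \<eta> w" "z \<in> ?X" | "z \<notin> ?X" using sub sub2 by blast
      then show "indicator (qube \<delta> w) z * (\<kappa> * (1 + c / 2) ^ (2 * N)) - indicator ?X z * M \<le> indicator ?X z * (r z * T z ^ (2 * N))"
      proof cases
        case 1
        then have "\<kappa> * (1 + c / 2) ^ (2 * N) \<le> r z * T z ^ (2 * N)"
          using rk[of z] Tin[of z] sub2 c k0 by (intro mult_mono power_mono) auto
        then show ?thesis using 1 sub sub2 M(1) by (auto simp: indicator_def)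
      next
        case 2
        then have "0 \<le> r z * T z ^ (2 * N)" using rk[of z] k0 ev by (intro mult_nonneg_nonneg) auto
        then show ?thesis using 2 M(1) sub by (auto simp: indicator_def)
      next
        case 3
        have "\<bar>r z * T z ^ (2 * N)\<bar> \<le> M * 1"
          unfolding abs_mult using M 3 Tout[of z] by (intro mult_mono) (auto simp: power_abs intro!: power_le_one)
        then show ?thesis using 3 sub2 by (auto simp: indicator_def abs_le_iff)
      next
        case 4
        then show ?thesis using sub sub2 by (auto simp: indicator_def)
      qed
    qed
    also have "(\<integral>z. indicator (qube \<delta> w) z * (\<kappa> * (1 + c / 2) ^ (2 * N)) - indicator ?X z * M \<partial>lborel) = \<kappa> * (1 + c / 2) ^ (2 * N) * V - M * V'"
      using fin by (subst Bochner_Integration.integral_diff)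
        (auto simp: V_def V'_def intro!: integrable_mult_left integrable_real_indicator)
    finally show ?thesis using z by simp
  qed
  have "1 < (1 + c / 2)\<^sup>2" using c by (intro one_less_power) auto
  then obtain N where "((1 + c / 2)\<^sup>2) ^ N > M * V' / (\<kappa> * V)"
    using real_arch_pow by blast
  then have "(1 + c / 2) ^ (2 * N) > M * V' / (\<kappa> * V)" by (simp add: power_mult)
  then have "\<kappa> * (1 + c / 2) ^ (2 * N) * V > M * V'"
    using k0 V by (simp add: pos_divide_less_eq mult_ac)
  then show False using key[of N] by linarith
qed

lemma hat_twist: "hat (\<lambda>z. \<phi> z * cis (- (\<theta> \<bullet> z))) \<zeta> = hat \<phi> (\<zeta> + \<theta>)"
  unfolding hat_def by (simp add: cis_mult mult.assoc inner_add_left add.commute)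

text \<open>The shift \<theta> is absorbed into \<phi> by a character. The coefficients are
  summable, so the series converges uniformly to a continuous function with the same coefficients on
  the lattice; the difference is then orthogonal to all lattice characters, and
  \<open>trig_complete\<close> makes it vanish inside the cube.\<close>

lemma fourier_inversion:
  fixes \<phi> :: "'a::euclidean_space \<Rightarrow> complex"
  assumes l: "l > 0" and kk: "bij_betw kk UNIV (Lat :: 'a set)"
    and \<phi>: "continuous_on UNIV \<phi>" "\<And>z. z \<notin> qube (pi * l) 0 \<Longrightarrow> \<phi> z = 0"
    and s: "summable (\<lambda>n. cmod (hat \<phi> (kk n /\<^sub>R l + \<theta>)))"
    and w: "\<And>b. b \<in> Basis \<Longrightarrow> \<bar>w \<bullet> b\<bar> < pi * l"
  shows "(\<lambda>n. hat \<phi> (kk n /\<^sub>R l + \<theta>) * cis ((kk n /\<^sub>R l + \<theta>) \<bullet> w)) sums (of_real ((2 * pi * l) ^ DIM('a)) * \<phi> w)"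
proof -
  let ?X = "qube (pi * l) (0 :: 'a)"
  define V where "V = complex_of_real ((2 * pi * l) ^ DIM('a))"
  define a where "a n = hat \<phi> (kk n /\<^sub>R l + \<theta>)" for n
  define \<psi> where "\<psi> z = \<phi> z * cis (- (\<theta> \<bullet> z))" for z
  have a: "a n = hat \<psi> (kk n /\<^sub>R l)" for n unfolding a_def \<psi>_def by (simp add: hat_twist)
  have sa: "summable (\<lambda>n. cmod (a n))" using s by (simp add: a_def)
  define F where "F z = (suminf (\<lambda>n. a n * cis ((kk n /\<^sub>R l) \<bullet> z)))" for z
  have sF: "summable (\<lambda>n. cmod (a n * cis ((kk n /\<^sub>R l) \<bullet> z)))" for z
    using sa by (simp add: norm_mult)
  have "uniform_limit UNIV (\<lambda>N z. \<Sum>n<N. a n * cis ((kk n /\<^sub>R l) \<bullet> z)) F sequentially"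
    unfolding F_def by (rule Weierstrass_m_test[OF _ sa]) (simp add: norm_mult)
  then have cF: "continuous_on UNIV F"
    by (rule uniform_limit_theorem[rotated]) (auto intro!: always_eventually continuous_intros)
  define D where "D z = V * \<psi> z - F z" for z
  have c\<psi>: "continuous_on UNIV \<psi>" unfolding \<psi>_def by (intro continuous_intros \<phi>)
  have cD: "continuous_on UNIV D" unfolding D_def by (intro continuous_intros c\<psi> cF)
  have int: "integrable lborel (\<lambda>z. indicator ?X z *\<^sub>R f z)" if "continuous_on UNIV f" for f :: "'a \<Rightarrow> complex"
    using that by (intro borel_integrable_compact) (auto intro: continuous_on_subset)
  have "D w = 0"
  proof (rule trig_complete[OF l continuous_on_subset[OF cD] _ w])
    fix k :: 'a assume "k \<in> Lat"
    then have "- k \<in> Lat" by (auto simp: Lat_def)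
    moreover have "range kk = Lat" using kk by (simp add: bij_betw_def)
    \<comment> \<open>Integration against the character of frequency k picks out the coefficient at
      - k.\<close>
    ultimately obtain m where m: "kk m = - k" by (metis imageE)
    define f where "f n z = indicator ?X z *\<^sub>R (a n * cis (((kk n + k) /\<^sub>R l) \<bullet> z))" for n z
    have f: "(\<integral>z. f n z \<partial>lborel) = (if n = m then a m * V else 0)" for n
    proof -
      have "kk n + k \<in> Lat" using bij_betwE[OF kk] \<open>k \<in> Lat\<close> by (auto simp: Lat_def inner_add_left)
      moreover have "kk n + k = 0 \<longleftrightarrow> n = m"
        using m kk by (auto simp: bij_betw_def inj_def add_eq_0_iff2 add_eq_0_iff)
      moreover have "(\<integral>z. f n z \<partial>lborel) = a n * (\<integral>z. indicator ?X z *\<^sub>R cis (((kk n + k) /\<^sub>R l) \<bullet> z) \<partial>lborel)"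
        unfolding f_def by (subst integral_mult_right_zero[symmetric]) (simp add: scaleR_conv_of_real mult_ac)
      ultimately show ?thesis using integral_cis_qube[OF l, of "kk n + k"] by (simp add: V_def)
    qed
    have intf: "integrable lborel (f n)" for n unfolding f_def by (intro int continuous_intros)
    have nf: "norm (f n z) = indicator ?X z * cmod (a n)" for n z
      by (simp add: f_def norm_mult)
    have fin: "emeasure lborel ?X < \<infinity>"
      unfolding qube_cbox by (rule emeasure_lborel_cbox_finite)
    have "(\<integral>z. (suminf (\<lambda>n. f n z)) \<partial>lborel) = (suminf (\<lambda>n. \<integral>z. f n z \<partial>lborel))"
    proof (rule integral_suminf[OF intf])
      show "AE z in lborel. summable (\<lambda>n. norm (f n z))"
        unfolding nf by (intro AE_I2 summable_mult sa)
      show "summable (\<lambda>n. \<integral>z. norm (f n z) \<partial>lborel)"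
        unfolding nf using sa by (simp add: summable_mult)
    qed
    also have "\<dots> = a m * V"
      unfolding f by (subst suminf_finite[of "{m}"]) auto
    finally have 1: "(\<integral>z. (suminf (\<lambda>n. f n z)) \<partial>lborel) = a m * V" .
    have 2: "(suminf (\<lambda>n. f n z)) = indicator ?X z *\<^sub>R (F z * cis ((k /\<^sub>R l) \<bullet> z))" for z
    proof -
      have "f n z = (indicator ?X z *\<^sub>R cis ((k /\<^sub>R l) \<bullet> z)) * (a n * cis ((kk n /\<^sub>R l) \<bullet> z))" for n
        by (simp add: f_def scaleR_add_right inner_add_left cis_mult[symmetric] mult_ac)
      then show ?thesis
        using suminf_mult[OF summable_norm_cancel[OF sF[of z]], of "indicator ?X z *\<^sub>R cis ((k /\<^sub>R l) \<bullet> z)"]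
        by (simp add: F_def mult_ac)
    qed
    have 3: "(\<integral>z. indicator ?X z *\<^sub>R (V * \<psi> z * cis ((k /\<^sub>R l) \<bullet> z)) \<partial>lborel) = V * a m"
    proof -
      have "indicator ?X z *\<^sub>R (V * \<psi> z * cis ((k /\<^sub>R l) \<bullet> z)) = V * (\<psi> z * cis (- ((kk m /\<^sub>R l) \<bullet> z)))" for z
        using \<phi>(2)[of z] by (auto simp: indicator_def \<psi>_def m)
      then show ?thesis unfolding a hat_def by simp
    qed
    have "indicator ?X z *\<^sub>R (D z * cis ((k /\<^sub>R l) \<bullet> z)) = indicator ?X z *\<^sub>R (V * \<psi> z * cis ((k /\<^sub>R l) \<bullet> z)) - (suminf (\<lambda>n. f n z))" for z
      unfolding 2 D_def by (simp add: algebra_simps)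
    then have "(\<integral>z. indicator ?X z *\<^sub>R (D z * cis ((k /\<^sub>R l) \<bullet> z)) \<partial>lborel) =
       (\<integral>z. indicator ?X z *\<^sub>R (V * \<psi> z * cis ((k /\<^sub>R l) \<bullet> z)) \<partial>lborel) - (\<integral>z. (suminf (\<lambda>n. f n z)) \<partial>lborel)"
      unfolding 2 by (simp only:) (intro Bochner_Integration.integral_diff int continuous_intros c\<psi> cF)
    then show "(\<integral>z. indicator ?X z *\<^sub>R (D z * cis ((k /\<^sub>R l) \<bullet> z)) \<partial>lborel) = 0"
      unfolding 1 3 by simp
  qed auto
  then have "F w = V * \<psi> w" by (simp add: D_def)
  moreover have "(\<lambda>n. a n * cis ((kk n /\<^sub>R l) \<bullet> w)) sums F w"
    unfolding F_def using summable_norm_cancel[OF sF] by (rule summable_sums)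
  ultimately have "(\<lambda>n. a n * cis ((kk n /\<^sub>R l) \<bullet> w) * cis (\<theta> \<bullet> w)) sums (V * \<psi> w * cis (\<theta> \<bullet> w))"
    by (intro sums_mult2) simp
  then show ?thesis
    by (simp add: a_def V_def \<psi>_def cis_mult mult.assoc inner_add_left)
qed

text \<open>After a cutoff, the difference of the mixed derivatives has vanishing Fourier coefficients.\<close>

lemma pd_commute:
  fixes f :: "'a::euclidean_space \<Rightarrow> complex"
  assumes X: "open X" "smooth_on X f" "z \<in> X" and ab: "a \<in> Basis" "b \<in> Basis"
  shows "pd a (pd b f) z = pd b (pd a f) z"
proof -
  obtain \<eta> N where \<eta>: "test X \<eta>" "open N" "z \<in> N" "\<And>y. y \<in> N \<Longrightarrow> \<eta> y = 1"
    using test_one_near_compact[of "{z}" X] X by auto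
  define \<phi> where "\<phi> y = \<eta> y * f y" for y
  have t: "test X \<phi>" unfolding \<phi>_def by (rule test_mult[OF X(1) \<eta>(1) X(2)])
  define D where "D y = pd a (pd b \<phi>) y - pd b (pd a \<phi>) y" for y
  have tD: "test X D" unfolding D_def by (intro test_diff test_pd t ab)
  have hD: "hat D \<zeta> = 0" for \<zeta>
    unfolding D_def using ab by (subst hat_diff[of X _ X]) (auto intro!: test_pd t simp: hat_pd[OF test_pd[OF t]] hat_pd[OF t])
  obtain S where S: "compact S" "\<And>y. y \<notin> S \<Longrightarrow> D y = 0" using tD by (auto simp: test_def)
  obtain R where R: "\<And>y. y \<in> insert z S \<Longrightarrow> norm y \<le> R"
    using compact_imp_bounded[OF compact_insert[OF S(1), of z]] by (auto simp: bounded_iff)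
  define l where "l = (\<bar>R\<bar> + 1) / pi"
  have l: "l > 0" "pi * l = \<bar>R\<bar> + 1" by (auto simp: l_def)
  obtain kk :: "nat \<Rightarrow> 'a" where kk: "bij_betw kk UNIV Lat" using Lat_enum by blast
  have "(\<lambda>n. hat D (kk n /\<^sub>R l + 0) * cis ((kk n /\<^sub>R l + 0) \<bullet> z)) sums (of_real ((2 * pi * l) ^ DIM('a)) * D z)"
  proof (rule fourier_inversion[OF l(1) kk])
    show "continuous_on UNIV D" by (rule smooth_on_continuous_on[OF test_smooth[OF tD]])
    show "D y = 0" if "y \<notin> qube (pi * l) 0" for y
    proof (rule S(2), rule notI)
      assume "y \<in> S"
      then have "\<bar>y \<bullet> c\<bar> \<le> \<bar>R\<bar> + 1" if "c \<in> Basis" for c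
        using R[of y] Basis_le_norm[OF that, of y] by simp
      then show False using that l by (simp add: qube_def)
    qed
    show "\<bar>z \<bullet> c\<bar> < pi * l" if "c \<in> Basis" for c
      using R[of z] Basis_le_norm[OF that, of z] l by simp
  qed (simp add: hD)
  then have "of_real ((2 * pi * l) ^ DIM('a)) * D z = 0"
    by (simp only: hD mult_zero_left) (rule sums_unique2[OF _ sums_zero])
  then have "D z = 0" using l(1) by simp
  moreover have "D z = pd a (pd b f) z - pd b (pd a f) z"
  proof -
    have "pdw w \<phi> z = pdw w f z" for w
      using \<eta> X by (intro pdw_cong[of "N \<inter> X"]) (auto simp: \<phi>_def)
    from this[of "[a, b]"] this[of "[b, a]"] show ?thesis by (simp add: D_def)
  qed
  ultimately show ?thesis by simp
qed

lemma pdw_pd_commute: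
  assumes "open X" "smooth_on X f" "z \<in> X" "b \<in> Basis" "set w \<subseteq> Basis"
  shows "pdw w (pd b f) z = pd b (pdw w f) z"
  using assms(3,5)
proof (induction w arbitrary: z)
  case (Cons a w)
  have "pd a (pdw w (pd b f)) z = pd a (pd b (pdw w f)) z"
    using Cons by (intro pd_cong[OF assms(1)]) auto
  also have "\<dots> = pd b (pd a (pdw w f)) z"
    using Cons.prems assms by (intro pd_commute[OF assms(1)] smooth_on_pdw) auto
  finally show ?case by simp
qed auto

text \<open>Off \<open>U\<close> the cutoff vanishes in a whole neighbourhood, so both sides are 0
  there whatever the values of \<open>v\<close>.\<close>

lemma pd_test_mult:
  assumes "open U" "test U \<eta>" "smooth_on U v"
  shows "pd b (\<lambda>z. \<eta> z * v z) z = \<eta> z * pd b v z + pd b \<eta> z * v z"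
proof (cases "z \<in> U")
  case True
  then show ?thesis
    using assms smooth_on_differentiable by (intro pd_mult) (auto simp: test_def)
next
  case False
  obtain S where S: "compact S" "S \<subseteq> U" "\<And>z. z \<notin> S \<Longrightarrow> \<eta> z = 0"
    using assms(2) unfolding test_def by blast
  have "open (- S)" using S(1) compact_imp_closed by auto
  then have "pd b \<eta> z = 0" "pd b (\<lambda>z. \<eta> z * v z) z = 0"
    using pd_cong[of "- S" \<eta> "\<lambda>_. 0" z b] pd_cong[of "- S" "\<lambda>z. \<eta> z * v z" "\<lambda>_. 0" z b] S False by auto
  then show ?thesis using S False by auto
qed

subsection \<open>Quasi-homogeneous symbols\<close>

text \<open>The quasi-homogeneous order of the derivative along the word.\<close>

definition wl :: "('a \<Rightarrow> real) \<Rightarrow> 'a list \<Rightarrow> real" where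
  "wl wt w = sum_list (map wt w)"

text \<open>The weighted frequency: a coordinate of weight \<open>wt b\<close> is at most its power
  \<open>wt b\<close>. The summand 1 keeps negative powers bounded.\<close>

definition rho :: "('a \<Rightarrow> real) \<Rightarrow> 'a::euclidean_space \<Rightarrow> real" where
  "rho wt \<zeta> = 1 + (\<Sum>b\<in>Basis. \<bar>\<zeta> \<bullet> b\<bar> powr (1 / wt b))"

text \<open>The symbol of \<open>pdw w\<close>: a derivative along b multiplies cis (\<zeta>
  \<bullet> z) by \<i> times \<zeta> \<bullet> b.\<close>

definition isym :: "'a::euclidean_space list \<Rightarrow> 'a \<Rightarrow> complex" where
  "isym w \<zeta> = prod_list (map (\<lambda>b. \<i> * of_real (\<zeta> \<bullet> b)) w)"

text \<open>
  The parameter \<open>d\<close> is the scale: \<open>op d\<close> is \<open>op 1\<close> after the dilation by \<open>d powr wt b\<close>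
  in the direction \<open>b\<close>, multiplied by \<open>d powr m\<close>.
\<close>

locale semielliptic =
  fixes wt :: "'a::euclidean_space \<Rightarrow> real"
    and I :: "'i set" and cf :: "'i \<Rightarrow> complex" and wd :: "'i \<Rightarrow> 'a list" and m :: real and e0 :: 'a
  assumes wt_ge_1: "b \<in> Basis \<Longrightarrow> 1 \<le> wt b"
    and finite_I: "finite I"
    and wd_Basis: "i \<in> I \<Longrightarrow> set (wd i) \<subseteq> Basis"
    and wl_le: "i \<in> I \<Longrightarrow> wl wt (wd i) \<le> m"
    and elliptic_est: "\<exists>c>0. \<exists>R. \<forall>\<zeta> d. 0 < d \<longrightarrow> d \<le> 1 \<longrightarrow> R \<le> rho wt \<zeta> \<longrightarrow>
      c * rho wt \<zeta> powr m \<le> cmod (\<Sum>i\<in>I. cf i * of_real (d powr (m - wl wt (wd i))) * isym (wd i) \<zeta>)"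
    and nonresonant: "finite {s. (\<Sum>i\<in>I. cf i * isym (wd i) (\<zeta> + s *\<^sub>R e0)) = 0}"
begin

definition symb :: "real \<Rightarrow> 'a \<Rightarrow> complex" where
  "symb d \<zeta> = (\<Sum>i\<in>I. cf i * of_real (d powr (m - wl wt (wd i))) * isym (wd i) \<zeta>)"

definition op :: "real \<Rightarrow> ('a \<Rightarrow> complex) \<Rightarrow> 'a \<Rightarrow> complex" where
  "op d u z = (\<Sum>i\<in>I. cf i * of_real (d powr (m - wl wt (wd i))) * pdw (wd i) u z)"

abbreviation \<rho> :: "'a \<Rightarrow> real" where "\<rho> \<equiv> rho wt"

lemma rho_ge_1: "1 \<le> \<rho> \<zeta>"
  unfolding rho_def by (simp add: sum_nonneg)

lemma rho_pos [simp]: "0 < \<rho> \<zeta>"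
  using rho_ge_1[of \<zeta>] by linarith

lemma rho_neq_0 [simp]: "\<rho> \<zeta> \<noteq> 0" and rho_abs [simp]: "\<bar>\<rho> \<zeta>\<bar> = \<rho> \<zeta>"
  using rho_pos[of \<zeta>] by linarith+

lemma powr_rho_mono: "s \<le> t \<Longrightarrow> \<rho> \<zeta> powr s \<le> \<rho> \<zeta> powr t"
  by (rule powr_mono[OF _ rho_ge_1])

lemma abs_le_rho:
  assumes "b \<in> Basis"
  shows "\<bar>\<zeta> \<bullet> b\<bar> \<le> \<rho> \<zeta> powr wt b"
proof -
  have w: "0 < wt b" using wt_ge_1[OF assms] by simp
  have "\<bar>\<zeta> \<bullet> b\<bar> powr (1 / wt b) \<le> (\<Sum>b\<in>Basis. \<bar>\<zeta> \<bullet> b\<bar> powr (1 / wt b))"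
    using assms by (intro member_le_sum) auto
  also have "\<dots> \<le> \<rho> \<zeta>" by (simp add: rho_def)
  finally have "(\<bar>\<zeta> \<bullet> b\<bar> powr (1 / wt b)) powr wt b \<le> \<rho> \<zeta> powr wt b"
    using w by (intro powr_mono2) auto
  then show ?thesis using w by (simp add: powr_powr)
qed

lemma isym_le_rho:
  assumes "set w \<subseteq> Basis"
  shows "cmod (isym w \<zeta>) \<le> \<rho> \<zeta> powr wl wt w"
  using assms
proof (induction w)
  case (Cons b w)
  have "cmod (isym (b # w) \<zeta>) = \<bar>\<zeta> \<bullet> b\<bar> * cmod (isym w \<zeta>)"
    by (simp add: isym_def norm_mult)
  also have "\<dots> \<le> \<rho> \<zeta> powr wt b * \<rho> \<zeta> powr wl wt w"
    using Cons abs_le_rho[of b \<zeta>] by (intro mult_mono) auto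
  finally show ?case by (simp add: wl_def powr_add)
qed (simp add: isym_def wl_def)

text \<open>Each factor 1 + (\<zeta> \<bullet> b)^2 is at most twice the power
  \<open>2 * wt b\<close> of the weighted frequency, whence the exponent. By this comparison such a
  power is summable over every shifted lattice.\<close>

lemma rho_summable_bound:
  "\<rho> \<zeta> powr (- (2 * sum wt Basis)) \<le> 2 ^ DIM('a) * (\<Prod>b\<in>Basis. 1 / (1 + (\<zeta> \<bullet> b)\<^sup>2))"
proof -
  have "(\<Prod>b\<in>Basis. 1 + (\<zeta> \<bullet> b)\<^sup>2) \<le> (\<Prod>b\<in>Basis. 2 * \<rho> \<zeta> powr (2 * wt b))"
  proof (intro prod_mono conjI)
    fix b :: 'a assume b: "b \<in> Basis"
    have "(\<zeta> \<bullet> b)\<^sup>2 \<le> (\<rho> \<zeta> powr wt b)\<^sup>2"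
      using abs_le_rho[OF b, of \<zeta>] by (intro power2_le_iff_abs_le[THEN iffD2]) auto
    also have "\<dots> = \<rho> \<zeta> powr (2 * wt b)" by (simp add: powr_powr[symmetric] power2_eq_square powr_add[symmetric])
    moreover have "1 \<le> \<rho> \<zeta> powr (2 * wt b)"
      using rho_ge_1 wt_ge_1[OF b] by (intro ge_one_powr_ge_zero) auto
    ultimately show "1 + (\<zeta> \<bullet> b)\<^sup>2 \<le> 2 * \<rho> \<zeta> powr (2 * wt b)" by linarith
  qed (simp add: add_nonneg_nonneg)
  also have "\<dots> = 2 ^ DIM('a) * \<rho> \<zeta> powr (2 * sum wt Basis)"
    by (simp add: prod.distrib powr_sum sum_distrib_left)
  finally have A: "(\<Prod>b\<in>Basis. 1 + (\<zeta> \<bullet> b)\<^sup>2) \<le> 2 ^ DIM('a) * \<rho> \<zeta> powr (2 * sum wt Basis)" .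
  have P: "0 < (\<Prod>b\<in>Basis. 1 + (\<zeta> \<bullet> b)\<^sup>2)" by (intro prod_pos) (simp add: add_pos_nonneg)
  have Q: "0 < \<rho> \<zeta> powr (2 * sum wt Basis)" by simp
  have "inverse (\<rho> \<zeta> powr (2 * sum wt Basis)) \<le> 2 ^ DIM('a) * inverse (\<Prod>b\<in>Basis. 1 + (\<zeta> \<bullet> b)\<^sup>2)"
    using A P Q by (simp add: field_simps)
  then show ?thesis by (simp add: powr_minus prod_dividef inverse_eq_divide)
qed

text \<open>The constant depends on the cutoff but not on the member of \<open>F\<close>. Letting
  \<open>F\<close> consist of the bounded solutions of all the operators \<open>op d\<close> yields
  estimates that are uniform in the scale.\<close>

definition decay :: "'a set \<Rightarrow> ('a \<Rightarrow> complex) set \<Rightarrow> real \<Rightarrow> bool" where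
  "decay U F s \<longleftrightarrow> (\<forall>\<eta>. test U \<eta> \<longrightarrow> (\<exists>C\<ge>0. \<forall>u\<in>F. \<forall>\<zeta>. cmod (hat (\<lambda>z. \<eta> z * u z) \<zeta>) \<le> C * \<rho> \<zeta> powr (- s)))"

text \<open>
  Moving the cutoff through a derivative costs terms in which one derivative falls on the cutoff;
  as all weights are at least 1, these are smaller by a factor \<open>\<rho>\<close>.
\<close>

lemma decay_word:
  assumes U: "open U" and F: "\<And>u. u \<in> F \<Longrightarrow> smooth_on U u" and dec: "decay U F s"
    and w: "set w \<subseteq> Basis" and \<eta>: "test U \<eta>"
  shows "\<exists>C\<ge>0. \<forall>u\<in>F. \<forall>\<zeta>. cmod (hat (\<lambda>z. \<eta> z * pdw w u z) \<zeta> - isym w \<zeta> * hat (\<lambda>z. \<eta> z * u z) \<zeta>)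
    \<le> C * \<rho> \<zeta> powr (wl wt w - 1 - s)"
    and "\<exists>C\<ge>0. \<forall>u\<in>F. \<forall>\<zeta>. cmod (hat (\<lambda>z. \<eta> z * pdw w u z) \<zeta>) \<le> C * \<rho> \<zeta> powr (wl wt w - s)"
proof -
  \<comment> \<open>The second bound follows from the first. It is proved for every cutoff, because
    the induction for the first bound needs it with the cutoff \<open>pd b \<eta>\<close>.\<close>
  have AB: "\<exists>C\<ge>0. \<forall>u\<in>F. \<forall>\<zeta>. cmod (hat (\<lambda>z. \<eta> z * pdw w u z) \<zeta>) \<le> C * \<rho> \<zeta> powr (wl wt w - s)"
    if A: "\<exists>C\<ge>0. \<forall>u\<in>F. \<forall>\<zeta>. cmod (hat (\<lambda>z. \<eta> z * pdw w u z) \<zeta> - isym w \<zeta> * hat (\<lambda>z. \<eta> z * u z) \<zeta>)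
      \<le> C * \<rho> \<zeta> powr (wl wt w - 1 - s)" and w: "set w \<subseteq> Basis" and t\<eta>: "test U \<eta>" for w \<eta>
  proof -
    obtain C where C: "C \<ge> 0" "\<And>u \<zeta>. u \<in> F \<Longrightarrow> cmod (hat (\<lambda>z. \<eta> z * pdw w u z) \<zeta> - isym w \<zeta> * hat (\<lambda>z. \<eta> z * u z) \<zeta>)
      \<le> C * \<rho> \<zeta> powr (wl wt w - 1 - s)" using A by blast
    obtain C' where C': "C' \<ge> 0" "\<And>u \<zeta>. u \<in> F \<Longrightarrow> cmod (hat (\<lambda>z. \<eta> z * u z) \<zeta>) \<le> C' * \<rho> \<zeta> powr (- s)"
      using dec t\<eta> unfolding decay_def by blast
    have "cmod (hat (\<lambda>z. \<eta> z * pdw w u z) \<zeta>) \<le> (C + C') * \<rho> \<zeta> powr (wl wt w - s)" if u: "u \<in> F" for u \<zeta>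
    proof -
      let ?x = "hat (\<lambda>z. \<eta> z * pdw w u z) \<zeta>" and ?y = "isym w \<zeta> * hat (\<lambda>z. \<eta> z * u z) \<zeta>"
      have "cmod ?x \<le> cmod (?x - ?y) + cmod ?y"
        using norm_triangle_sub[of ?x ?y] by (simp add: add.commute)
      also have "cmod ?y \<le> \<rho> \<zeta> powr wl wt w * (C' * \<rho> \<zeta> powr (- s))"
        unfolding norm_mult using isym_le_rho[OF w] C'(2)[OF u] by (intro mult_mono) auto
      also have "\<dots> = C' * \<rho> \<zeta> powr (wl wt w - s)"
        using powr_add[of "\<rho> \<zeta>" "wl wt w" "- s"] by simp
      also have "cmod (?x - ?y) \<le> C * \<rho> \<zeta> powr (wl wt w - s)"
        using order_trans[OF C(2)[OF u] mult_left_mono[OF powr_rho_mono C(1)]] by simp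
      finally show ?thesis by (simp add: algebra_simps)
    qed
    then show ?thesis using C(1) C'(1) by (intro exI[of _ "C + C'"]) auto
  qed
  show A: "\<exists>C\<ge>0. \<forall>u\<in>F. \<forall>\<zeta>. cmod (hat (\<lambda>z. \<eta> z * pdw w u z) \<zeta> - isym w \<zeta> * hat (\<lambda>z. \<eta> z * u z) \<zeta>)
    \<le> C * \<rho> \<zeta> powr (wl wt w - 1 - s)"
    using w \<eta>
  proof (induction w arbitrary: \<eta>)
    case Nil
    then show ?case by (auto simp: isym_def intro!: exI[of _ 0])
  next
    case (Cons b w)
    have b: "b \<in> Basis" and w: "set w \<subseteq> Basis" using Cons.prems by auto
    obtain C1 where C1: "C1 \<ge> 0" "\<And>u \<zeta>. u \<in> F \<Longrightarrow> cmod (hat (\<lambda>z. \<eta> z * pdw w u z) \<zeta> - isym w \<zeta> * hat (\<lambda>z. \<eta> z * u z) \<zeta>)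
      \<le> C1 * \<rho> \<zeta> powr (wl wt w - 1 - s)" using Cons.IH[OF w Cons.prems(2)] by blast
    have t': "test U (pd b \<eta>)" by (rule test_pd[OF Cons.prems(2) b])
    obtain C2 where C2: "C2 \<ge> 0" "\<And>u \<zeta>. u \<in> F \<Longrightarrow> cmod (hat (\<lambda>z. pd b \<eta> z * pdw w u z) \<zeta>) \<le> C2 * \<rho> \<zeta> powr (wl wt w - s)"
      using AB[OF Cons.IH[OF w t'] w t'] by blast
    have "cmod (hat (\<lambda>z. \<eta> z * pdw (b # w) u z) \<zeta> - isym (b # w) \<zeta> * hat (\<lambda>z. \<eta> z * u z) \<zeta>)
      \<le> (C1 + C2) * \<rho> \<zeta> powr (wl wt (b # w) - 1 - s)" if u: "u \<in> F" for u \<zeta>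
    proof -
      have sv: "smooth_on U (pdw w u)" by (rule smooth_on_pdw[OF F[OF u] w])
      have t1: "test U (\<lambda>z. \<eta> z * pdw w u z)" by (rule test_mult[OF U Cons.prems(2) sv])
      have t2: "test U (\<lambda>z. pd b \<eta> z * pdw w u z)" by (rule test_mult[OF U t' sv])
      have "(\<lambda>z. \<eta> z * pdw (b # w) u z) = (\<lambda>z. pd b (\<lambda>z. \<eta> z * pdw w u z) z - pd b \<eta> z * pdw w u z)"
        using pd_test_mult[OF U Cons.prems(2) sv, of b] by (simp add: fun_eq_iff)
      then have h: "hat (\<lambda>z. \<eta> z * pdw (b # w) u z) \<zeta> = \<i> * of_real (\<zeta> \<bullet> b) * hat (\<lambda>z. \<eta> z * pdw w u z) \<zeta>
          - hat (\<lambda>z. pd b \<eta> z * pdw w u z) \<zeta>"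
        using hat_diff[OF test_pd[OF t1 b] t2] hat_pd[OF t1 b] by simp
      have "cmod (hat (\<lambda>z. \<eta> z * pdw (b # w) u z) \<zeta> - isym (b # w) \<zeta> * hat (\<lambda>z. \<eta> z * u z) \<zeta>) =
        cmod (\<i> * of_real (\<zeta> \<bullet> b) * (hat (\<lambda>z. \<eta> z * pdw w u z) \<zeta> - isym w \<zeta> * hat (\<lambda>z. \<eta> z * u z) \<zeta>)
          - hat (\<lambda>z. pd b \<eta> z * pdw w u z) \<zeta>)"
        unfolding h by (simp add: isym_def algebra_simps)
      also have "\<dots> \<le> \<bar>\<zeta> \<bullet> b\<bar> * cmod (hat (\<lambda>z. \<eta> z * pdw w u z) \<zeta> - isym w \<zeta> * hat (\<lambda>z. \<eta> z * u z) \<zeta>)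
          + cmod (hat (\<lambda>z. pd b \<eta> z * pdw w u z) \<zeta>)"
        by (rule order_trans[OF norm_triangle_ineq4]) (simp add: norm_mult)
      also have "\<dots> \<le> \<rho> \<zeta> powr wt b * (C1 * \<rho> \<zeta> powr (wl wt w - 1 - s)) + C2 * \<rho> \<zeta> powr (wl wt (b # w) - 1 - s)"
      proof (intro add_mono mult_mono abs_le_rho b C1(2) u)
        have "C2 * \<rho> \<zeta> powr (wl wt w - s) \<le> C2 * \<rho> \<zeta> powr (wl wt (b # w) - 1 - s)"
          using wt_ge_1[OF b] C2(1) by (intro mult_left_mono powr_rho_mono) (auto simp: wl_def)
        then show "cmod (hat (\<lambda>z. pd b \<eta> z * pdw w u z) \<zeta>) \<le> C2 * \<rho> \<zeta> powr (wl wt (b # w) - 1 - s)"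
          using C2(2)[OF u, of \<zeta>] by linarith
      qed auto
      also have "\<rho> \<zeta> powr wt b * (C1 * \<rho> \<zeta> powr (wl wt w - 1 - s)) = C1 * \<rho> \<zeta> powr (wl wt (b # w) - 1 - s)"
        using powr_add[of "\<rho> \<zeta>" "wt b" "wl wt w - 1 - s"] by (simp add: wl_def algebra_simps)
      finally show ?thesis by (simp add: algebra_simps)
    qed
    then show ?case using C1(1) C2(1) by (intro exI[of _ "C1 + C2"]) auto
  qed
  show "\<exists>C\<ge>0. \<forall>u\<in>F. \<forall>\<zeta>. cmod (hat (\<lambda>z. \<eta> z * pdw w u z) \<zeta>) \<le> C * \<rho> \<zeta> powr (wl wt w - s)"
    by (rule AB[OF A w \<eta>])
qed

lemma decay_0:
  assumes "open U" "\<And>u. u \<in> F \<Longrightarrow> smooth_on U u" "\<And>u z. u \<in> F \<Longrightarrow> z \<in> U \<Longrightarrow> cmod (u z) \<le> 1"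
  shows "decay U F 0"
  unfolding decay_def
proof (intro allI impI)
  fix \<eta> assume \<eta>: "test U \<eta>"
  obtain S where S: "S \<subseteq> U" "\<And>z. z \<notin> S \<Longrightarrow> \<eta> z = 0"
    using \<eta> unfolding test_def by blast
  have "cmod (hat (\<lambda>z. \<eta> z * u z) \<zeta>) \<le> (\<integral>z. cmod (\<eta> z) \<partial>lborel) * \<rho> \<zeta> powr (- 0)" if u: "u \<in> F" for u \<zeta>
  proof -
    have "cmod (hat (\<lambda>z. \<eta> z * u z) \<zeta>) \<le> (\<integral>z. cmod (\<eta> z * u z) \<partial>lborel)" by (rule hat_bound)
    also have "\<dots> \<le> (\<integral>z. cmod (\<eta> z) \<partial>lborel)"
    proof (intro integral_mono integrable_norm test_integrable[OF \<eta>] test_integrable[OF test_mult[OF assms(1) \<eta> assms(2)[OF u]]])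
      show "cmod (\<eta> z * u z) \<le> cmod (\<eta> z)" for z
        using assms(3)[OF u, of z] S by (cases "z \<in> S") (auto simp: norm_mult intro!: mult_left_le)
    qed
    finally show ?thesis by simp
  qed
  then show "\<exists>C\<ge>0. \<forall>u\<in>F. \<forall>\<zeta>. cmod (hat (\<lambda>z. \<eta> z * u z) \<zeta>) \<le> C * \<rho> \<zeta> powr (- 0)"
    by (intro exI[of _ "\<integral>z. cmod (\<eta> z) \<partial>lborel"]) auto
qed

text \<open>As the cutoff times \<open>op d u\<close> is 0, the symbol times the coefficient of
  \<eta> u equals minus the sum of the commutator errors of \<open>decay_word\<close>, which have
  order m - 1 - s. Division by the symbol, of size \<rho> powr m, gains one power. Where \<rho> is
  below R, one power of \<rho> costs only a constant.\<close>

lemma decay_step: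
  assumes U: "open U" and F: "\<And>u. u \<in> F \<Longrightarrow> smooth_on U u"
    and sol: "\<And>u. u \<in> F \<Longrightarrow> \<exists>d. 0 < d \<and> d \<le> 1 \<and> (\<forall>z\<in>U. op d u z = 0)"
    and dec: "decay U F s"
  shows "decay U F (s + 1)"
  unfolding decay_def
proof (intro allI impI)
  fix \<eta> assume \<eta>: "test U \<eta>"
  obtain S where S: "S \<subseteq> U" "\<And>z. z \<notin> S \<Longrightarrow> \<eta> z = 0"
    using \<eta> unfolding test_def by blast
  obtain c R where cR: "c > 0" "\<And>\<zeta> d. 0 < d \<Longrightarrow> d \<le> 1 \<Longrightarrow> R \<le> \<rho> \<zeta> \<Longrightarrow> c * \<rho> \<zeta> powr m \<le> cmod (symb d \<zeta>)"
    using elliptic_est[folded symb_def] by blast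
  obtain C0 where C0: "C0 \<ge> 0" "\<And>u \<zeta>. u \<in> F \<Longrightarrow> cmod (hat (\<lambda>z. \<eta> z * u z) \<zeta>) \<le> C0 * \<rho> \<zeta> powr (- s)"
    using dec \<eta> unfolding decay_def by blast
  have "\<forall>i\<in>I. \<exists>C\<ge>0. \<forall>u\<in>F. \<forall>\<zeta>. cmod (hat (\<lambda>z. \<eta> z * pdw (wd i) u z) \<zeta> - isym (wd i) \<zeta> * hat (\<lambda>z. \<eta> z * u z) \<zeta>)
    \<le> C * \<rho> \<zeta> powr (wl wt (wd i) - 1 - s)"
    using decay_word(1)[OF U F dec wd_Basis \<eta>] by blast
  from bchoice[OF this] obtain C where "\<forall>i\<in>I. C i \<ge> 0 \<and>
    (\<forall>u\<in>F. \<forall>\<zeta>. cmod (hat (\<lambda>z. \<eta> z * pdw (wd i) u z) \<zeta> - isym (wd i) \<zeta> * hat (\<lambda>z. \<eta> z * u z) \<zeta>)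
    \<le> C i * \<rho> \<zeta> powr (wl wt (wd i) - 1 - s))" by blast
  then have C: "\<And>i. i \<in> I \<Longrightarrow> C i \<ge> 0"
    "\<And>i u \<zeta>. i \<in> I \<Longrightarrow> u \<in> F \<Longrightarrow> cmod (hat (\<lambda>z. \<eta> z * pdw (wd i) u z) \<zeta> - isym (wd i) \<zeta> * hat (\<lambda>z. \<eta> z * u z) \<zeta>)
    \<le> C i * \<rho> \<zeta> powr (wl wt (wd i) - 1 - s)"
    by blast+
  define C' where "C' = (\<Sum>i\<in>I. cmod (cf i) * C i)"
  have C': "C' \<ge> 0" unfolding C'_def using C(1) by (intro sum_nonneg) auto
  have "cmod (hat (\<lambda>z. \<eta> z * u z) \<zeta>) \<le> (C' / c + C0 * \<bar>R\<bar>) * \<rho> \<zeta> powr (- (s + 1))" if u: "u \<in> F" for u \<zeta>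
  proof (cases "R \<le> \<rho> \<zeta>")
    case True
    obtain d where d: "0 < d" "d \<le> 1" "\<And>z. z \<in> U \<Longrightarrow> op d u z = 0" using sol[OF u] by blast
    \<comment> \<open>Since d is at most 1 and all orders are at most m, the rescaled coefficients
      are bounded by the original ones; this makes the constant independent of d.\<close>
    define a where "a i = cf i * of_real (d powr (m - wl wt (wd i)))" for i
    have a: "cmod (a i) \<le> cmod (cf i)" if "i \<in> I" for i
    proof -
      have "d powr (m - wl wt (wd i)) \<le> 1 powr (m - wl wt (wd i))"
        using d wl_le[OF that] by (intro powr_mono2) auto
      then show ?thesis by (simp add: a_def norm_mult mult_left_le)
    qed
    have ti: "test U (\<lambda>z. \<eta> z * pdw (wd i) u z)" if "i \<in> I" for i
      by (rule test_mult[OF U \<eta> smooth_on_pdw[OF F[OF u] wd_Basis[OF that]]])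
    have "(\<Sum>i\<in>I. a i * (\<eta> z * pdw (wd i) u z)) = 0" for z
    proof -
      have "(\<Sum>i\<in>I. a i * (\<eta> z * pdw (wd i) u z)) = \<eta> z * op d u z"
        by (simp add: op_def a_def sum_distrib_left mult_ac)
      then show ?thesis using d(3)[of z] S by (cases "z \<in> S") auto
    qed
    then have "0 = hat (\<lambda>z. \<Sum>i\<in>I. a i * (\<eta> z * pdw (wd i) u z)) \<zeta>" by (simp add: hat_def)
    also have "\<dots> = (\<Sum>i\<in>I. a i * hat (\<lambda>z. \<eta> z * pdw (wd i) u z) \<zeta>)"
      by (subst hat_sum[of I U]) (auto intro: test_cmult[OF ti] simp: hat_cmult)
    finally have z: "(\<Sum>i\<in>I. a i * hat (\<lambda>z. \<eta> z * pdw (wd i) u z) \<zeta>) = 0" by simp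
    have "symb d \<zeta> * hat (\<lambda>z. \<eta> z * u z) \<zeta> = (\<Sum>i\<in>I. a i * (isym (wd i) \<zeta> * hat (\<lambda>z. \<eta> z * u z) \<zeta>))"
      by (simp add: symb_def a_def sum_distrib_right mult.assoc)
    also have "\<dots> = - (\<Sum>i\<in>I. a i * (hat (\<lambda>z. \<eta> z * pdw (wd i) u z) \<zeta> - isym (wd i) \<zeta> * hat (\<lambda>z. \<eta> z * u z) \<zeta>))"
      by (simp add: right_diff_distrib sum_subtractf z)
    finally have "cmod (symb d \<zeta> * hat (\<lambda>z. \<eta> z * u z) \<zeta>) \<le>
      (\<Sum>i\<in>I. cmod (cf i) * C i * \<rho> \<zeta> powr (m - 1 - s))"
    proof (simp only: norm_minus_cancel, intro sum_norm_le)
      fix i assume i: "i \<in> I"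
      have "cmod (hat (\<lambda>z. \<eta> z * pdw (wd i) u z) \<zeta> - isym (wd i) \<zeta> * hat (\<lambda>z. \<eta> z * u z) \<zeta>) \<le> C i * \<rho> \<zeta> powr (m - 1 - s)"
        using order_trans[OF C(2)[OF i u] mult_left_mono[OF powr_rho_mono C(1)[OF i]]] wl_le[OF i] by simp
      then show "cmod (a i * (hat (\<lambda>z. \<eta> z * pdw (wd i) u z) \<zeta> - isym (wd i) \<zeta> * hat (\<lambda>z. \<eta> z * u z) \<zeta>))
        \<le> cmod (cf i) * C i * \<rho> \<zeta> powr (m - 1 - s)"
        unfolding norm_mult mult.assoc using a[OF i] by (intro mult_mono) auto
    qed
    then have 1: "cmod (symb d \<zeta>) * cmod (hat (\<lambda>z. \<eta> z * u z) \<zeta>) \<le> C' * \<rho> \<zeta> powr (m - 1 - s)"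
      by (simp add: C'_def sum_distrib_right norm_mult)
    have "c * \<rho> \<zeta> powr m * cmod (hat (\<lambda>z. \<eta> z * u z) \<zeta>) \<le> cmod (symb d \<zeta>) * cmod (hat (\<lambda>z. \<eta> z * u z) \<zeta>)"
      using cR(2)[OF d(1,2) True] by (intro mult_right_mono) auto
    also note 1
    also have "\<rho> \<zeta> powr (m - 1 - s) = \<rho> \<zeta> powr m * \<rho> \<zeta> powr (- (s + 1))"
      by (simp add: powr_add[symmetric] algebra_simps)
    finally have "\<rho> \<zeta> powr m * (c * cmod (hat (\<lambda>z. \<eta> z * u z) \<zeta>)) \<le> \<rho> \<zeta> powr m * (C' * \<rho> \<zeta> powr (- (s + 1)))"
      by (simp add: mult_ac)
    then have "c * cmod (hat (\<lambda>z. \<eta> z * u z) \<zeta>) \<le> C' * \<rho> \<zeta> powr (- (s + 1))"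
      by (subst (asm) mult_le_cancel_left_pos) auto
    then have "cmod (hat (\<lambda>z. \<eta> z * u z) \<zeta>) \<le> C' / c * \<rho> \<zeta> powr (- (s + 1))"
      using cR(1) by (simp add: field_simps)
    also have "\<dots> \<le> (C' / c + C0 * \<bar>R\<bar>) * \<rho> \<zeta> powr (- (s + 1))"
      using C0(1) by (intro mult_right_mono) auto
    finally show ?thesis .
  next
    case False
    have "\<rho> \<zeta> powr (- s) = \<rho> \<zeta> * \<rho> \<zeta> powr (- (s + 1))"
      using powr_add[of "\<rho> \<zeta>" 1 "- (s + 1)"] by simp
    also have "\<dots> \<le> \<bar>R\<bar> * \<rho> \<zeta> powr (- (s + 1))"
      using False by (intro mult_right_mono) auto
    finally have "C0 * \<rho> \<zeta> powr (- s) \<le> C0 * (\<bar>R\<bar> * \<rho> \<zeta> powr (- (s + 1)))"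
      using C0(1) by (rule mult_left_mono)
    moreover have "0 \<le> C' / c * \<rho> \<zeta> powr (- (s + 1))" using C' cR(1) by simp
    ultimately show ?thesis using C0(2)[OF u, of \<zeta>] by (simp add: algebra_simps)
  qed
  then show "\<exists>C\<ge>0. \<forall>u\<in>F. \<forall>\<zeta>. cmod (hat (\<lambda>z. \<eta> z * u z) \<zeta>) \<le> C * \<rho> \<zeta> powr (- (s + 1))"
    using C' C0(1) cR(1) by (intro exI[of _ "C' / c + C0 * \<bar>R\<bar>"]) auto
qed

lemma decay_solutions:
  assumes U: "open U" and F: "\<And>u. u \<in> F \<Longrightarrow> smooth_on U u"
    and sol: "\<And>u. u \<in> F \<Longrightarrow> \<exists>d. 0 < d \<and> d \<le> 1 \<and> (\<forall>z\<in>U. op d u z = 0)"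
    and bd: "\<And>u z. u \<in> F \<Longrightarrow> z \<in> U \<Longrightarrow> cmod (u z) \<le> 1"
  shows "decay U F s"
proof -
  have n: "decay U F (real n)" for n
  proof (induction n)
    case 0
    show ?case unfolding of_nat_0 by (rule decay_0) (use U F bd in auto)
  next
    case (Suc n)
    have "decay U F (real n + 1)" by (rule decay_step[OF U F sol Suc.IH])
    then show ?case by (simp add: add.commute)
  qed
  obtain n where n': "s \<le> real n" using real_arch_simple by blast
  show ?thesis unfolding decay_def
  proof (intro allI impI)
    fix \<eta> assume "test U \<eta>"
    then obtain C where C: "C \<ge> 0" "\<And>u \<zeta>. u \<in> F \<Longrightarrow> cmod (hat (\<lambda>z. \<eta> z * u z) \<zeta>) \<le> C * \<rho> \<zeta> powr (- real n)"
      using n unfolding decay_def by blast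
    have "C * \<rho> \<zeta> powr (- real n) \<le> C * \<rho> \<zeta> powr (- s)" for \<zeta>
      using n' C(1) by (intro mult_left_mono powr_rho_mono) auto
    then show "\<exists>C\<ge>0. \<forall>u\<in>F. \<forall>\<zeta>. cmod (hat (\<lambda>z. \<eta> z * u z) \<zeta>) \<le> C * \<rho> \<zeta> powr (- s)"
      using C by (meson order_trans)
  qed
qed

subsection \<open>Interior estimates\<close>

definition sol :: "'a set \<Rightarrow> ('a \<Rightarrow> complex) \<Rightarrow> bool" where
  "sol X u \<longleftrightarrow> smooth_on X u \<and> (\<forall>z\<in>X. op 1 u z = 0)"

text \<open>Decay of order \<sigma> + wt b leaves \<rho> powr (- \<sigma>), a summable bound, for
  the coefficients of the derivative of \<eta> u, and the inversion formula at 0 bounds the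
  gradient. The lattice scale 1 is large enough since the unit box lies in the cube of half side
  pi.\<close>

lemma gradient_unit:
  assumes b: "b \<in> Basis"
  obtains C where "C \<ge> 0" "\<And>u d. smooth_on (box (- One) One) u \<Longrightarrow> 0 < d \<Longrightarrow> d \<le> 1 \<Longrightarrow>
    (\<And>z. z \<in> box (- One) One \<Longrightarrow> op d u z = 0) \<Longrightarrow> (\<And>z. z \<in> box (- One) One \<Longrightarrow> cmod (u z) \<le> 1) \<Longrightarrow> cmod (pd b u 0) \<le> C"
proof -
  define U where "U = box (- One) (One :: 'a)"
  define F where "F = {u. smooth_on U u \<and> (\<exists>d. 0 < d \<and> d \<le> 1 \<and> (\<forall>z\<in>U. op d u z = 0)) \<and> (\<forall>z\<in>U. cmod (u z) \<le> 1)}"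
  have U: "open U" "0 \<in> U" unfolding U_def by (rule open_box) (simp add: box_def)
  obtain \<eta> N where \<eta>: "test U \<eta>" "open N" "0 \<in> N" "\<And>y. y \<in> N \<Longrightarrow> \<eta> y = 1"
    using test_one_near_compact[of "{0}" U] U by auto
  obtain S where S: "S \<subseteq> U" "\<And>z. z \<notin> S \<Longrightarrow> \<eta> z = 0"
    using \<eta>(1) unfolding test_def by blast
  define \<sigma> where "\<sigma> = 2 * sum wt Basis"
  have "decay U F (\<sigma> + wt b)" by (rule decay_solutions[OF U(1)]) (auto simp: F_def)
  then obtain C where C: "C \<ge> 0" "\<And>u \<zeta>. u \<in> F \<Longrightarrow> cmod (hat (\<lambda>z. \<eta> z * u z) \<zeta>) \<le> C * \<rho> \<zeta> powr (- (\<sigma> + wt b))"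
    using \<eta>(1) unfolding decay_def by blast
  obtain kk :: "nat \<Rightarrow> 'a" where kk: "bij_betw kk UNIV Lat" using Lat_enum by blast
  define p where "p n = (\<Prod>b\<in>Basis. 1 / (1 + ((kk n /\<^sub>R 1 + 0) \<bullet> b)\<^sup>2))" for n
  have p: "summable p" unfolding p_def using summable_shifted_Lat[OF kk, of 1 0] by simp
  have p0: "p n \<ge> 0" for n unfolding p_def by (intro prod_nonneg) (simp add: add_nonneg_nonneg)
  define V where "V = (2 * pi * 1) ^ DIM('a)"
  have V: "V > 0" by (simp add: V_def)
  show ?thesis
  proof (rule that)
    show "0 \<le> C * 2 ^ DIM('a) * suminf p / V" using C(1) V suminf_nonneg[OF p p0] by simp
  next
    fix u d
    assume "smooth_on (box (- One) One) u" "0 < d" "d \<le> 1"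
      "\<And>z. z \<in> box (- One) One \<Longrightarrow> op d u z = 0" "\<And>z. z \<in> box (- One) One \<Longrightarrow> cmod (u z) \<le> 1"
    then have u: "u \<in> F" unfolding F_def U_def by blast
    then have su: "smooth_on U u" by (simp add: F_def)
    have t: "test U (\<lambda>z. \<eta> z * u z)" by (rule test_mult[OF U(1) \<eta>(1) su])
    define \<phi> where "\<phi> = pd b (\<lambda>z. \<eta> z * u z)"
    have t\<phi>: "test U \<phi>" unfolding \<phi>_def by (rule test_pd[OF t b])
    have h: "cmod (hat \<phi> \<zeta>) \<le> C * 2 ^ DIM('a) * (\<Prod>b\<in>Basis. 1 / (1 + (\<zeta> \<bullet> b)\<^sup>2))" for \<zeta>
    proof -
      have "cmod (hat \<phi> \<zeta>) = \<bar>\<zeta> \<bullet> b\<bar> * cmod (hat (\<lambda>z. \<eta> z * u z) \<zeta>)"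
        unfolding \<phi>_def hat_pd[OF t b] by (simp add: norm_mult)
      also have "\<dots> \<le> \<rho> \<zeta> powr wt b * (C * \<rho> \<zeta> powr (- (\<sigma> + wt b)))"
        by (intro mult_mono abs_le_rho b C(2) u) auto
      also have "\<dots> = C * \<rho> \<zeta> powr (- \<sigma>)"
        using powr_add[of "\<rho> \<zeta>" "wt b" "- (\<sigma> + wt b)"] by simp
      also have "\<dots> \<le> C * (2 ^ DIM('a) * (\<Prod>b\<in>Basis. 1 / (1 + (\<zeta> \<bullet> b)\<^sup>2)))"
        unfolding \<sigma>_def by (intro mult_left_mono rho_summable_bound C(1))
      finally show ?thesis by (simp add: mult.assoc)
    qed
    have sm: "summable (\<lambda>n. cmod (hat \<phi> (kk n /\<^sub>R 1 + 0)))"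
      by (rule summable_comparison_test'[OF summable_mult[OF p, of "C * 2 ^ DIM('a)"], where N = 0])
        (use h in \<open>auto simp: p_def\<close>)
    have "(\<lambda>n. hat \<phi> (kk n /\<^sub>R 1 + 0) * cis ((kk n /\<^sub>R 1 + 0) \<bullet> 0)) sums (of_real ((2 * pi * 1) ^ DIM('a)) * \<phi> 0)"
    proof (rule fourier_inversion[OF _ kk _ _ sm])
      show "continuous_on UNIV \<phi>" by (rule smooth_on_continuous_on[OF test_smooth[OF t\<phi>]])
      show "\<phi> z = 0" if "z \<notin> qube (pi * 1) 0" for z
      proof -
        have "z \<in> qube (pi * 1) 0" if "z \<in> U"
        proof -
          have "\<bar>z \<bullet> a\<bar> \<le> pi" if "a \<in> Basis" for a
          proof -
            have "- 1 < z \<bullet> a" "z \<bullet> a < 1" using \<open>z \<in> U\<close> that by (auto simp: U_def box_def)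
            then show ?thesis using pi_gt3 by linarith
          qed
          then show ?thesis by (simp add: qube_def)
        qed
        then show ?thesis using that t\<phi> unfolding test_def by blast
      qed
    qed auto
    then have "V * cmod (\<phi> 0) = cmod (suminf (\<lambda>n. hat \<phi> (kk n /\<^sub>R 1 + 0)))"
      by (simp add: V_def sums_iff norm_mult norm_power)
    also have "\<dots> \<le> (suminf (\<lambda>n. cmod (hat \<phi> (kk n /\<^sub>R 1 + 0))))" by (rule summable_norm[OF sm])
    also have "\<dots> \<le> (suminf (\<lambda>n. C * 2 ^ DIM('a) * p n))"
      by (intro suminf_le sm summable_mult p) (use h in \<open>auto simp: p_def\<close>)
    also have "\<dots> = C * 2 ^ DIM('a) * suminf p" by (rule suminf_mult[OF p])
    finally have "cmod (\<phi> 0) \<le> C * 2 ^ DIM('a) * suminf p / V" using V by (simp add: field_simps)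
    moreover have "\<phi> 0 = pd b u 0"
      unfolding \<phi>_def using \<eta> by (intro pd_cong[of N]) auto
    ultimately show "cmod (pd b u 0) \<le> C * 2 ^ DIM('a) * suminf p / V" by simp
  qed
qed

lemma op_dil:
  assumes X: "open X" "smooth_on X u" and Y: "open Y" "\<And>y. y \<in> Y \<Longrightarrow> a + dil (\<lambda>b. d powr wt b) y \<in> X"
    and d: "d > 0" and y: "y \<in> Y"
  shows "op d (\<lambda>y. u (a + dil (\<lambda>b. d powr wt b) y)) y = of_real (d powr m) * op 1 u (a + dil (\<lambda>b. d powr wt b) y)"
proof -
  have "prod_list (map (\<lambda>b. d powr wt b) w) = d powr wl wt w" for w
    using d by (induction w) (auto simp: wl_def powr_add)
  then have "op d (\<lambda>y. u (a + dil (\<lambda>b. d powr wt b) y)) y = (\<Sum>i\<in>I. cf i * of_real (d powr (m - wl wt (wd i))) *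
      (of_real (d powr wl wt (wd i)) * pdw (wd i) u (a + dil (\<lambda>b. d powr wt b) y)))"
    unfolding op_def using pdw_affine_dil[OF X(1) Y X(2) wd_Basis y] by (intro sum.cong) auto
  also have "\<dots> = (\<Sum>i\<in>I. of_real (d powr m) * (cf i * pdw (wd i) u (a + dil (\<lambda>b. d powr wt b) y)))"
  proof (intro sum.cong refl)
    fix i
    have "d powr m = d powr (m - wl wt (wd i)) * d powr wl wt (wd i)" by (simp add: powr_add[symmetric])
    then show "cf i * of_real (d powr (m - wl wt (wd i))) * (of_real (d powr wl wt (wd i)) * pdw (wd i) u (a + dil (\<lambda>b. d powr wt b) y)) =
      of_real (d powr m) * (cf i * pdw (wd i) u (a + dil (\<lambda>b. d powr wt b) y))" by simp
  qed
  finally show ?thesis by (simp add: op_def sum_distrib_left)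
qed

lemma op_cmult:
  assumes "open X" "smooth_on X u" "z \<in> X"
  shows "op d (\<lambda>z. c * u z) z = c * op d u z"
  unfolding op_def sum_distrib_left
  using pdw_cmult[OF assms(1,2) wd_Basis assms(3)] by (intro sum.cong) (auto simp: mult_ac)

text \<open>Dilation to unit size reduces this to \<open>gradient_unit\<close>, the chain rule
  supplying the power of \<eta>. Because the weights are at least 1 and \<eta> is at most 1, the
  dilated box stays in \<open>qube \<eta> z\<close>.\<close>

lemma gradient_estimate:
  obtains C where "C \<ge> 0" "\<And>b \<eta> X z w M. b \<in> Basis \<Longrightarrow> 0 < \<eta> \<Longrightarrow> \<eta> \<le> 1 \<Longrightarrow> open X \<Longrightarrow> qube \<eta> z \<subseteq> X \<Longrightarrow>
    sol X w \<Longrightarrow> (\<And>y. y \<in> qube \<eta> z \<Longrightarrow> cmod (w y) \<le> M) \<Longrightarrow> cmod (pd b w z) \<le> C * M / \<eta> powr wt b"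
proof -
  let ?U = "box (- One) (One :: 'a)"
  have "\<exists>C\<ge>0. \<forall>u d. smooth_on ?U u \<longrightarrow> 0 < d \<longrightarrow> d \<le> 1 \<longrightarrow>
    (\<forall>z\<in>?U. op d u z = 0) \<longrightarrow> (\<forall>z\<in>?U. cmod (u z) \<le> 1) \<longrightarrow> cmod (pd b u 0) \<le> C" if "b \<in> Basis" for b
    by (rule gradient_unit[OF that]) blast
  then obtain C where C: "\<And>b. b \<in> Basis \<Longrightarrow> C b \<ge> 0"
    "\<And>b u d. b \<in> Basis \<Longrightarrow> smooth_on ?U u \<Longrightarrow> 0 < d \<Longrightarrow> d \<le> 1 \<Longrightarrow>
    (\<forall>z\<in>?U. op d u z = 0) \<Longrightarrow> (\<forall>z\<in>?U. cmod (u z) \<le> 1) \<Longrightarrow> cmod (pd b u 0) \<le> C b"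
    by metis
  define C' where "C' = sum C Basis"
  have CC: "C b \<le> C'" if "b \<in> Basis" for b unfolding C'_def using that C(1) by (intro member_le_sum) auto
  show ?thesis
  proof (rule that)
    show "0 \<le> C'" unfolding C'_def by (intro sum_nonneg C(1))
    fix b :: 'a and \<eta> :: real and X z w M
    assume b: "b \<in> Basis" and \<eta>: "0 < \<eta>" "\<eta> \<le> 1" and X: "open X" "qube \<eta> z \<subseteq> X"
      and w: "sol X w" and M: "\<And>y. y \<in> qube \<eta> z \<Longrightarrow> cmod (w y) \<le> M"
    define l where "l = (\<lambda>b. \<eta> powr wt b)"
    have l: "0 < l b" "b \<in> Basis \<Longrightarrow> l b \<le> \<eta>" for b
      using \<eta> powr_mono'[of 1 "wt b" \<eta>] wt_ge_1[of b] by (auto simp: l_def)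
    have inq: "z + dil l y \<in> qube \<eta> z" if "y \<in> ?U" for y
      unfolding qube_def
    proof (intro CollectI ballI)
      fix a :: 'a assume a: "a \<in> Basis"
      have "- 1 < y \<bullet> a" "y \<bullet> a < 1" using that a by (auto simp: box_def)
      then have "\<bar>y \<bullet> a\<bar> \<le> 1" by linarith
      then have "l a * \<bar>y \<bullet> a\<bar> \<le> \<eta> * 1" using l[of a] a \<eta> by (intro mult_mono) auto
      then show "\<bar>(z + dil l y - z) \<bullet> a\<bar> \<le> \<eta>" using a l(1)[of a] by (simp add: abs_mult)
    qed
    have sw: "smooth_on X w" using w by (simp add: sol_def)
    have M0: "M \<ge> 0" using M[of z] \<eta> order_trans[OF norm_ge_zero] by auto
    \<comment> \<open>\<open>M\<close> may be 0, so the normalisation divides by a larger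
      \<open>M'\<close>, which tends to \<open>M\<close> at the end.\<close>
    have key: "cmod (pd b w z) \<le> C' * M' / \<eta> powr wt b" if M': "M' > M" for M'
    proof -
      have M'0: "M' > 0" using M' M0 by simp
      define u where "u y = complex_of_real (1 / M') * w (z + dil l y)" for y
      have s1: "smooth_on ?U (\<lambda>y. w (z + dil l y))"
        by (rule smooth_on_affine_dil[OF X(1) open_box _ sw]) (use inq X in auto)
      have su: "smooth_on ?U u"
        unfolding u_def by (intro smooth_on_mult s1) auto
      have o: "op \<eta> u y = 0" if "y \<in> ?U" for y
      proof -
        have "op \<eta> (\<lambda>y. w (z + dil l y)) y = of_real (\<eta> powr m) * op 1 w (z + dil l y)"
          unfolding l_def by (rule op_dil[OF X(1) sw open_box _ \<eta>(1) that]) (use inq X in \<open>auto simp: l_def\<close>)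
        moreover have "op 1 w (z + dil l y) = 0" using w inq[OF that] X by (auto simp: sol_def)
        moreover have "op \<eta> u y = complex_of_real (1 / M') * op \<eta> (\<lambda>y. w (z + dil l y)) y"
          unfolding u_def by (rule op_cmult[OF open_box s1 that])
        ultimately show ?thesis by simp
      qed
      have bu: "cmod (u y) \<le> 1" if "y \<in> ?U" for y
        using M[OF inq[OF that]] M' M'0 by (simp add: u_def norm_divide pos_divide_le_eq)
      have z0: "0 \<in> ?U" by (simp add: box_def)
      have "cmod (pd b u 0) \<le> C b" using C(2)[OF b su \<eta>] o bu by blast
      moreover have "pd b u 0 = of_real (1 / M') * (of_real (l b) * pd b w z)"
      proof -
        have zX: "z \<in> X" using X(2) \<eta> by auto
        have d: "w differentiable (at (z + dil l 0))" using smooth_on_differentiable[OF sw zX] by (simp add: dil_def)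
        have "pd b u 0 = of_real (1 / M') * pd b (\<lambda>y. w (z + dil l y)) 0"
          unfolding u_def by (intro pd_cmult smooth_on_differentiable[OF s1 z0])
        then show ?thesis using pd_affine_dil[OF d b] by (simp add: dil_def)
      qed
      ultimately have "l b * cmod (pd b w z) / M' \<le> C'"
        using M'0 l(1)[of b] CC[OF b] by (simp add: norm_mult norm_divide)
      then show ?thesis using M'0 l(1)[of b] by (simp add: l_def field_simps)
    qed
    show "cmod (pd b w z) \<le> C' * M / \<eta> powr wt b"
    proof (rule field_le_epsilon)
      fix e :: real assume e: "e > 0"
      define K where "K = C' / \<eta> powr wt b"
      have K: "K \<ge> 0" unfolding K_def C'_def using C(1) by (simp add: sum_nonneg)
      have "cmod (pd b w z) \<le> K * (M + e / (K + 1))"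
        using key[of "M + e / (K + 1)"] e K by (simp add: K_def)
      also have "\<dots> = K * M + e * (K / (K + 1))" by (simp add: algebra_simps)
      also have "e * (K / (K + 1)) \<le> e * 1" using e K by (intro mult_left_mono) auto
      finally show "cmod (pd b w z) \<le> C' * M / \<eta> powr wt b + e" by (simp add: K_def)
    qed
  qed
qed

end

context semielliptic
begin

section \<open>The solution space: linear operations and derivatives\<close>

lemma sol_smooth: "sol X u \<Longrightarrow> smooth_on X u"
  by (simp add: sol_def)

lemma sol_subset: "sol X u \<Longrightarrow> Y \<subseteq> X \<Longrightarrow> sol Y u"
  unfolding sol_def using smooth_on_subset by blast

lemma op_cong:
  assumes "open X" "\<And>x. x \<in> X \<Longrightarrow> f x = g x" "z \<in> X"
  shows "op d f z = op d g z"
  unfolding op_def using pdw_cong[OF assms] by simp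

lemma sol_cong:
  assumes "open X" "\<And>x. x \<in> X \<Longrightarrow> f x = g x" "sol X f"
  shows "sol X g"
  using assms(3) smooth_on_cong[OF assms(1,2)] op_cong[OF assms(1,2)] by (auto simp: sol_def)

lemma op_zero [simp]: "op d (\<lambda>z. 0) z = 0"
  by (simp add: op_def)

lemma sol_zero [simp]: "sol X (\<lambda>z. 0)"
  by (simp add: sol_def)

lemma sol_cmult: "open X \<Longrightarrow> sol X u \<Longrightarrow> sol X (\<lambda>z. c * u z)"
  unfolding sol_def using op_cmult by (auto intro!: smooth_on_mult)

lemma op_add:
  assumes "open X" "smooth_on X u" "smooth_on X v" "z \<in> X"
  shows "op d (\<lambda>z. u z + v z) z = op d u z + op d v z"
  unfolding op_def sum.distrib[symmetric]
  using pdw_add[OF assms(1-3) wd_Basis assms(4)] by (intro sum.cong) (auto simp: distrib_left)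

lemma sol_add: "open X \<Longrightarrow> sol X u \<Longrightarrow> sol X v \<Longrightarrow> sol X (\<lambda>z. u z + v z)"
  unfolding sol_def using op_add by (auto intro!: smooth_on_add)

lemma sol_diff: "open X \<Longrightarrow> sol X u \<Longrightarrow> sol X v \<Longrightarrow> sol X (\<lambda>z. u z - v z)"
  using sol_add[of X u "\<lambda>z. -1 * v z"] sol_cmult[of X v "-1"] by simp

lemma sol_sum: "open X \<Longrightarrow> (\<And>i. i \<in> J \<Longrightarrow> sol X (u i)) \<Longrightarrow> sol X (\<lambda>z. \<Sum>i\<in>J. u i z)"
  by (induction J rule: infinite_finite_induct) (auto intro: sol_add)

lemma sol_pd:
  assumes X: "open X" and u: "sol X u" and b: "b \<in> Basis"
  shows "sol X (pd b u)"
  unfolding sol_def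
proof (intro conjI ballI)
  have su: "smooth_on X u" using u by (simp add: sol_def)
  show "smooth_on X (pd b u)" by (rule smooth_on_pd[OF su b])
  fix z assume z: "z \<in> X"
  have d: "pdw (wd i) u differentiable (at z)" if "i \<in> I" for i
    by (rule smooth_on_differentiable[OF smooth_on_pdw[OF su wd_Basis[OF that]] z])
  have "op 1 (pd b u) z = (\<Sum>i\<in>I. pd b (\<lambda>z. cf i * of_real (1 powr (m - wl wt (wd i))) * pdw (wd i) u z) z)"
    unfolding op_def
    by (intro sum.cong refl) (simp add: pdw_pd_commute[OF X su z b wd_Basis] pd_cmult[OF d])
  also have "\<dots> = pd b (\<lambda>z. op 1 u z) z"
    unfolding op_def by (intro pd_sum[symmetric]) (use d in auto)
  also have "\<dots> = pd b (\<lambda>z. 0) z"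
    by (rule pd_cong[OF X _ z]) (use u in \<open>auto simp: sol_def\<close>)
  finally show "op 1 (pd b u) z = 0" by simp
qed

lemma sol_pdw: "open X \<Longrightarrow> sol X u \<Longrightarrow> set w \<subseteq> Basis \<Longrightarrow> sol X (pdw w u)"
  by (induction w) (auto intro: sol_pd)

lemma sol_pd_dir:
  assumes X: "open X" and u: "sol X u"
  shows "sol X (pd v u)"
proof (rule sol_cong[OF X])
  show "sol X (\<lambda>z. \<Sum>b\<in>Basis. of_real (v \<bullet> b) * pd b u z)"
    by (rule sol_sum[OF X], rule sol_cmult[OF X], rule sol_pd[OF X u])
  show "(\<Sum>b\<in>Basis. of_real (v \<bullet> b) * pd b u z) = pd v u z" if "z \<in> X" for z
    by (rule pd_expand[OF smooth_on_differentiable[OF sol_smooth[OF u] that], symmetric])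
qed

lemma sol_iter_pd: "open X \<Longrightarrow> sol X u \<Longrightarrow> sol X ((pd v ^^ k) u)"
  by (induction k) (auto intro: sol_pd_dir)

text \<open>In directions spanned by coordinates of weight 1 the gradient estimate loses only a
  factor 1 / \<eta>. For P(D) they are the purely spatial directions, as t has weight m / r >
  1.\<close>

definition xdir :: "'a \<Rightarrow> bool" where
  "xdir v \<longleftrightarrow> (\<forall>b\<in>Basis. wt b \<noteq> 1 \<longrightarrow> v \<bullet> b = 0)"

lemma qube_mono: "c \<le> d \<Longrightarrow> qube c z \<subseteq> qube d z"
  by (auto simp: qube_def)

lemma qube_trans:
  fixes y z :: 'a
  assumes "y \<in> qube c z" shows "qube d y \<subseteq> qube (c + d) z"
proof
  fix x assume x: "x \<in> qube d y"
  show "x \<in> qube (c + d) z" unfolding qube_def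
  proof (intro CollectI ballI)
    fix b :: 'a assume b: "b \<in> Basis"
    have "\<bar>(x - y) \<bullet> b\<bar> \<le> d" "\<bar>(y - z) \<bullet> b\<bar> \<le> c" using assms x b by (auto simp: qube_def)
    then show "\<bar>(x - z) \<bullet> b\<bar> \<le> c + d" by (simp add: inner_diff_left)
  qed
qed

text \<open>Derivatives of solutions are solutions, so the gradient estimate can be repeated. Each
  use shrinks the cube by \<eta>, which is why k uses need the half side k \<eta>.\<close>

lemma iter_pd_bound:
  obtains A where "A \<ge> 0" "\<And>v \<eta> X u M k z. xdir v \<Longrightarrow> 0 < \<eta> \<Longrightarrow> \<eta> \<le> 1 \<Longrightarrow> open X \<Longrightarrow> sol X u \<Longrightarrow>
    qube (real k * \<eta>) z \<subseteq> X \<Longrightarrow> z \<in> X \<Longrightarrow> (\<And>y. y \<in> qube (real k * \<eta>) z \<Longrightarrow> cmod (u y) \<le> M) \<Longrightarrow>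
    cmod ((pd v ^^ k) u z) \<le> (A * norm v / \<eta>) ^ k * M"
proof -
  obtain C where C: "C \<ge> 0" "\<And>b \<eta> X z w M. b \<in> Basis \<Longrightarrow> 0 < \<eta> \<Longrightarrow> \<eta> \<le> 1 \<Longrightarrow> open X \<Longrightarrow> qube \<eta> z \<subseteq> X \<Longrightarrow>
    sol X w \<Longrightarrow> (\<And>y. y \<in> qube \<eta> z \<Longrightarrow> cmod (w y) \<le> M) \<Longrightarrow> cmod (pd b w z) \<le> C * M / \<eta> powr wt b"
    using gradient_estimate by blast
  define A where "A = real DIM('a) * C"
  have grad: "cmod (pd v w z) \<le> (A * norm v / \<eta>) * M" if v: "xdir v" and \<eta>: "0 < \<eta>" "\<eta> \<le> 1" and X: "open X" "qube \<eta> z \<subseteq> X"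
    and w: "sol X w" and M: "\<And>y. y \<in> qube \<eta> z \<Longrightarrow> cmod (w y) \<le> M" for v \<eta> X w M z
  proof -
    have zX: "z \<in> X" using X \<eta> by auto
    have M0: "M \<ge> 0" using M[of z] \<eta> order_trans[OF norm_ge_zero] by auto
    have "cmod (\<Sum>b\<in>Basis. of_real (v \<bullet> b) * pd b w z) \<le> (\<Sum>b\<in>(Basis :: 'a set). norm v * (C * M / \<eta>))"
    proof (intro sum_norm_le)
      fix b :: 'a assume b: "b \<in> Basis"
      show "cmod (of_real (v \<bullet> b) * pd b w z) \<le> norm v * (C * M / \<eta>)"
      proof (cases "wt b = 1")
        case True
        have "cmod (pd b w z) \<le> C * M / \<eta> powr wt b" by (rule C(2)[OF b \<eta> X w M])
        then have "cmod (pd b w z) \<le> C * M / \<eta>" using True \<eta> by simp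
        then show ?thesis unfolding norm_mult norm_of_real using Basis_le_norm[OF b, of v]
          by (intro mult_mono) auto
      next
        case False
        then show ?thesis using v b C(1) M0 \<eta> by (simp add: xdir_def)
      qed
    qed
    also have "\<dots> = (A * norm v / \<eta>) * M" by (simp add: A_def)
    finally show ?thesis
      using pd_expand[OF smooth_on_differentiable[OF sol_smooth[OF w] zX], of v] by simp
  qed
  show ?thesis
  proof (rule that)
    show "A \<ge> 0" using C(1) by (simp add: A_def)
    fix v \<eta> X u M k z
    assume v: "xdir v" and \<eta>: "0 < \<eta>" "\<eta> \<le> 1" and X: "open X" and u: "sol X u"
      and z: "qube (real k * \<eta>) z \<subseteq> X" "z \<in> X" "\<And>y. y \<in> qube (real k * \<eta>) z \<Longrightarrow> cmod (u y) \<le> M"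
    from z show "cmod ((pd v ^^ k) u z) \<le> (A * norm v / \<eta>) ^ k * M"
    proof (induction k arbitrary: z)
      case 0
      then show ?case by simp
    next
      case (Suc k)
      have sub: "qube (real k * \<eta>) y \<subseteq> qube (real (Suc k) * \<eta>) z" if "y \<in> qube \<eta> z" for y
        using qube_trans[OF that, of "real k * \<eta>"] by (simp add: algebra_simps)
      have sub': "qube \<eta> z \<subseteq> qube (real (Suc k) * \<eta>) z"
        using \<eta> by (intro qube_mono) (simp add: algebra_simps)
      have "cmod (pd v ((pd v ^^ k) u) z) \<le> (A * norm v / \<eta>) * ((A * norm v / \<eta>) ^ k * M)"
      proof (rule grad[OF v \<eta> X _ sol_iter_pd[OF X u]])
        show "qube \<eta> z \<subseteq> X" using sub' Suc.prems by blast
        show "cmod ((pd v ^^ k) u y) \<le> (A * norm v / \<eta>) ^ k * M" if "y \<in> qube \<eta> z" for y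
          using sub[OF that] sub' that Suc.prems by (intro Suc.IH) blast+
      qed
      then show ?case by (simp add: mult.assoc)
    qed
  qed
qed

text \<open>One term of the exponential series at k is at most its sum.\<close>

lemma power_self_le_exp_fact: "real k ^ k \<le> exp 1 ^ k * fact k"
proof -
  have "(\<Sum>i\<in>{k}. real k ^ i /\<^sub>R fact i) \<le> suminf (\<lambda>i. real k ^ i /\<^sub>R fact i)"
    by (intro sum_le_suminf summable_exp_generic) auto
  then have "real k ^ k / fact k \<le> exp (real k)"
    by (simp add: exp_def field_simps)
  then show ?thesis by (simp add: field_simps exp_of_nat_mult[symmetric])
qed

text \<open>Use \<open>\<eta> = c / k\<close> in the iterated gradient estimate, and \<open>k\<^sup>k \<le> e\<^sup>k k!\<close>.\<close>

lemma analytic_bound: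
  obtains A where "A > 0" "\<And>v c X u M k z. xdir v \<Longrightarrow> 0 < c \<Longrightarrow> c \<le> 1 \<Longrightarrow> open X \<Longrightarrow> sol X u \<Longrightarrow>
    qube c z \<subseteq> X \<Longrightarrow> (\<And>y. y \<in> qube c z \<Longrightarrow> cmod (u y) \<le> M) \<Longrightarrow>
    cmod ((pd v ^^ k) u z) \<le> fact k * (A * norm v / c) ^ k * M"
proof -
  obtain A where A: "A \<ge> 0" "\<And>v \<eta> X u M k z. xdir v \<Longrightarrow> 0 < \<eta> \<Longrightarrow> \<eta> \<le> 1 \<Longrightarrow> open X \<Longrightarrow> sol X u \<Longrightarrow>
    qube (real k * \<eta>) z \<subseteq> X \<Longrightarrow> z \<in> X \<Longrightarrow> (\<And>y. y \<in> qube (real k * \<eta>) z \<Longrightarrow> cmod (u y) \<le> M) \<Longrightarrow>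
    cmod ((pd v ^^ k) u z) \<le> (A * norm v / \<eta>) ^ k * M"
    using iter_pd_bound by blast
  show ?thesis
  proof (rule that)
    \<comment> \<open>Adding 1 makes the constant positive even if \<open>A\<close> is 0; the factor
      e absorbs the growth of k^k beyond k!.\<close>
    show "0 < (A + 1) * exp 1" using A(1) by simp
    fix v c X u M k z
    assume v: "xdir v" and c: "0 < c" "c \<le> 1" and X: "open X" and u: "sol X u"
      and z: "qube c z \<subseteq> X" "\<And>y. y \<in> qube c z \<Longrightarrow> cmod (u y) \<le> M"
    have zX: "z \<in> X" using z c by auto
    have M0: "M \<ge> 0" using z(2)[of z] c order_trans[OF norm_ge_zero] by auto
    show "cmod ((pd v ^^ k) u z) \<le> fact k * ((A + 1) * exp 1 * norm v / c) ^ k * M"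
    proof (cases "k = 0")
      case True
      then show ?thesis using z c by simp
    next
      case False
      have "cmod ((pd v ^^ k) u z) \<le> (A * norm v / (c / real k)) ^ k * M"
      proof (rule A(2)[OF v _ _ X u _ zX])
        show "c / real k \<le> 1" using c False by (simp add: field_simps)
      qed (use z c False in auto)
      also have "(A * norm v / (c / real k)) ^ k = (A * norm v / c) ^ k * real k ^ k"
        by (simp add: power_mult_distrib[symmetric])
      also have "\<dots> \<le> ((A + 1) * norm v / c) ^ k * (exp 1 ^ k * fact k)"
        using A(1) c by (intro mult_mono power_mono power_self_le_exp_fact divide_right_mono mult_right_mono) auto
      also have "\<dots> = fact k * ((A + 1) * exp 1 * norm v / c) ^ k"
        by (simp add: power_mult_distrib[symmetric] mult_ac)
      finally show ?thesis using M0 by (simp add: mult_right_mono)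
    qed
  qed
qed

text \<open>Half of the cube is spent on the outermost derivative and half on the remaining word.
  The estimate serves convergence of derivatives, so how \<open>C\<close> depends on the word and on
  c is immaterial.\<close>

lemma pdw_bound:
  assumes "set w \<subseteq> Basis" "0 < c" "c \<le> 1"
  shows "\<exists>C\<ge>0. \<forall>X u M z. open X \<longrightarrow> sol X u \<longrightarrow> qube c z \<subseteq> X \<longrightarrow> (\<forall>y\<in>qube c z. cmod (u y) \<le> M) \<longrightarrow>
    cmod (pdw w u z) \<le> C * M"
  using assms
proof (induction w arbitrary: c)
  case Nil
  then show ?case by (intro exI[of _ 1]) auto
next
  case (Cons b w)
  obtain C where C: "C \<ge> 0" "\<And>b \<eta> X z w M. b \<in> Basis \<Longrightarrow> 0 < \<eta> \<Longrightarrow> \<eta> \<le> 1 \<Longrightarrow> open X \<Longrightarrow> qube \<eta> z \<subseteq> X \<Longrightarrow>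
    sol X w \<Longrightarrow> (\<And>y. y \<in> qube \<eta> z \<Longrightarrow> cmod (w y) \<le> M) \<Longrightarrow> cmod (pd b w z) \<le> C * M / \<eta> powr wt b"
    using gradient_estimate by blast
  have bw: "b \<in> Basis" "set w \<subseteq> Basis" and c: "0 < c / 2" "c / 2 \<le> 1" using Cons.prems by auto
  obtain C' where C': "C' \<ge> 0" "\<And>X u M z. open X \<Longrightarrow> sol X u \<Longrightarrow> qube (c / 2) z \<subseteq> X \<Longrightarrow> (\<forall>y\<in>qube (c / 2) z. cmod (u y) \<le> M) \<Longrightarrow>
    cmod (pdw w u z) \<le> C' * M" using Cons.IH[OF bw(2) c] by blast
  have "cmod (pdw (b # w) u z) \<le> (C * C' / (c / 2) powr wt b) * M"
    if X: "open X" "sol X u" "qube c z \<subseteq> X" "\<forall>y\<in>qube c z. cmod (u y) \<le> M" for X u M z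
  proof -
    have sub: "qube (c / 2) y \<subseteq> qube c z" if "y \<in> qube (c / 2) z" for y
      using qube_trans[OF that, of "c / 2"] by simp
    have sub': "qube (c / 2) z \<subseteq> qube c z" using c by (intro qube_mono) auto
    have "cmod (pd b (pdw w u) z) \<le> C * (C' * M) / (c / 2) powr wt b"
    proof (rule C(2)[OF bw(1) c X(1) _ sol_pdw[OF X(1,2) bw(2)]])
      show "cmod (pdw w u y) \<le> C' * M" if "y \<in> qube (c / 2) z" for y
        using sub[OF that] X by (intro C'(2)[OF X(1,2)]) blast+
    qed (use sub' X in blast)
    then show ?thesis by (simp add: mult.assoc)
  qed
  then show ?case using C(1) C'(1) by (intro exI[of _ "C * C' / (c / 2) powr wt b"]) auto
qed

text \<open>The differences of the sequence are solutions, so the interior estimate upgrades uniform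
  convergence on compact sets to locally uniform convergence of every derivative, and the equation
  passes to the limit.\<close>

lemma sol_limit:
  assumes X: "open X" and u: "\<And>n. sol X (u n)"
    and cauchy: "\<And>S. compact S \<Longrightarrow> S \<subseteq> X \<Longrightarrow> uniformly_Cauchy_on S u"
  obtains g where "sol X g" "\<And>x. x \<in> X \<Longrightarrow> (\<lambda>n. u n x) \<longlonglongrightarrow> g x"
proof -
  have cau: "\<exists>e>0. uniformly_Cauchy_on (ball x e) (\<lambda>n. pdw w (u n))" if w: "set w \<subseteq> Basis" and x: "x \<in> X" for w x
  proof -
    obtain e where e: "e > 0" "cball x e \<subseteq> X" using X x open_contains_cball by blast
    define c where "c = min 1 (e / (2 * real DIM('a)))"
    have c: "0 < c" "c \<le> 1" "2 * c * real DIM('a) \<le> e" using e by (auto simp: c_def min_def field_simps)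
    have q: "qube (2 * c) x \<subseteq> X"
    proof
      fix y assume y: "y \<in> qube (2 * c) x"
      have "norm (y - x) \<le> (\<Sum>b\<in>Basis. \<bar>(y - x) \<bullet> b\<bar>)" by (rule norm_le_l1)
      also have "\<dots> \<le> (\<Sum>b\<in>(Basis :: 'a set). 2 * c)" using y by (intro sum_mono) (auto simp: qube_def)
      also have "\<dots> \<le> e" using c by (simp add: mult_ac)
      finally show "y \<in> X" using e(2) by (auto simp: dist_norm norm_minus_commute)
    qed
    obtain C where C: "C \<ge> 0" "\<And>X u M z. open X \<Longrightarrow> sol X u \<Longrightarrow> qube c z \<subseteq> X \<Longrightarrow> (\<forall>y\<in>qube c z. cmod (u y) \<le> M) \<Longrightarrow>
      cmod (pdw w u z) \<le> C * M" using pdw_bound[OF w c(1,2)] by blast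
    have "uniformly_Cauchy_on (ball x c) (\<lambda>n. pdw w (u n))"
    proof (rule uniformly_Cauchy_onI)
      fix r :: real assume r: "r > 0"
      have uC: "uniformly_Cauchy_on (qube (2 * c) x) u" by (rule cauchy[OF compact_qube q])
      have r': "r / (C + 1) > 0" using r C(1) by simp
      obtain N where N: "\<And>y n k. y \<in> qube (2 * c) x \<Longrightarrow> n \<ge> N \<Longrightarrow> k \<ge> N \<Longrightarrow> dist (u n y) (u k y) < r / (C + 1)"
        using uC r' unfolding uniformly_Cauchy_on_def by metis
      have "dist (pdw w (u n) y) (pdw w (u k) y) < r" if y: "y \<in> ball x c" and nk: "n \<ge> N" "k \<ge> N" for y n k
      proof -
        have "y \<in> qube c x" unfolding qube_def
        proof (intro CollectI ballI)
          fix b :: 'a assume "b \<in> Basis"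
          then have "\<bar>(y - x) \<bullet> b\<bar> \<le> norm (y - x)" by (rule Basis_le_norm)
          then show "\<bar>(y - x) \<bullet> b\<bar> \<le> c" using y by (simp add: dist_norm norm_minus_commute)
        qed
        then have qy: "qube c y \<subseteq> qube (2 * c) x" using qube_trans[of y c x c] by simp
        have "y \<in> qube c y" using c by simp
        then have yX: "y \<in> X" using qy q by blast
        have "cmod (pdw w (\<lambda>z. u n z - u k z) y) \<le> C * (r / (C + 1))"
        proof (rule C(2)[OF X sol_diff[OF X u u]])
          show "qube c y \<subseteq> X" using qy q by blast
          show "\<forall>z\<in>qube c y. cmod (u n z - u k z) \<le> r / (C + 1)"
          proof
            fix z assume "z \<in> qube c y"
            then show "cmod (u n z - u k z) \<le> r / (C + 1)"
              using N[of z n k] qy nk by (auto simp: dist_norm less_imp_le)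
          qed
        qed
        also have "\<dots> < r" using r C(1) by (simp add: field_simps)
        finally show ?thesis
          using pdw_diff[OF X sol_smooth[OF u] sol_smooth[OF u] w yX] by (simp add: dist_norm)
      qed
      then show "\<exists>M. \<forall>x\<in>ball x c. \<forall>m\<ge>M. \<forall>n\<ge>M. dist (pdw w (u m) x) (pdw w (u n) x) < r" by blast
    qed
    then show ?thesis using c by blast
  qed
  have "\<exists>g. smooth_on X g \<and> (\<forall>w x. set w \<subseteq> Basis \<longrightarrow> x \<in> X \<longrightarrow> (\<lambda>n. pdw w (u n) x) \<longlonglongrightarrow> pdw w g x)"
    by (rule smooth_on_limit[of X u, OF X sol_smooth[OF u] cau]) auto
  then obtain g where g: "smooth_on X g"
    "\<And>w x. set w \<subseteq> Basis \<Longrightarrow> x \<in> X \<Longrightarrow> (\<lambda>n. pdw w (u n) x) \<longlonglongrightarrow> pdw w g x" by blast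
  have "op 1 g z = 0" if z: "z \<in> X" for z
  proof -
    have "(\<lambda>n. op 1 (u n) z) \<longlonglongrightarrow> op 1 g z"
      unfolding op_def by (intro tendsto_intros g(2) wd_Basis z)
    moreover have "op 1 (u n) z = 0" for n using u z by (simp add: sol_def)
    ultimately show ?thesis by (simp add: LIMSEQ_const_iff)
  qed
  then have "sol X g" using g(1) by (simp add: sol_def)
  then show ?thesis using g(2)[of "[]"] by (intro that) auto
qed

end

section \<open>Exponential series and their derivatives\<close>

lemma pdw_cis: "pdw w (\<lambda>z. cis (\<zeta> \<bullet> z)) = (\<lambda>z. isym w \<zeta> * cis (\<zeta> \<bullet> z))"
proof (induction w)
  case (Cons b w)
  have "pd b (\<lambda>z. isym w \<zeta> * cis (\<zeta> \<bullet> z)) z = isym (b # w) \<zeta> * cis (\<zeta> \<bullet> z)" for z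
    using smooth_on_differentiable[OF smooth_on_cis_inner, of z UNIV \<zeta>]
    by (simp add: pd_cmult pd_cis_inner isym_def)
  then show ?case using Cons by auto
qed (simp add: isym_def)

lemma smooth_exponential_series:
  fixes \<zeta> :: "nat \<Rightarrow> 'a::euclidean_space"
  assumes s: "\<And>w. set w \<subseteq> Basis \<Longrightarrow> summable (\<lambda>n. cmod (a n * isym w (\<zeta> n)))"
  shows "smooth_on UNIV (\<lambda>z. suminf (\<lambda>n. a n * cis (\<zeta> n \<bullet> z)))"
    and "set w \<subseteq> Basis \<Longrightarrow> pdw w (\<lambda>z. suminf (\<lambda>n. a n * cis (\<zeta> n \<bullet> z))) z = suminf (\<lambda>n. a n * isym w (\<zeta> n) * cis (\<zeta> n \<bullet> z))"
proof -
  define f where "f N z = (\<Sum>n<N. a n * cis (\<zeta> n \<bullet> z))" for N z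
  have sm: "smooth_on UNIV (f N)" for N
    unfolding f_def by (intro smooth_on_sum smooth_on_mult smooth_on_const smooth_on_cis_inner) auto
  have pf: "pdw w (f N) z = (\<Sum>n<N. a n * isym w (\<zeta> n) * cis (\<zeta> n \<bullet> z))" if w: "set w \<subseteq> Basis" for w N z
  proof -
    have "pdw w (f N) z = (\<Sum>n<N. pdw w (\<lambda>z. a n * cis (\<zeta> n \<bullet> z)) z)"
      unfolding f_def by (rule pdw_sum[of UNIV]) (auto intro!: smooth_on_mult smooth_on_cis_inner w[THEN subsetD])
    also have "\<dots> = (\<Sum>n<N. a n * isym w (\<zeta> n) * cis (\<zeta> n \<bullet> z))"
      by (intro sum.cong refl) (simp add: pdw_cmult[OF open_UNIV smooth_on_cis_inner w] pdw_cis)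
    finally show ?thesis .
  qed
  have ul: "uniform_limit UNIV (\<lambda>N. pdw w (f N)) (\<lambda>z. suminf (\<lambda>n. a n * isym w (\<zeta> n) * cis (\<zeta> n \<bullet> z))) sequentially"
    if w: "set w \<subseteq> Basis" for w
  proof -
    have "uniform_limit UNIV (\<lambda>N z. \<Sum>n<N. a n * isym w (\<zeta> n) * cis (\<zeta> n \<bullet> z)) (\<lambda>z. suminf (\<lambda>n. a n * isym w (\<zeta> n) * cis (\<zeta> n \<bullet> z))) sequentially"
      by (rule Weierstrass_m_test[OF _ s[OF w]]) (simp add: norm_mult)
    moreover have "(\<lambda>N. pdw w (f N)) = (\<lambda>N z. \<Sum>n<N. a n * isym w (\<zeta> n) * cis (\<zeta> n \<bullet> z))"
      using pf[OF w] by (simp add: fun_eq_iff)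
    ultimately show ?thesis by simp
  qed
  obtain g where g: "smooth_on UNIV g"
    "\<And>w x. set w \<subseteq> Basis \<Longrightarrow> x \<in> UNIV \<Longrightarrow> (\<lambda>n. pdw w (f n) x) \<longlonglongrightarrow> pdw w g x"
  proof (rule smooth_on_limit[OF open_UNIV sm])
    fix w :: "'a list" and x :: 'a assume "set w \<subseteq> Basis"
    then have "uniformly_convergent_on UNIV (\<lambda>n. pdw w (f n))"
      unfolding uniformly_convergent_on_def using ul by blast
    then have "uniformly_Cauchy_on UNIV (\<lambda>n. pdw w (f n))" by (rule uniformly_convergent_Cauchy)
    then have "uniformly_Cauchy_on (ball x 1) (\<lambda>n. pdw w (f n))"
      unfolding uniformly_Cauchy_on_def by blast
    then show "\<exists>e>0. uniformly_Cauchy_on (ball x e) (\<lambda>n. pdw w (f n))"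
      by (intro exI[of _ 1]) auto
  qed blast
  have gw: "pdw w g z = suminf (\<lambda>n. a n * isym w (\<zeta> n) * cis (\<zeta> n \<bullet> z))" if w: "set w \<subseteq> Basis" for w z
    using LIMSEQ_unique[OF g(2)[OF w UNIV_I] tendsto_uniform_limitI[OF ul[OF w] UNIV_I]] .
  have "g = (\<lambda>z. suminf (\<lambda>n. a n * cis (\<zeta> n \<bullet> z)))"
    using gw[of "[]"] by (simp add: fun_eq_iff isym_def)
  then show "smooth_on UNIV (\<lambda>z. suminf (\<lambda>n. a n * cis (\<zeta> n \<bullet> z)))"
    and "set w \<subseteq> Basis \<Longrightarrow> pdw w (\<lambda>z. suminf (\<lambda>n. a n * cis (\<zeta> n \<bullet> z))) z = suminf (\<lambda>n. a n * isym w (\<zeta> n) * cis (\<zeta> n \<bullet> z))"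
    using g(1) gw by auto
qed

subsection \<open>Solutions with compactly supported singularities\<close>

context semielliptic
begin

lemma op_1: "op 1 u z = (\<Sum>i\<in>I. cf i * pdw (wd i) u z)"
  by (simp add: op_def)

lemma symb_1: "symb 1 \<zeta> = (\<Sum>i\<in>I. cf i * isym (wd i) \<zeta>)"
  by (simp add: symb_def)

lemma rho_summable:
  fixes kk :: "nat \<Rightarrow> 'a"
  assumes "bij_betw kk UNIV (Lat :: 'a set)" "l > 0"
  shows "summable (\<lambda>n. \<rho> (kk n /\<^sub>R l + \<theta>) powr (- (2 * sum wt Basis)))"
  by (rule summable_comparison_test'[OF summable_mult[OF summable_shifted_Lat[OF assms]], where N = 0])
    (use rho_summable_bound in simp)

text \<open>For each lattice point only finitely many shifts along \<open>e0\<close> hit a zero of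
  the symbol, so all lattice points together exclude only countably many shifts. With an admissible
  shift the elliptic estimate covers all but finitely many frequencies, because a negative power of
  \<rho> is summable over the lattice, and a minimum covers the rest.\<close>

lemma nonresonant_shift:
  fixes kk :: "nat \<Rightarrow> 'a"
  assumes kk: "bij_betw kk UNIV (Lat :: 'a set)" and l: "l > 0"
  obtains \<theta> c where "c > 0" "\<And>n. c * \<rho> (kk n /\<^sub>R l + \<theta>) powr m \<le> cmod (symb 1 (kk n /\<^sub>R l + \<theta>))"
proof -
  have "countable (\<Union>n. {s. symb 1 (kk n /\<^sub>R l + s *\<^sub>R e0) = 0})"
    by (rule countable_UN) (auto simp: symb_1 intro!: countable_finite nonresonant)
  from real_interval_avoid_countable_set[OF zero_less_one this]
  obtain s where s: "\<And>n. symb 1 (kk n /\<^sub>R l + s *\<^sub>R e0) \<noteq> 0" by auto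
  define \<zeta> where "\<zeta> n = kk n /\<^sub>R l + s *\<^sub>R e0" for n
  define \<sigma> where "\<sigma> = 2 * sum wt Basis"
  have "0 \<le> wt b" if "b \<in> Basis" for b using wt_ge_1[OF that] by simp
  then have \<sigma>: "\<sigma> \<ge> 0" unfolding \<sigma>_def by (intro mult_nonneg_nonneg sum_nonneg) auto
  obtain c R where cR: "c > 0" "\<And>\<zeta> d. 0 < d \<Longrightarrow> d \<le> 1 \<Longrightarrow> R \<le> \<rho> \<zeta> \<Longrightarrow> c * \<rho> \<zeta> powr m \<le> cmod (symb d \<zeta>)"
    using elliptic_est[folded symb_def] by blast
  define R' where "R' = max R 1"
  have "(\<lambda>n. \<rho> (\<zeta> n) powr (- \<sigma>)) \<longlonglongrightarrow> 0"
    unfolding \<zeta>_def \<sigma>_def by (rule summable_LIMSEQ_zero[OF rho_summable[OF kk l]])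
  moreover have "0 < R' powr (- \<sigma>)" by (simp add: R'_def)
  ultimately have "\<forall>\<^sub>F n in sequentially. \<rho> (\<zeta> n) powr (- \<sigma>) < R' powr (- \<sigma>)"
    by (rule order_tendstoD(2))
  then obtain N where N: "\<And>n. n \<ge> N \<Longrightarrow> \<rho> (\<zeta> n) powr (- \<sigma>) < R' powr (- \<sigma>)"
    by (auto simp: eventually_sequentially)
  have R: "R \<le> \<rho> (\<zeta> n)" if "n \<ge> N" for n
  proof (rule ccontr)
    assume "\<not> R \<le> \<rho> (\<zeta> n)"
    then have "\<rho> (\<zeta> n) \<le> R'" by (simp add: R'_def)
    then have "R' powr (- \<sigma>) \<le> \<rho> (\<zeta> n) powr (- \<sigma>)" using \<sigma> by (intro powr_mono2') auto
    then show False using N[OF that] by simp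
  qed
  define q where "q n = cmod (symb 1 (\<zeta> n)) / \<rho> (\<zeta> n) powr m" for n
  define c' where "c' = Min (insert c (q ` {..<N}))"
  have q: "q n > 0" for n using s by (simp add: q_def \<zeta>_def)
  show ?thesis
  proof (rule that)
    show "c' > 0" unfolding c'_def using q cR(1) by auto
    fix n
    have "c' \<le> q n"
    proof (cases "n < N")
      case True
      then show ?thesis unfolding c'_def by (intro Min_le) auto
    next
      case False
      have "c' \<le> c" unfolding c'_def by (intro Min_le) auto
      also have "c \<le> q n" using cR(2)[of 1 "\<zeta> n"] R[of n] False by (simp add: q_def field_simps)
      finally show ?thesis .
    qed
    then show "c' * \<rho> (kk n /\<^sub>R l + s *\<^sub>R e0) powr m \<le> cmod (symb 1 (kk n /\<^sub>R l + s *\<^sub>R e0))"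
      by (simp add: q_def \<zeta>_def field_simps)
  qed
qed

text \<open>
  The pieces solve \<open>P u\<^sub>p = \<psi>\<^sub>p P(\<eta> f)\<close> on a large cube; the cutoff \<open>\<eta>\<close> is 1 near \<open>E\<close> and
  the \<open>\<psi>\<^sub>p\<close> are a partition of unity on the support of \<open>P(\<eta> f)\<close>.
\<close>

lemma decomposition:
  assumes W: "open W" and E: "compact E" "E \<subseteq> W" and r: "\<And>p. p \<in> W - E \<Longrightarrow> r p > 0"
  obtains F S0 where "finite F" "F \<subseteq> W - E"
    "\<forall>S>S0. \<exists>C. \<forall>f. sol W f \<longrightarrow> (\<forall>z\<in>W. cmod (f z) \<le> 1) \<longrightarrow>
      (\<exists>u. (\<forall>p\<in>F. sol (box (- S *\<^sub>R One) (S *\<^sub>R One) - cball p (r p)) (u p) \<and> (\<forall>z. cmod (u p z) \<le> C)) \<and>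
        (\<forall>z\<in>E. f z = (\<Sum>p\<in>F. u p z)))"
proof -
  obtain \<eta> N where \<eta>: "test W \<eta>" "open N" "E \<subseteq> N" "\<And>z. z \<in> N \<Longrightarrow> \<eta> z = 1"
    using test_one_near_compact[OF E W] by blast
  obtain T where T: "compact T" "T \<subseteq> W" "\<And>z. z \<notin> T \<Longrightarrow> \<eta> z = 0" using \<eta>(1) unfolding test_def by blast
  have NT: "N \<subseteq> T" using \<eta>(4) T(3) by force
  \<comment> \<open>The right-hand side \<open>op 1 (v f)\<close> lives on this set: on
    \<open>N\<close> it equals \<open>op 1 f\<close>, and off \<open>T\<close> the function
    \<open>v f\<close> is 0 near every point.\<close>
  have Y: "compact (T - N)" using T(1) \<eta>(2) by (rule compact_diff)
  have YW: "T - N \<subseteq> W - E" using T(2) \<eta>(3) by blast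
  obtain F \<psi> N' where F: "finite F" "F \<subseteq> T - N" "\<And>p. smooth_on UNIV (\<psi> p)"
    "\<And>p z. z \<notin> ball p (r p) \<Longrightarrow> p \<in> F \<Longrightarrow> \<psi> p z = 0" "open N'" "T - N \<subseteq> N'" "\<And>z. z \<in> N' \<Longrightarrow> (\<Sum>p\<in>F. \<psi> p z) = 1"
    by (rule partition_of_compact[OF Y, of r]) (use r YW in auto)
  have t\<psi>: "test UNIV (\<psi> p)" if "p \<in> F" for p
  proof -
    have "\<psi> p z = 0" if "z \<notin> cball p (r p)" for z
      using F(4)[of z p] that \<open>p \<in> F\<close> by auto
    then show ?thesis unfolding test_def using F(3) by (intro conjI exI[of _ "cball p (r p)"]) simp_all
  qed
  have "bounded (T \<union> (\<Union>p\<in>F. cball p (r p)))"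
    using T(1) F(1) by (auto simp: compact_imp_bounded bounded_UN)
  then obtain S0 where S0: "\<And>z. z \<in> T \<union> (\<Union>p\<in>F. cball p (r p)) \<Longrightarrow> norm z \<le> S0"
    unfolding bounded_iff by blast
  define F1 where "F1 = {f. sol W f \<and> (\<forall>z\<in>W. cmod (f z) \<le> 1)}"
  define v where "v f z = \<eta> z * f z" for f :: "'a \<Rightarrow> complex" and z
  define F2 where "F2 = v ` F1"
  define g where "g p f z = \<psi> p z * op 1 (v f) z" for p f z
  have tv: "test W (v f)" if "f \<in> F1" for f
    unfolding v_def using that by (intro test_mult W \<eta>(1)) (auto simp: F1_def sol_def)
  have t_op: "test UNIV (op 1 (v f))" if "f \<in> F1" for f
  proof -
    have "test UNIV (\<lambda>z. \<Sum>i\<in>I. cf i * pdw (wd i) (v f) z)"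
      using test_mono[OF tv[OF that]] wd_Basis by (intro test_sum test_cmult test_pdw) auto
    then show ?thesis unfolding op_1[abs_def] .
  qed
  have tg: "test UNIV (g p f)" if "f \<in> F1" "p \<in> F" for f p
    unfolding g_def by (rule test_mult_test[OF t\<psi>[OF that(2)] t_op[OF that(1)]])
  have dec1: "decay W F1 s" for s
    by (rule decay_solutions[OF W]) (auto simp: F1_def sol_def intro!: exI[of _ "1::real"])
  \<comment> \<open>\<open>v f\<close> is not a solution, but it inherits the decay: a cutoff \<phi>
    times \<eta> f is f times the cutoff \<eta> \<phi>, which is supported in
    \<open>W\<close>.\<close>
  have dec2: "decay UNIV F2 s" for s
    unfolding decay_def
  proof (intro allI impI)
    fix \<phi> :: "'a \<Rightarrow> complex" assume \<phi>: "test UNIV \<phi>"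
    have "test W (\<lambda>z. \<eta> z * \<phi> z)" by (rule test_mult_test[OF \<eta>(1) \<phi>])
    then obtain C where C: "C \<ge> 0" "\<And>f \<zeta>. f \<in> F1 \<Longrightarrow> cmod (hat (\<lambda>z. \<eta> z * \<phi> z * f z) \<zeta>) \<le> C * \<rho> \<zeta> powr (- s)"
      using dec1[of s] unfolding decay_def by blast
    have "(\<lambda>z. \<phi> z * v f z) = (\<lambda>z. \<eta> z * \<phi> z * f z)" for f by (auto simp: v_def)
    then show "\<exists>C\<ge>0. \<forall>u\<in>F2. \<forall>\<zeta>. cmod (hat (\<lambda>z. \<phi> z * u z) \<zeta>) \<le> C * \<rho> \<zeta> powr (- s)"
      using C by (auto simp: F2_def)
  qed
  have smF2: "smooth_on UNIV u" if "u \<in> F2" for u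
    using that tv test_smooth unfolding F2_def by blast
  \<comment> \<open>The operator costs m orders of decay, which is harmless because s is
    arbitrary.\<close>
  have hg: "\<exists>C\<ge>0. \<forall>f\<in>F1. \<forall>\<zeta>. cmod (hat (g p f) \<zeta>) \<le> C * \<rho> \<zeta> powr (m - s)" if p: "p \<in> F" for p s
  proof -
    have "\<forall>i\<in>I. \<exists>C\<ge>0. \<forall>u\<in>F2. \<forall>\<zeta>. cmod (hat (\<lambda>z. \<psi> p z * pdw (wd i) u z) \<zeta>) \<le> C * \<rho> \<zeta> powr (wl wt (wd i) - s)"
      using decay_word(2)[OF open_UNIV smF2 dec2 wd_Basis t\<psi>[OF p]] by blast
    from bchoice[OF this] obtain C where "\<forall>i\<in>I. C i \<ge> 0 \<and>
      (\<forall>u\<in>F2. \<forall>\<zeta>. cmod (hat (\<lambda>z. \<psi> p z * pdw (wd i) u z) \<zeta>) \<le> C i * \<rho> \<zeta> powr (wl wt (wd i) - s))" by blast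
    then have C: "\<And>i. i \<in> I \<Longrightarrow> C i \<ge> 0"
      "\<And>i u \<zeta>. i \<in> I \<Longrightarrow> u \<in> F2 \<Longrightarrow> cmod (hat (\<lambda>z. \<psi> p z * pdw (wd i) u z) \<zeta>) \<le> C i * \<rho> \<zeta> powr (wl wt (wd i) - s)"
      by blast+
    have "cmod (hat (g p f) \<zeta>) \<le> (\<Sum>i\<in>I. cmod (cf i) * C i) * \<rho> \<zeta> powr (m - s)" if f: "f \<in> F1" for f \<zeta>
    proof -
      have vf: "v f \<in> F2" using f by (simp add: F2_def)
      have ti: "test UNIV (\<lambda>z. \<psi> p z * pdw (wd i) (v f) z)" if "i \<in> I" for i
        by (rule test_mult[OF open_UNIV t\<psi>[OF p] smooth_on_pdw[OF smF2[OF vf] wd_Basis[OF that]]])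
      have "g p f = (\<lambda>z. \<Sum>i\<in>I. cf i * (\<psi> p z * pdw (wd i) (v f) z))"
        by (simp add: g_def fun_eq_iff op_1 sum_distrib_left mult_ac)
      then have "hat (g p f) \<zeta> = (\<Sum>i\<in>I. cf i * hat (\<lambda>z. \<psi> p z * pdw (wd i) (v f) z) \<zeta>)"
        by (simp add: hat_sum[of I UNIV] test_cmult[OF ti] hat_cmult)
      also have "cmod \<dots> \<le> (\<Sum>i\<in>I. cmod (cf i) * C i * \<rho> \<zeta> powr (m - s))"
      proof (rule sum_norm_le)
        fix i assume i: "i \<in> I"
        have "C i * \<rho> \<zeta> powr (wl wt (wd i) - s) \<le> C i * \<rho> \<zeta> powr (m - s)"
          using C(1)[OF i] wl_le[OF i] by (intro mult_left_mono powr_rho_mono) auto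
        then have "cmod (hat (\<lambda>z. \<psi> p z * pdw (wd i) (v f) z) \<zeta>) \<le> C i * \<rho> \<zeta> powr (m - s)"
          using C(2)[OF i vf, of \<zeta>] by linarith
        then show "cmod (cf i * hat (\<lambda>z. \<psi> p z * pdw (wd i) (v f) z) \<zeta>) \<le> cmod (cf i) * C i * \<rho> \<zeta> powr (m - s)"
          unfolding norm_mult mult.assoc by (intro mult_left_mono) auto
      qed
      finally show ?thesis by (simp add: sum_distrib_right)
    qed
    then show ?thesis using C(1) by (intro exI[of _ "\<Sum>i\<in>I. cmod (cf i) * C i"]) (auto intro!: sum_nonneg)
  qed
  have part: "op 1 (v f) z = (\<Sum>p\<in>F. g p f z)" if f: "f \<in> F1" for f z
  proof -
    have "op 1 (v f) z = 0" if "z \<in> N \<or> z \<notin> T"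
    proof (cases "z \<in> N")
      case True
      have "op 1 (v f) z = op 1 f z"
        by (rule op_cong[OF \<eta>(2) _ True]) (simp add: v_def \<eta>(4))
      then show ?thesis using f True NT T(2) by (auto simp: F1_def sol_def)
    next
      case False
      then have "z \<in> - T" using that by blast
      moreover have "open (- T)" using T(1) compact_imp_closed by auto
      ultimately have "op 1 (v f) z = op 1 (\<lambda>z. 0) z"
        by (intro op_cong[of "- T"]) (auto simp: v_def T(3))
      then show ?thesis by simp
    qed
    moreover have "(\<Sum>p\<in>F. \<psi> p z) = 1" if "\<not> (z \<in> N \<or> z \<notin> T)" using F(6,7) that by blast
    ultimately show ?thesis unfolding g_def sum_distrib_right[symmetric] by auto
  qed
  have hv: "symb 1 \<zeta> * hat (v f) \<zeta> = (\<Sum>p\<in>F. hat (g p f) \<zeta>)" if f: "f \<in> F1" for f \<zeta>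
  proof -
    have "hat (op 1 (v f)) \<zeta> = hat (\<lambda>z. \<Sum>i\<in>I. cf i * pdw (wd i) (v f) z) \<zeta>" by (simp add: op_1[abs_def])
    also have "\<dots> = (\<Sum>i\<in>I. cf i * (isym (wd i) \<zeta> * hat (v f) \<zeta>))"
      using hat_sum[of I W "\<lambda>i z. cf i * pdw (wd i) (v f) z"] tv[OF f] wd_Basis
      by (simp add: test_cmult test_pdw hat_cmult hat_pdw isym_def)
    finally have "symb 1 \<zeta> * hat (v f) \<zeta> = hat (op 1 (v f)) \<zeta>"
      by (simp add: symb_1 sum_distrib_right mult.assoc)
    also have "op 1 (v f) = (\<lambda>z. \<Sum>p\<in>F. g p f z)" using part[OF f] by (simp add: fun_eq_iff)
    also have "hat \<dots> \<zeta> = (\<Sum>p\<in>F. hat (g p f) \<zeta>)"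
      by (rule hat_sum[of F UNIV]) (use tg[OF f] in auto)
    finally show ?thesis .
  qed
  \<comment> \<open>The poles \<open>F\<close> are already fixed here; only the pieces and their
    bound depend on S.\<close>
  have main: "\<exists>C. \<forall>f. sol W f \<longrightarrow> (\<forall>z\<in>W. cmod (f z) \<le> 1) \<longrightarrow>
      (\<exists>u. (\<forall>p\<in>F. sol (box (- S *\<^sub>R One) (S *\<^sub>R One) - cball p (r p)) (u p) \<and> (\<forall>z. cmod (u p z) \<le> C)) \<and>
        (\<forall>z\<in>E. f z = (\<Sum>p\<in>F. u p z)))" if S: "S > \<bar>S0\<bar>" for S
  proof -
    define l where "l = S / pi"
    have l: "l > 0" "pi * l = S" using S by (auto simp: l_def)
    obtain kk :: "nat \<Rightarrow> 'a" where kk: "bij_betw kk UNIV Lat" using Lat_enum by blast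
    obtain \<theta> c where c: "c > 0" "\<And>n. c * \<rho> (kk n /\<^sub>R l + \<theta>) powr m \<le> cmod (symb 1 (kk n /\<^sub>R l + \<theta>))"
      using nonresonant_shift[OF kk l(1)] by blast
    define \<zeta> where "\<zeta> n = kk n /\<^sub>R l + \<theta>" for n
    have c: "c > 0" "\<And>n. c * \<rho> (\<zeta> n) powr m \<le> cmod (symb 1 (\<zeta> n))" using c by (auto simp: \<zeta>_def)
    have nz: "symb 1 (\<zeta> n) \<noteq> 0" for n
    proof -
      have "0 < c * \<rho> (\<zeta> n) powr m" using c(1) by simp
      then show ?thesis using c(2)[of n] by auto
    qed
    define V where "V = (2 * pi * l) ^ DIM('a)"
    have V: "V > 0" using l(1) by (simp add: V_def)
    define \<sigma> where "\<sigma> = 2 * sum wt Basis"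
    have sum\<rho>: "summable (\<lambda>n. \<rho> (\<zeta> n) powr (- \<sigma>))" unfolding \<zeta>_def \<sigma>_def by (rule rho_summable[OF kk l(1)])
    have inq: "\<phi> z = 0" if "\<And>z. z \<notin> T \<union> (\<Union>p\<in>F. cball p (r p)) \<Longrightarrow> \<phi> z = 0" "z \<notin> qube (pi * l) 0" for \<phi> :: "'a \<Rightarrow> complex" and z
    proof (rule that(1), rule notI)
      assume "z \<in> T \<union> (\<Union>p\<in>F. cball p (r p))"
      then have "\<bar>z \<bullet> b\<bar> \<le> S" if "b \<in> Basis" for b
        using S0[of z] Basis_le_norm[OF that, of z] S by linarith
      then show False using that(2) l by (simp add: qube_def)
    qed
    define a where "a f p n = hat (g p f) (\<zeta> n) / (of_real V * symb 1 (\<zeta> n))" for f p n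
    define u where "u f p z = suminf (\<lambda>n. a f p n * cis (\<zeta> n \<bullet> z))" for f p z
    have ab: "\<exists>C\<ge>0. \<forall>f\<in>F1. \<forall>n. cmod (a f p n) \<le> C * \<rho> (\<zeta> n) powr (- s)" if p: "p \<in> F" for p s
    proof -
      obtain C where C: "C \<ge> 0" "\<And>f \<zeta>. f \<in> F1 \<Longrightarrow> cmod (hat (g p f) \<zeta>) \<le> C * \<rho> \<zeta> powr (m - s)" using hg[OF p] by blast
      have "cmod (a f p n) \<le> C / (V * c) * \<rho> (\<zeta> n) powr (- s)" if f: "f \<in> F1" for f n
      proof -
        have "cmod (a f p n) = cmod (hat (g p f) (\<zeta> n)) / (V * cmod (symb 1 (\<zeta> n)))"
          using V by (simp add: a_def norm_divide norm_mult)
        also have "\<dots> \<le> (C * \<rho> (\<zeta> n) powr (m - s)) / (V * (c * \<rho> (\<zeta> n) powr m))"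
          using C f c V by (intro frac_le mult_left_mono mult_pos_pos) auto
        also have "\<rho> (\<zeta> n) powr (m - s) = \<rho> (\<zeta> n) powr m * \<rho> (\<zeta> n) powr (- s)" by (simp add: powr_add[symmetric])
        finally show ?thesis by (simp add: field_simps)
      qed
      then show ?thesis using C(1) V c(1) by (intro exI[of _ "C / (V * c)"]) auto
    qed
    have sumw: "summable (\<lambda>n. cmod (a f p n * isym w (\<zeta> n)))" if f: "f \<in> F1" and p: "p \<in> F" and w: "set w \<subseteq> Basis" for f p w
    proof -
      obtain C where C: "C \<ge> 0" "\<And>n. cmod (a f p n) \<le> C * \<rho> (\<zeta> n) powr (- (\<sigma> + wl wt w))" using ab[OF p] f by blast
      have "cmod (a f p n * isym w (\<zeta> n)) \<le> C * \<rho> (\<zeta> n) powr (- \<sigma>)" for n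
      proof -
        have "cmod (a f p n * isym w (\<zeta> n)) \<le> (C * \<rho> (\<zeta> n) powr (- (\<sigma> + wl wt w))) * \<rho> (\<zeta> n) powr wl wt w"
          unfolding norm_mult by (intro mult_mono C isym_le_rho w) (use C(1) in auto)
        also have "\<dots> = C * \<rho> (\<zeta> n) powr (- \<sigma>)" by (simp add: powr_add[symmetric])
        finally show ?thesis .
      qed
      then show ?thesis by (intro summable_comparison_test'[OF summable_mult[OF sum\<rho>], where N = 0]) auto
    qed
    have smu: "smooth_on UNIV (u f p)" if "f \<in> F1" "p \<in> F" for f p
      unfolding u_def using sumw[OF that] by (rule smooth_exponential_series(1))
    have pdwu: "(\<lambda>n. a f p n * isym w (\<zeta> n) * cis (\<zeta> n \<bullet> z)) sums pdw w (u f p) z"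
      if "f \<in> F1" "p \<in> F" "set w \<subseteq> Basis" for f p w z
    proof -
      have "summable (\<lambda>n. cmod (a f p n * isym w (\<zeta> n) * cis (\<zeta> n \<bullet> z)))"
        using sumw[OF that] by (simp add: norm_mult)
      then have "summable (\<lambda>n. a f p n * isym w (\<zeta> n) * cis (\<zeta> n \<bullet> z))" by (rule summable_norm_cancel)
      moreover have "pdw w (u f p) z = suminf (\<lambda>n. a f p n * isym w (\<zeta> n) * cis (\<zeta> n \<bullet> z))"
        unfolding u_def[abs_def] by (rule smooth_exponential_series(2)) (use sumw that in auto)
      ultimately show ?thesis by (simp add: summable_sums)
    qed
    have opu: "op 1 (u f p) z = g p f z" if f: "f \<in> F1" and p: "p \<in> F" and z: "\<And>b. b \<in> Basis \<Longrightarrow> \<bar>z \<bullet> b\<bar> < pi * l" for f p z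
    proof -
      obtain C where C: "C \<ge> 0" "\<And>n. cmod (hat (g p f) (\<zeta> n)) \<le> C * \<rho> (\<zeta> n) powr (- \<sigma>)"
        using hg[OF p, of "m + \<sigma>"] f by auto
      have sm: "summable (\<lambda>n. cmod (hat (g p f) (kk n /\<^sub>R l + \<theta>)))"
        by (rule summable_comparison_test'[OF summable_mult[OF sum\<rho>, of C], where N = 0]) (use C in \<open>auto simp: \<zeta>_def\<close>)
      have "(\<lambda>n. hat (g p f) (\<zeta> n) * cis (\<zeta> n \<bullet> z)) sums (of_real V * g p f z)"
        unfolding \<zeta>_def V_def
      proof (rule fourier_inversion[OF l(1) kk _ _ sm])
        show "continuous_on UNIV (g p f)" by (rule smooth_on_continuous_on[OF test_smooth[OF tg[OF f p]]])
        show "g p f y = 0" if "y \<notin> qube (pi * l) 0" for y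
          by (rule inq[OF _ that]) (use F(4) p in \<open>auto simp: g_def\<close>)
      qed (use z in auto)
      then have 1: "(\<lambda>n. hat (g p f) (\<zeta> n) * cis (\<zeta> n \<bullet> z) / of_real V) sums (g p f z)"
        using sums_divide[of _ "of_real V * g p f z" "of_real V"] V by fastforce
      have "(\<lambda>n. \<Sum>i\<in>I. cf i * (a f p n * isym (wd i) (\<zeta> n) * cis (\<zeta> n \<bullet> z))) sums (\<Sum>i\<in>I. cf i * pdw (wd i) (u f p) z)"
        by (intro sums_sum sums_mult pdwu f p wd_Basis)
      moreover have "(\<Sum>i\<in>I. cf i * (a f p n * isym (wd i) (\<zeta> n) * cis (\<zeta> n \<bullet> z))) = hat (g p f) (\<zeta> n) * cis (\<zeta> n \<bullet> z) / of_real V" for n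
      proof -
        have "(\<Sum>i\<in>I. cf i * (a f p n * isym (wd i) (\<zeta> n) * cis (\<zeta> n \<bullet> z))) = a f p n * symb 1 (\<zeta> n) * cis (\<zeta> n \<bullet> z)"
          by (simp add: symb_1 sum_distrib_left sum_distrib_right mult_ac)
        then show ?thesis using nz[of n] by (simp add: a_def)
      qed
      ultimately show ?thesis unfolding op_1 using sums_unique2[OF _ 1] by simp
    qed
    \<comment> \<open>By \<open>hv\<close> the coefficients of the pieces add up to those of
      \<open>v f\<close>, and \<open>v f\<close> is \<open>f\<close> on \<open>E\<close>. The
      inversion formula then identifies the sums.\<close>
    have fE: "f z = (\<Sum>p\<in>F. u f p z)" if f: "f \<in> F1" and z: "z \<in> E" for f z
    proof -
      obtain C where C: "C \<ge> 0" "\<And>n. cmod (hat (v f) (\<zeta> n)) \<le> C * \<rho> (\<zeta> n) powr (- \<sigma>)"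
        using dec1[of \<sigma>] \<eta>(1) f unfolding decay_def v_def[abs_def] by blast
      have zS: "\<bar>z \<bullet> b\<bar> < pi * l" if "b \<in> Basis" for b
        using S0[of z] z \<eta>(3) NT Basis_le_norm[OF that, of z] S l by force
      have sm: "summable (\<lambda>n. cmod (hat (v f) (kk n /\<^sub>R l + \<theta>)))"
        by (rule summable_comparison_test'[OF summable_mult[OF sum\<rho>, of C], where N = 0]) (use C in \<open>auto simp: \<zeta>_def\<close>)
      have 1: "(\<lambda>n. hat (v f) (\<zeta> n) * cis (\<zeta> n \<bullet> z)) sums (of_real V * v f z)"
        unfolding \<zeta>_def V_def
      proof (rule fourier_inversion[OF l(1) kk _ _ sm])
        show "continuous_on UNIV (v f)" by (rule smooth_on_continuous_on[OF test_smooth[OF tv[OF f]]])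
        show "v f y = 0" if "y \<notin> qube (pi * l) 0" for y
          by (rule inq[OF _ that]) (use T(3) in \<open>auto simp: v_def\<close>)
      qed (use zS in auto)
      have "(\<lambda>n. a f p n * isym [] (\<zeta> n) * cis (\<zeta> n \<bullet> z)) sums pdw [] (u f p) z" if "p \<in> F" for p
        by (rule pdwu[OF f that]) simp
      then have "(\<lambda>n. of_real V * (\<Sum>p\<in>F. a f p n * cis (\<zeta> n \<bullet> z))) sums (of_real V * (\<Sum>p\<in>F. u f p z))"
        by (intro sums_mult sums_sum) (simp add: isym_def)
      moreover have "of_real V * (\<Sum>p\<in>F. a f p n * cis (\<zeta> n \<bullet> z)) = hat (v f) (\<zeta> n) * cis (\<zeta> n \<bullet> z)" for n
      proof -
        have "of_real V * (\<Sum>p\<in>F. a f p n * cis (\<zeta> n \<bullet> z)) = (\<Sum>p\<in>F. hat (g p f) (\<zeta> n)) / symb 1 (\<zeta> n) * cis (\<zeta> n \<bullet> z)"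
          using V by (simp add: a_def sum_distrib_left sum_distrib_right sum_divide_distrib)
        then show ?thesis using hv[OF f, of "\<zeta> n", symmetric] nz[of n] by simp
      qed
      ultimately have "of_real V * v f z = of_real V * (\<Sum>p\<in>F. u f p z)" using sums_unique2[OF 1] by simp
      then have "v f z = (\<Sum>p\<in>F. u f p z)" using V by simp
      then show ?thesis using z \<eta>(3,4) by (auto simp: v_def)
    qed
    have "\<forall>p\<in>F. \<exists>C\<ge>0. \<forall>f\<in>F1. \<forall>n. cmod (a f p n) \<le> C * \<rho> (\<zeta> n) powr (- \<sigma>)" using ab by blast
    from bchoice[OF this] obtain C where C0: "\<forall>p\<in>F. C p \<ge> 0 \<and> (\<forall>f\<in>F1. \<forall>n. cmod (a f p n) \<le> C p * \<rho> (\<zeta> n) powr (- \<sigma>))" by blast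
    define B where "B = suminf (\<lambda>n. \<rho> (\<zeta> n) powr (- \<sigma>))"
    have B: "B \<ge> 0" unfolding B_def by (intro suminf_nonneg sum\<rho>) simp
    have bu: "cmod (u f p z) \<le> sum C F * B" if f: "f \<in> F1" and p: "p \<in> F" for f p z
    proof -
      have s1: "summable (\<lambda>n. cmod (a f p n * cis (\<zeta> n \<bullet> z)))"
        using sumw[OF f p, of "[]"] by (simp add: isym_def norm_mult)
      have "cmod (u f p z) \<le> suminf (\<lambda>n. cmod (a f p n * cis (\<zeta> n \<bullet> z)))"
        unfolding u_def by (rule summable_norm[OF s1])
      also have "\<dots> \<le> suminf (\<lambda>n. C p * \<rho> (\<zeta> n) powr (- \<sigma>))"
        using C0 f p by (intro suminf_le s1 summable_mult sum\<rho>) (simp add: norm_mult)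
      also have "\<dots> = C p * B" unfolding B_def by (rule suminf_mult[OF sum\<rho>])
      also have "\<dots> \<le> sum C F * B" using C0 p F(1) B by (intro mult_right_mono member_le_sum) auto
      finally show ?thesis .
    qed
    show ?thesis
    proof (intro exI[of _ "sum C F * B"] allI impI)
      fix f assume "sol W f" "\<forall>z\<in>W. cmod (f z) \<le> 1"
      then have f: "f \<in> F1" by (simp add: F1_def)
      have "sol (box (- S *\<^sub>R One) (S *\<^sub>R One) - cball p (r p)) (u f p)" if p: "p \<in> F" for p
        unfolding sol_def
      proof (intro conjI ballI)
        show "smooth_on (box (- S *\<^sub>R One) (S *\<^sub>R One) - cball p (r p)) (u f p)"
          using smooth_on_subset[OF smu[OF f p]] by blast
        fix z assume z: "z \<in> box (- S *\<^sub>R One) (S *\<^sub>R One) - cball p (r p)"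
        have "\<bar>z \<bullet> b\<bar> < pi * l" if "b \<in> Basis" for b
        proof -
          have "- S < z \<bullet> b" "z \<bullet> b < S" using z that by (auto simp: box_def)
          then show ?thesis using l by linarith
        qed
        then have "op 1 (u f p) z = g p f z" by (rule opu[OF f p])
        then show "op 1 (u f p) z = 0" using F(4)[of z p] p z by (simp add: g_def)
      qed
      then show "\<exists>u. (\<forall>p\<in>F. sol (box (- S *\<^sub>R One) (S *\<^sub>R One) - cball p (r p)) (u p) \<and> (\<forall>z. cmod (u p z) \<le> sum C F * B)) \<and>
        (\<forall>z\<in>E. f z = (\<Sum>p\<in>F. u p z))"
        using bu[OF f] fE[OF f] by blast
    qed
  qed
  show ?thesis
    by (rule that[of F "\<bar>S0\<bar>", OF F(1) _ allI[OF impI[OF main]]]) (use F(2) YW in auto)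
qed

end

subsection \<open>Quantitative approximation and pole pushing\<close>

context semielliptic
begin

text \<open>A quantitative Runge property: accuracy on \<open>E\<close> is paid for by a power of 1
  / \<epsilon> on \<open>A'\<close>. \<open>C\<close> and \<open>s\<close> are chosen before
  \<epsilon> and u, and the bound holds on all of \<open>A'\<close>, so that the relation can be
  composed.\<close>

definition approx :: "'a set \<Rightarrow> 'a set \<Rightarrow> 'a set \<Rightarrow> bool" where
  "approx E A A' \<longleftrightarrow> (\<exists>C>0. \<exists>s>0. \<forall>\<epsilon>\<in>{0<..<1}. \<forall>u. sol A u \<longrightarrow> (\<forall>z\<in>A. cmod (u z) \<le> 1) \<longrightarrow>
    (\<exists>u'. sol A' u' \<and> (\<forall>z\<in>E. cmod (u z - u' z) \<le> \<epsilon>) \<and> (\<forall>z\<in>A'. cmod (u' z) \<le> C * \<epsilon> powr (- s))))"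

lemma approx_scaled:
  assumes "approx E A A'" "open A" "open A'"
  obtains C s where "C > 0" "s > 0" "\<And>\<epsilon> u B. 0 < \<epsilon> \<Longrightarrow> \<epsilon> < 1 \<Longrightarrow> sol A u \<Longrightarrow> 0 < B \<Longrightarrow> (\<And>z. z \<in> A \<Longrightarrow> cmod (u z) \<le> B) \<Longrightarrow>
    \<exists>u'. sol A' u' \<and> (\<forall>z\<in>E. cmod (u z - u' z) \<le> \<epsilon> * B) \<and> (\<forall>z\<in>A'. cmod (u' z) \<le> C * \<epsilon> powr (- s) * B)"
proof -
  obtain C s where Cs: "C > 0" "s > 0" and ap: "\<And>\<epsilon> u. \<epsilon> \<in> {0<..<1} \<Longrightarrow> sol A u \<Longrightarrow> (\<forall>z\<in>A. cmod (u z) \<le> 1) \<Longrightarrow>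
    \<exists>u'. sol A' u' \<and> (\<forall>z\<in>E. cmod (u z - u' z) \<le> \<epsilon>) \<and> (\<forall>z\<in>A'. cmod (u' z) \<le> C * \<epsilon> powr (- s))"
    using assms(1) unfolding approx_def by blast
  have "\<exists>u'. sol A' u' \<and> (\<forall>z\<in>E. cmod (u z - u' z) \<le> \<epsilon> * B) \<and> (\<forall>z\<in>A'. cmod (u' z) \<le> C * \<epsilon> powr (- s) * B)"
    if \<epsilon>: "0 < \<epsilon>" "\<epsilon> < 1" and u: "sol A u" and B: "0 < B" and bd: "\<And>z. z \<in> A \<Longrightarrow> cmod (u z) \<le> B" for \<epsilon> u B
  proof -
    let ?v = "\<lambda>z. complex_of_real (1 / B) * u z"
    have "sol A ?v" by (rule sol_cmult[OF assms(2) u])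
    moreover have "\<forall>z\<in>A. cmod (?v z) \<le> 1" using bd B by (simp add: norm_divide)
    ultimately obtain v' where v': "sol A' v'" "\<And>z. z \<in> E \<Longrightarrow> cmod (?v z - v' z) \<le> \<epsilon>" "\<And>z. z \<in> A' \<Longrightarrow> cmod (v' z) \<le> C * \<epsilon> powr (- s)"
      using ap[of \<epsilon> ?v] \<epsilon> by auto
    have "cmod (u z - of_real B * v' z) \<le> \<epsilon> * B" if "z \<in> E" for z
    proof -
      have "u z - of_real B * v' z = of_real B * (?v z - v' z)" using B by (simp add: right_diff_distrib)
      then have "cmod (u z - of_real B * v' z) = B * cmod (?v z - v' z)" using B by (simp only: norm_mult norm_of_real abs_of_pos)
      then show ?thesis using v'(2)[OF that] B by (simp add: mult.commute)
    qed
    moreover have "cmod (of_real B * v' z) \<le> C * \<epsilon> powr (- s) * B" if "z \<in> A'" for z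
      using v'(3)[OF that] B by (simp add: norm_mult mult.commute)
    moreover have "sol A' (\<lambda>z. of_real B * v' z)" by (rule sol_cmult[OF assms(3) v'(1)])
    ultimately show ?thesis by blast
  qed
  then show ?thesis using that[OF Cs] by blast
qed

lemma approx_mono:
  assumes "approx E A A'" "A \<subseteq> B" "A'' \<subseteq> A'" "E' \<subseteq> E"
  shows "approx E' B A''"
proof -
  obtain C s where Cs: "C > 0" "s > 0" and ap: "\<And>\<epsilon> u. \<epsilon> \<in> {0<..<1} \<Longrightarrow> sol A u \<Longrightarrow> (\<forall>z\<in>A. cmod (u z) \<le> 1) \<Longrightarrow>
    \<exists>u'. sol A' u' \<and> (\<forall>z\<in>E. cmod (u z - u' z) \<le> \<epsilon>) \<and> (\<forall>z\<in>A'. cmod (u' z) \<le> C * \<epsilon> powr (- s))"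
    using assms(1) unfolding approx_def by blast
  have "\<exists>u'. sol A'' u' \<and> (\<forall>z\<in>E'. cmod (u z - u' z) \<le> \<epsilon>) \<and> (\<forall>z\<in>A''. cmod (u' z) \<le> C * \<epsilon> powr (- s))"
    if "\<epsilon> \<in> {0<..<1}" "sol B u" "\<forall>z\<in>B. cmod (u z) \<le> 1" for \<epsilon> u
  proof -
    have "sol A u" "\<forall>z\<in>A. cmod (u z) \<le> 1" using that sol_subset[OF that(2) assms(2)] assms(2) by auto
    from ap[OF that(1) this] obtain u' where "sol A' u'" "\<forall>z\<in>E. cmod (u z - u' z) \<le> \<epsilon>" "\<forall>z\<in>A'. cmod (u' z) \<le> C * \<epsilon> powr (- s)"
      by blast
    then show ?thesis using sol_subset[of A' u' A''] assms(3,4) by (intro exI[of _ u']) auto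
  qed
  then show ?thesis unfolding approx_def using Cs by blast
qed

lemma approx_refl: "approx E A A"
  unfolding approx_def
proof (intro exI[of _ "1::real"] conjI ballI allI impI)
  fix \<epsilon> :: real and u assume \<epsilon>: "\<epsilon> \<in> {0<..<1}" and u: "sol A u" "\<forall>z\<in>A. cmod (u z) \<le> 1"
  have "1 \<le> \<epsilon> powr (- 1)" using \<epsilon> by (simp add: powr_minus field_simps)
  then have "\<forall>z\<in>A. cmod (u z) \<le> 1 * \<epsilon> powr (- 1)" using u(2) by force
  then show "\<exists>u'. sol A u' \<and> (\<forall>z\<in>E. cmod (u z - u' z) \<le> \<epsilon>) \<and> (\<forall>z\<in>A. cmod (u' z) \<le> 1 * \<epsilon> powr (- 1))"
    using u(1) \<epsilon> by (intro exI[of _ u]) auto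
qed auto

text \<open>The first approximant is bounded by B, a constant times \<epsilon> powr (- s).
  Approximating it with relative accuracy \<epsilon> / (2 B) costs C' (2 B / \<epsilon>) powr s'
  times B, whence the exponent s + (1 + s) s'.\<close>

lemma approx_trans:
  assumes 1: "approx E A A'" and 2: "approx E A' A''" and op: "open A" "open A'" "open A''"
  shows "approx E A A''"
proof -
  obtain C s where Cs: "C > 0" "s > 0" and ap: "\<And>\<epsilon> u. \<epsilon> \<in> {0<..<1} \<Longrightarrow> sol A u \<Longrightarrow> (\<forall>z\<in>A. cmod (u z) \<le> 1) \<Longrightarrow>
    \<exists>u'. sol A' u' \<and> (\<forall>z\<in>E. cmod (u z - u' z) \<le> \<epsilon>) \<and> (\<forall>z\<in>A'. cmod (u' z) \<le> C * \<epsilon> powr (- s))"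
    using 1 unfolding approx_def by blast
  obtain C' s' where Cs': "C' > 0" "s' > 0" and ap': "\<And>\<epsilon> u B. 0 < \<epsilon> \<Longrightarrow> \<epsilon> < 1 \<Longrightarrow> sol A' u \<Longrightarrow> 0 < B \<Longrightarrow> (\<And>z. z \<in> A' \<Longrightarrow> cmod (u z) \<le> B) \<Longrightarrow>
    \<exists>u'. sol A'' u' \<and> (\<forall>z\<in>E. cmod (u z - u' z) \<le> \<epsilon> * B) \<and> (\<forall>z\<in>A''. cmod (u' z) \<le> C' * \<epsilon> powr (- s') * B)"
    using approx_scaled[OF 2 op(2,3)] by blast
  define D where "D = C + 1"
  define K where "K = D * 2 powr s"
  have D: "D \<ge> 1" "D \<ge> C" using Cs by (auto simp: D_def)
  have K: "K \<ge> 1" using D Cs ge_one_powr_ge_zero[of 2 s] mult_mono[of 1 D 1 "2 powr s"] by (simp add: K_def)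
  define t where "t = s + (1 + s) * s'"
  define C'' where "C'' = C' * 2 powr s' * K powr s' * K"
  have "\<exists>u'. sol A'' u' \<and> (\<forall>z\<in>E. cmod (u z - u' z) \<le> \<epsilon>) \<and> (\<forall>z\<in>A''. cmod (u' z) \<le> C'' * \<epsilon> powr (- t))"
    if \<epsilon>: "\<epsilon> \<in> {0<..<1}" and u: "sol A u" "\<forall>z\<in>A. cmod (u z) \<le> 1" for \<epsilon> u
  proof -
    have e2: "\<epsilon> / 2 \<in> {0<..<1}" using \<epsilon> by auto
    obtain u1 where u1: "sol A' u1" "\<And>z. z \<in> E \<Longrightarrow> cmod (u z - u1 z) \<le> \<epsilon> / 2" "\<And>z. z \<in> A' \<Longrightarrow> cmod (u1 z) \<le> C * (\<epsilon> / 2) powr (- s)"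
      using ap[OF e2 u] by blast
    define B where "B = K * \<epsilon> powr (- s)"
    have "1 \<le> \<epsilon> powr (- s)"
      using \<epsilon> Cs(2) powr_mono'[of "- s" 0 \<epsilon>] by simp
    then have B: "B \<ge> 1" unfolding B_def using K mult_mono[of 1 K 1 "\<epsilon> powr (- s)"] by simp
    have pw: "(\<epsilon> / 2) powr (- s) = 2 powr s * \<epsilon> powr (- s)" using \<epsilon> by (simp add: powr_divide powr_minus field_simps)
    have u1B: "cmod (u1 z) \<le> B" if "z \<in> A'" for z
    proof -
      have "C * (\<epsilon> / 2) powr (- s) \<le> D * (\<epsilon> / 2) powr (- s)" using D by (intro mult_right_mono) auto
      also have "\<dots> = B" by (simp add: B_def K_def pw)
      finally show ?thesis using u1(3)[OF that] by linarith
    qed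
    define \<delta> where "\<delta> = \<epsilon> / (2 * B)"
    have \<delta>: "0 < \<delta>" "\<delta> < 1" using \<epsilon> B by (auto simp: \<delta>_def field_simps)
    obtain u2 where u2: "sol A'' u2" "\<And>z. z \<in> E \<Longrightarrow> cmod (u1 z - u2 z) \<le> \<delta> * B" "\<And>z. z \<in> A'' \<Longrightarrow> cmod (u2 z) \<le> C' * \<delta> powr (- s') * B"
      using ap'[OF \<delta> u1(1), of B] u1B B by auto
    have "cmod (u z - u2 z) \<le> \<epsilon>" if "z \<in> E" for z
    proof -
      have "cmod (u z - u2 z) \<le> cmod (u z - u1 z) + cmod (u1 z - u2 z)"
        using norm_triangle_ineq[of "u z - u1 z" "u1 z - u2 z"] by simp
      also have "\<dots> \<le> \<epsilon> / 2 + \<delta> * B" by (intro add_mono u1 u2 that)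
      finally show ?thesis using B by (simp add: \<delta>_def)
    qed
    moreover have "C' * \<delta> powr (- s') * B = C'' * \<epsilon> powr (- t)"
    proof -
      have "\<delta> powr (- s') = (2 * B / \<epsilon>) powr s'"
        unfolding \<delta>_def using \<epsilon> B by (simp add: powr_minus powr_divide powr_mult)
      also have "2 * B / \<epsilon> = 2 * (K * \<epsilon> powr (- s)) * (1 / \<epsilon>)" by (simp add: B_def)
      also have "\<dots> powr s' = 2 powr s' * (K powr s' * (\<epsilon> powr (- s)) powr s') * (1 / \<epsilon>) powr s'"
      proof -
        have 1: "(2 * (K * \<epsilon> powr (- s)) * (1 / \<epsilon>)) powr s' = (2 * (K * \<epsilon> powr (- s))) powr s' * (1 / \<epsilon>) powr s'"
          using \<epsilon> K by (intro powr_mult)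
        have 2: "(2 * (K * \<epsilon> powr (- s))) powr s' = 2 powr s' * (K * \<epsilon> powr (- s)) powr s'"
          using \<epsilon> K by (intro powr_mult)
        have 3: "(K * \<epsilon> powr (- s)) powr s' = K powr s' * (\<epsilon> powr (- s)) powr s'"
          using \<epsilon> K by (intro powr_mult)
        show ?thesis unfolding 1 2 3 by (rule refl)
      qed
      also have "(1 / \<epsilon>) powr s' = \<epsilon> powr (- s')" using \<epsilon> by (simp add: powr_divide powr_minus_divide)
      finally have "C' * \<delta> powr (- s') * B = C'' * ((\<epsilon> powr (- s)) powr s' * \<epsilon> powr (- s') * \<epsilon> powr (- s))"
        by (simp add: C''_def B_def mult_ac)
      also have "(\<epsilon> powr (- s)) powr s' * \<epsilon> powr (- s') * \<epsilon> powr (- s) = \<epsilon> powr (- t)"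
        unfolding powr_powr powr_add[symmetric] by (simp add: t_def algebra_simps)
      finally show ?thesis .
    qed
    ultimately show ?thesis using u2(1,3) by (intro exI[of _ u2]) auto
  qed
  moreover have "C'' > 0" using Cs' K by (simp add: C''_def)
  moreover have "t > 0" using Cs Cs' by (simp add: t_def add_pos_pos)
  ultimately show ?thesis unfolding approx_def by blast
qed

section \<open>Translation of a pole by a Taylor polynomial\<close>

lemma sol_translate:
  assumes X: "open X" "sol X u" and Y: "open Y" "\<And>y. y \<in> Y \<Longrightarrow> y - v \<in> X"
  shows "sol Y (\<lambda>y. u (y - v))"
  unfolding sol_def
proof (intro conjI ballI)
  have su: "smooth_on X u" using X by (simp add: sol_def)
  have eq: "(- v) + dil (\<lambda>b. 1) y = y - v" for y by simp
  show "smooth_on Y (\<lambda>y. u (y - v))"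
    using smooth_on_affine_dil[OF X(1) Y(1) _ su, of "- v" "\<lambda>b. 1"] Y(2) by simp
  show "op 1 (\<lambda>y. u (y - v)) y = 0" if "y \<in> Y" for y
    using op_dil[OF X(1) su Y(1) _ zero_less_one that, of "- v"] Y(2) that X(2) by (auto simp: sol_def)
qed

text \<open>
  The singularities of the Taylor polynomial \<open>\<Sum>k<p. (\<partial>\<^sub>v\<^sup>k u)(z - v) / k!\<close> are those of \<open>u\<close>,
  translated by \<open>v\<close>.
\<close>

lemma approx_translate_pole:
  obtains \<kappa> where "\<kappa> > 0" "\<And>A A' E v c d. open A \<Longrightarrow> open A' \<Longrightarrow> xdir v \<Longrightarrow> 0 < c \<Longrightarrow> c \<le> 1 \<Longrightarrow> 0 < d \<Longrightarrow> d \<le> 1 \<Longrightarrow>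
    norm v \<le> \<kappa> * d \<Longrightarrow> \<forall>z\<in>A'. qube c (z - v) \<subseteq> A \<Longrightarrow>
    \<forall>z\<in>E. \<forall>s\<in>{0..1}. qube d (z - s *\<^sub>R v) \<subseteq> A \<Longrightarrow> approx E A A'"
proof -
  obtain K where K: "K > 0" "\<And>v c X u M k z. xdir v \<Longrightarrow> 0 < c \<Longrightarrow> c \<le> 1 \<Longrightarrow> open X \<Longrightarrow> sol X u \<Longrightarrow>
    qube c z \<subseteq> X \<Longrightarrow> (\<And>y. y \<in> qube c z \<Longrightarrow> cmod (u y) \<le> M) \<Longrightarrow>
    cmod ((pd v ^^ k) u z) \<le> fact k * (K * norm v / c) ^ k * M"
    using analytic_bound by blast
  \<comment> \<open>The factor 4 bounds the p-th derivative near \<open>E\<close> by p! / 4^p, hence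
    the Taylor remainder by p / 4^p, which is at most 1 / 2^p. Only the margin d around
    \<open>E\<close> limits the length of v; the margin c on \<open>A'\<close> affects merely the
    growth rate \<open>R\<close>.\<close>
  have main: "approx E A A'" if A: "open A" "open A'" and v: "xdir v" and c: "0 < c" "c \<le> 1" and d: "0 < d" "d \<le> 1"
    and vd: "norm v \<le> 1 / (4 * K) * d" and A'0: "\<forall>z\<in>A'. qube c (z - v) \<subseteq> A"
    and E0: "\<forall>z\<in>E. \<forall>s\<in>{0..1}. qube d (z - s *\<^sub>R v) \<subseteq> A" for A A' E v c d
  proof -
    have A': "qube c (z - v) \<subseteq> A" if "z \<in> A'" for z using A'0 that by blast
    have E: "qube d (z - s *\<^sub>R v) \<subseteq> A" if "z \<in> E" "0 \<le> s" "s \<le> 1" for z s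
      using E0 that by simp
    \<comment> \<open>Being at least 2, \<open>R\<close> dominates the geometric sum of its powers
      below p by R^p. With p the ceiling of log 2 (1 / \<epsilon>) this is at most R times
      \<epsilon> powr (- s) for s = log 2 R.\<close>
    define R where "R = max 2 (K * norm v / c)"
    have R: "R \<ge> 2" "K * norm v / c \<le> R" by (auto simp: R_def)
    define s where "s = log 2 R"
    have s: "s > 0" using R by (simp add: s_def)
    have A'A: "z - v \<in> A" if "z \<in> A'" for z using A'[OF that] c by auto
    have "\<exists>u'. sol A' u' \<and> (\<forall>z\<in>E. cmod (u z - u' z) \<le> \<epsilon>) \<and> (\<forall>z\<in>A'. cmod (u' z) \<le> R * \<epsilon> powr (- s))"
      if \<epsilon>: "\<epsilon> \<in> {0<..<1}" and u: "sol A u" "\<forall>z\<in>A. cmod (u z) \<le> 1" for \<epsilon> u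
    proof -
      define p where "p = nat \<lceil>log 2 (1 / \<epsilon>)\<rceil>"
      have lg: "log 2 (1 / \<epsilon>) > 0" using \<epsilon> by simp
      then have p0: "p > 0" by (simp add: p_def)
      have p1: "log 2 (1 / \<epsilon>) \<le> real p" "real p \<le> log 2 (1 / \<epsilon>) + 1" using lg by (simp_all add: p_def)
      have pe: "(1 / 2) ^ p \<le> \<epsilon>"
      proof -
        have "1 / \<epsilon> = 2 powr log 2 (1 / \<epsilon>)" using \<epsilon> by simp
        also have "\<dots> \<le> 2 powr real p" using p1 by (intro powr_mono) auto
        also have "\<dots> = 2 ^ p" by (simp add: powr_realpow)
        finally show ?thesis using \<epsilon> by (simp add: field_simps power_divide)
      qed
      have Rp: "R ^ p \<le> R * \<epsilon> powr (- s)"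
      proof -
        have "R ^ p = R powr real p" using R by (simp add: powr_realpow)
        also have "\<dots> \<le> R powr (log 2 (1 / \<epsilon>) + 1)" using R p1 by (intro powr_mono) auto
        also have "\<dots> = R * R powr log 2 (1 / \<epsilon>)" using R by (simp add: powr_add)
        also have "R powr log 2 (1 / \<epsilon>) = (2 powr s) powr log 2 (1 / \<epsilon>)" using R by (simp add: s_def)
        also have "\<dots> = (2 powr log 2 (1 / \<epsilon>)) powr s" by (simp add: powr_powr mult.commute)
        also have "\<dots> = (1 / \<epsilon>) powr s" using \<epsilon> by simp
        also have "\<dots> = \<epsilon> powr (- s)" using \<epsilon> by (simp add: powr_divide powr_minus_divide)
        finally show ?thesis .
      qed
      define u' where "u' z = (\<Sum>k<p. of_real (1 / fact k) * (pd v ^^ k) u (z - v))" for z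
      have "sol A' u'"
        unfolding u'_def
        by (rule sol_sum[OF A(2)], rule sol_cmult[OF A(2)], rule sol_translate[OF A(1) _ A(2) A'A], rule sol_iter_pd[OF A(1) u(1)])
      moreover have "cmod (u' z) \<le> R * \<epsilon> powr (- s)" if z: "z \<in> A'" for z
      proof -
        have "cmod (u' z) \<le> (\<Sum>k<p. R ^ k)"
          unfolding u'_def
        proof (rule sum_norm_le)
          fix k
          have "cmod ((pd v ^^ k) u (z - v)) \<le> fact k * (K * norm v / c) ^ k * 1"
            using A'[OF z] u by (intro K(2)[OF v c A(1) u(1)]) auto
          also have "(K * norm v / c) ^ k \<le> R ^ k" using K(1) c R by (intro power_mono) auto
          finally show "cmod (of_real (1 / fact k) * (pd v ^^ k) u (z - v)) \<le> R ^ k"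
            by (simp add: norm_mult norm_divide field_simps)
        qed
        also have "\<dots> \<le> R ^ p"
        proof (induction p)
          case (Suc p)
          have "R ^ p + R ^ p \<le> R * R ^ p" using R mult_right_mono[of 2 R "R ^ p"] by simp
          then show ?case using Suc by simp
        qed simp
        finally show ?thesis using Rp by linarith
      qed
      moreover have "cmod (u z - u' z) \<le> \<epsilon>" if z: "z \<in> E" for z
      proof -
        \<comment> \<open>Taylor's formula runs along the segment from z - v to z;
          \<open>u' z\<close> is the polynomial centred at z - v.\<close>
        define \<gamma> where "\<gamma> t = (z - v) + t *\<^sub>R v" for t :: real
        have \<gamma>: "qube d (\<gamma> t) \<subseteq> A" "\<gamma> t \<in> A" if "t \<in> {0..1}" for t
        proof -
          have "\<gamma> t = z - (1 - t) *\<^sub>R v" by (simp add: \<gamma>_def algebra_simps)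
          then show "qube d (\<gamma> t) \<subseteq> A" using E[OF z, of "1 - t"] that by simp
          then show "\<gamma> t \<in> A" using d by auto
        qed
        define Df where "Df k t = (pd v ^^ k) u (\<gamma> t)" for k t
        have Dfd: "(Df k has_vector_derivative Df (Suc k) t) (at t within {0..1})" if "0 \<le> t" "t \<le> 1" for k t
        proof -
          have g: "(\<gamma> has_derivative (\<lambda>h. h *\<^sub>R v)) (at t within {0..1})"
            unfolding \<gamma>_def by (auto intro!: derivative_eq_intros)
          have dif: "(pd v ^^ k) u differentiable (at (\<gamma> t))"
            using that by (intro smooth_on_differentiable[OF sol_smooth[OF sol_iter_pd[OF A(1) u(1)]]] \<gamma>(2)) auto
          from has_derivative_compose[OF g has_derivative_pd[OF dif]]
          show ?thesis unfolding has_vector_derivative_def Df_def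
            using linear_scale[OF linear_pd[OF dif]] by simp
        qed
        have Dfb: "cmod (Df p t) \<le> fact p * (1 / 4) ^ p" if "t \<in> {0..1}" for t
        proof -
          have "cmod (Df p t) \<le> fact p * (K * norm v / d) ^ p * 1"
            unfolding Df_def using \<gamma>(1)[OF that] u by (intro K(2)[OF v d A(1) u(1)]) auto
          also have "(K * norm v / d) ^ p \<le> (1 / 4) ^ p"
            using K(1) d vd by (intro power_mono) (auto simp: field_simps)
          finally show ?thesis by simp
        qed
        have ti: "((\<lambda>x. ((1 - x) ^ (p - 1) / fact (p - 1)) *\<^sub>R Df p x) has_integral
            Df 0 1 - (\<Sum>i<p. ((1 - 0) ^ i / fact i) *\<^sub>R Df i 0)) {0..1}"
          by (rule Taylor_has_integral[OF p0 refl]) (use Dfd in auto)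
        have "cmod (Df 0 1 - (\<Sum>i<p. ((1 - 0) ^ i / fact i) *\<^sub>R Df i 0)) \<le> (real p * (1 / 4) ^ p) * measure lborel {0..1::real}"
        proof (rule has_integral_bound_real[OF _ finite.emptyI ti])
          fix x :: real assume "x \<in> {0..1} - {}"
          then have x: "x \<in> {0..1}" by simp
          have "norm (((1 - x) ^ (p - 1) / fact (p - 1)) *\<^sub>R Df p x) \<le> (1 / fact (p - 1)) * (fact p * (1 / 4) ^ p)"
            unfolding norm_scaleR using x Dfb[OF x]
            by (intro mult_mono) (auto simp: power_abs divide_right_mono power_le_one)
          also have "\<dots> = real p * (1 / 4) ^ p" using p0 by (simp add: fact_reduce[of p])
          finally show "norm (((1 - x) ^ (p - 1) / fact (p - 1)) *\<^sub>R Df p x) \<le> real p * (1 / 4) ^ p" .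
        qed simp
        also have "\<dots> \<le> 2 ^ p * (1 / 4) ^ p"
          using of_nat_less_two_power[of p, where 'a = real] by (auto intro!: mult_right_mono)
        also have "\<dots> = (1 / 2) ^ p" by (simp add: power_mult_distrib[symmetric])
        also have "Df 0 1 = u z" by (simp add: Df_def \<gamma>_def)
        also have "(\<Sum>i<p. ((1 - 0) ^ i / fact i) *\<^sub>R Df i 0) = u' z"
          by (simp add: u'_def Df_def \<gamma>_def scaleR_conv_of_real)
        finally show ?thesis using pe by linarith
      qed
      ultimately show ?thesis by blast
    qed
    then show ?thesis unfolding approx_def using R s by (intro exI[of _ R] conjI exI[of _ s]) auto
  qed
  have "1 / (4 * K) > 0" using K(1) by simp
  then show ?thesis by (rule that) (rule main)
qed

section \<open>Moving poles along paths\<close>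

abbreviation cube :: "real \<Rightarrow> 'a set" where
  "cube S \<equiv> box (- S *\<^sub>R One) (S *\<^sub>R One)"

lemma mem_cube: "z \<in> cube S \<longleftrightarrow> (\<forall>b\<in>Basis. \<bar>z \<bullet> b\<bar> < S)"
  by (auto simp: box_def abs_less_iff)

lemma norm_le_qube: "y \<in> qube c z \<Longrightarrow> norm (y - z) \<le> real DIM('a) * c"
  for y z :: 'a
  using norm_le_l1[of "y - z"] sum_mono[of Basis "\<lambda>b. \<bar>(y - z) \<bullet> b\<bar>" "\<lambda>_. c"] by (auto simp: qube_def)

text \<open>Uniform continuity cuts the path into N steps short enough for
  \<open>approx_translate_pole\<close>. The singular ball follows the path and grows a little at
  each step, and the outer cube shrinks; hence a cube larger by 2 N at the start and a ball of twice
  the radius at the end.\<close>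

lemma approx_move_pole:
  fixes g :: "real \<Rightarrow> 'a"
  assumes g: "continuous_on {0..1} g" and gx: "\<And>s. s \<in> {0..1} \<Longrightarrow> xdir (g s - g 0)"
    and r: "r > 0" and far: "\<And>z s. z \<in> E \<Longrightarrow> s \<in> {0..1} \<Longrightarrow> 4 * r \<le> norm (z - g s)"
    and ES: "\<And>z b. z \<in> E \<Longrightarrow> b \<in> Basis \<Longrightarrow> \<bar>z \<bullet> b\<bar> + 3 \<le> S"
  obtains N :: nat where "approx E (cube (S + 2 * real N) - cball (g 0) r) (cube S - cball (g 1) (2 * r))"
proof -
  define D where "D = real DIM('a)"
  have D: "D \<ge> 1" unfolding D_def using DIM_positive[where 'a='a] by linarith
  obtain \<kappa> where \<kappa>: "\<kappa> > 0" "\<And>A A' E v c d. open A \<Longrightarrow> open A' \<Longrightarrow> xdir v \<Longrightarrow> 0 < c \<Longrightarrow> c \<le> 1 \<Longrightarrow> 0 < d \<Longrightarrow> d \<le> 1 \<Longrightarrow>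
    norm v \<le> \<kappa> * d \<Longrightarrow> \<forall>z\<in>A'. qube c (z - v) \<subseteq> A \<Longrightarrow>
    \<forall>z\<in>E. \<forall>s\<in>{0..1}. qube d (z - s *\<^sub>R v) \<subseteq> A \<Longrightarrow> approx E A A'"
    using approx_translate_pole by blast
  \<comment> \<open>Margins on \<open>E\<close>: the path keeps distance 4 r, the balls have radius
    at most 2 r, and the cube of half side d and the shift take at most r / 2 each.\<close>
  define d where "d = min 1 (r / (2 * D))"
  have d: "0 < d" "d \<le> 1" "D * d \<le> r / 2" using r D by (auto simp: d_def min_def field_simps)
  define \<mu> where "\<mu> = min 1 (min (r / 2) (\<kappa> * d))"
  have \<mu>: "\<mu> > 0" "\<mu> \<le> 1" "\<mu> \<le> r / 2" "\<mu> \<le> \<kappa> * d" using r \<kappa>(1) d by (auto simp: \<mu>_def)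
  have "uniformly_continuous_on {0..1} g" by (rule compact_uniformly_continuous[OF g]) simp
  then obtain \<delta> where \<delta>: "\<delta> > 0" "\<And>s t. s \<in> {0..1} \<Longrightarrow> t \<in> {0..1} \<Longrightarrow> dist t s < \<delta> \<Longrightarrow> dist (g t) (g s) < \<mu>"
    using \<mu>(1) unfolding uniformly_continuous_on_def by metis
  obtain N0 where "1 / \<delta> < real N0" using reals_Archimedean2 by blast
  define N where "N = Suc N0"
  have N: "N > 0" "1 / real N < \<delta>"
    using \<open>1 / \<delta> < real N0\<close> \<delta>(1) by (auto simp: N_def field_simps)
  define t where "t i = real i / real N" for i
  have t: "t i \<in> {0..1}" if "i \<le> N" for i using that N by (simp add: t_def)
  \<comment> \<open>A cube of half side c lies in a ball of radius D c; this choice keeps the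
    enlargement over all N steps at most r.\<close>
  define c where "c = min 1 (r / (real N * D))"
  have c: "0 < c" "c \<le> 1" "real N * (D * c) \<le> r"
  proof -
    show "0 < c" "c \<le> 1" using r D N by (auto simp: c_def)
    have "c \<le> r / (real N * D)" by (simp add: c_def)
    then show "real N * (D * c) \<le> r" using N D by (simp add: field_simps)
  qed
  \<comment> \<open>The outer cube loses 2 per step, 1 for the translation and 1 for the margin c.
    The excluded ball grows by D c, the reach of the margin cube.\<close>
  define A where "A i = cube (S + 2 * (real N - real i)) - cball (g (t i)) (r + real i * (D * c))" for i
  have opA: "open (A i)" for i unfolding A_def by (intro open_Diff open_box closed_cball)
  have ri: "r + real i * (D * c) \<le> 2 * r" if "i \<le> N" for i
  proof -
    have "real i * (D * c) \<le> real N * (D * c)" using that D c by (intro mult_right_mono) auto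
    then show ?thesis using c(3) by linarith
  qed
  have "approx E (A 0) (A i)" if "i \<le> N" for i
    using that
  proof (induction i)
    case 0
    show ?case by (rule approx_refl)
  next
    case (Suc i)
    define v where "v = g (t (Suc i)) - g (t i)"
    have ti: "t i \<in> {0..1}" "t (Suc i) \<in> {0..1}" using Suc.prems by (intro t; simp)+
    have "dist (t (Suc i)) (t i) < \<delta>"
      using N by (simp add: t_def dist_real_def diff_divide_distrib[symmetric])
    then have nv: "norm v < \<mu>" using \<delta>(2)[OF ti] by (simp add: v_def dist_norm)
    have "approx E (A i) (A (Suc i))"
    proof (rule \<kappa>(2)[OF opA opA _ c(1,2) d(1,2)])
      have "v = (g (t (Suc i)) - g 0) - (g (t i) - g 0)" by (simp add: v_def)
      then show "xdir v" using gx[OF ti(1)] gx[OF ti(2)] unfolding xdir_def by (simp add: inner_diff_left)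
      show "norm v \<le> \<kappa> * d" using nv \<mu> by linarith
      show "\<forall>z\<in>A (Suc i). qube c (z - v) \<subseteq> A i"
      proof (intro ballI subsetI)
        fix z y assume z: "z \<in> A (Suc i)" and y: "y \<in> qube c (z - v)"
        have "y \<in> cube (S + 2 * (real N - real i))" unfolding mem_cube
        proof
          fix b :: 'a assume b: "b \<in> Basis"
          have "\<bar>z \<bullet> b\<bar> < S + 2 * (real N - real (Suc i))" using z b unfolding A_def mem_cube Diff_iff by blast
          moreover have "\<bar>(y - (z - v)) \<bullet> b\<bar> \<le> c" using y b by (auto simp: qube_def)
          moreover have "\<bar>v \<bullet> b\<bar> \<le> 1" using Basis_le_norm[OF b, of v] nv \<mu> by linarith
          ultimately show "\<bar>y \<bullet> b\<bar> < S + 2 * (real N - real i)" using c(2) by (simp add: inner_diff_left)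
        qed
        moreover have "y \<notin> cball (g (t i)) (r + real i * (D * c))"
        proof -
          have "norm (z - g (t (Suc i))) > r + real (Suc i) * (D * c)"
            using z by (auto simp: A_def dist_norm norm_minus_commute)
          moreover have "norm (y - (z - v)) \<le> D * c" using norm_le_qube[OF y] by (simp add: D_def)
          moreover have "z - g (t (Suc i)) = (y - g (t i)) - (y - (z - v))" by (simp add: v_def)
          then have "norm (z - g (t (Suc i))) \<le> norm (y - g (t i)) + norm (y - (z - v))" by (metis norm_triangle_ineq4)
          ultimately have "norm (y - g (t i)) > r + real i * (D * c)" by (simp add: algebra_simps)
          then show ?thesis by (simp add: dist_norm norm_minus_commute)
        qed
        ultimately show "y \<in> A i" by (simp add: A_def)
      qed
      show "\<forall>z\<in>E. \<forall>s\<in>{0..1}. qube d (z - s *\<^sub>R v) \<subseteq> A i"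
      proof (intro ballI subsetI)
        fix z y and s :: real assume z: "z \<in> E" and s': "s \<in> {0..1}" and y: "y \<in> qube d (z - s *\<^sub>R v)"
        have s: "0 \<le> s" "s \<le> 1" using s' by auto
        have nsv: "norm (s *\<^sub>R v) \<le> norm v" using s by (simp add: mult_left_le_one_le)
        have "y \<in> cube (S + 2 * (real N - real i))" unfolding mem_cube
        proof
          fix b :: 'a assume b: "b \<in> Basis"
          have "\<bar>z \<bullet> b\<bar> + 3 \<le> S" by (rule ES[OF z b])
          moreover have "\<bar>(y - (z - s *\<^sub>R v)) \<bullet> b\<bar> \<le> d" using y b by (auto simp: qube_def)
          moreover have "\<bar>(s *\<^sub>R v) \<bullet> b\<bar> \<le> 1" using Basis_le_norm[OF b, of "s *\<^sub>R v"] nsv nv \<mu> by linarith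
          moreover have "real i \<le> real N" using Suc.prems by simp
          ultimately show "\<bar>y \<bullet> b\<bar> < S + 2 * (real N - real i)" using d(2) by (simp add: inner_diff_left)
        qed
        moreover have "y \<notin> cball (g (t i)) (r + real i * (D * c))"
        proof -
          have "4 * r \<le> norm (z - g (t i))" by (rule far[OF z ti(1)])
          moreover have "norm (y - (z - s *\<^sub>R v)) \<le> r / 2" using norm_le_qube[OF y] d(3) by (simp add: D_def)
          moreover have "norm (z - g (t i)) \<le> norm (y - g (t i)) + norm (y - (z - s *\<^sub>R v)) + norm (s *\<^sub>R v)"
          proof -
            have "norm (z - g (t i)) = norm (((y - g (t i)) - (y - (z - s *\<^sub>R v))) + s *\<^sub>R v)" by simp
            then show ?thesis using norm_triangle_ineq[of "(y - g (t i)) - (y - (z - s *\<^sub>R v))" "s *\<^sub>R v"]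
                norm_triangle_ineq4[of "y - g (t i)" "y - (z - s *\<^sub>R v)"] by linarith
          qed
          moreover have "r + real i * (D * c) \<le> 2 * r" using Suc.prems by (intro ri) simp
          ultimately have "norm (y - g (t i)) > r + real i * (D * c)" using nsv nv \<mu>(3) r by linarith
          then show ?thesis by (simp add: dist_norm norm_minus_commute)
        qed
        ultimately show "y \<in> A i" by (simp add: A_def)
      qed
    qed
    then show ?case using approx_trans[OF Suc.IH _ opA opA opA] Suc.prems by simp
  qed
  then have "approx E (A 0) (A N)" by simp
  then have "approx E (cube (S + 2 * real N) - cball (g 0) r) (cube S - cball (g 1) (2 * r))"
  proof (rule approx_mono)
    show "A 0 \<subseteq> cube (S + 2 * real N) - cball (g 0) r" by (simp add: A_def t_def)
    have "cball (g (t N)) (r + real N * (D * c)) \<subseteq> cball (g 1) (2 * r)"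
      using ri[of N] N by (auto simp: t_def)
    then show "cube S - cball (g 1) (2 * r) \<subseteq> A N" by (auto simp: A_def)
  qed simp
  then show ?thesis by (rule that)
qed

text \<open>Every point of \<open>W - E\<close> gets a radius small compared with its own escape
  path. So wherever the finite decomposition puts its poles, each singular ball can be carried past
  \<open>E\<close> and out of \<open>A'\<close>; adding the moved pieces gives the
  approximant.\<close>

lemma runge_theorem:
  assumes W: "open W" and E: "compact E" "E \<subseteq> W" and A': "open A'" "bounded A'"
    and esc: "\<And>p. p \<in> W - E \<Longrightarrow> \<exists>g. path g \<and> pathstart g = p \<and> pathfinish g \<notin> closure A' \<and>
      path_image g \<inter> E = {} \<and> (\<forall>s\<in>{0..1}. xdir (g s - p))"
  shows "approx E W A'"
proof -
  have "\<exists>r>0. \<exists>g :: real \<Rightarrow> 'a. continuous_on {0..1} g \<and> g 0 = p \<and> (\<forall>s\<in>{0..1}. xdir (g s - g 0)) \<and>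
    (\<forall>z\<in>E. \<forall>s\<in>{0..1}. 4 * r \<le> norm (z - g s)) \<and> A' \<inter> cball (g 1) (2 * r) = {}" if p: "p \<in> W - E" for p
  proof -
    obtain g where g: "path g" "g 0 = p" "g 1 \<notin> closure A'" "path_image g \<inter> E = {}" "\<forall>s\<in>{0..1}. xdir (g s - p)"
      using esc[OF p] unfolding pathstart_def pathfinish_def by blast
    obtain \<delta> where \<delta>: "\<delta> > 0" "\<And>x y. x \<in> path_image g \<Longrightarrow> y \<in> E \<Longrightarrow> \<delta> \<le> dist x y"
      using separate_compact_closed[OF compact_path_image[OF g(1)] compact_imp_closed[OF E(1)] g(4)] by blast
    have "open (- closure A')" by auto
    then obtain e where e: "e > 0" "cball (g 1) e \<subseteq> - closure A'" using g(3) open_contains_cball by blast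
    \<comment> \<open>\<open>approx_move_pole\<close> asks for distance 4 r between path and
      \<open>E\<close>, and the ball of radius 2 r that it leaves at the end of the path must miss
      \<open>A'\<close>.\<close>
    define r where "r = min (\<delta> / 4) (e / 2)"
    have r: "r > 0" "4 * r \<le> \<delta>" "2 * r \<le> e" using \<delta> e by (auto simp: r_def)
    show ?thesis
    proof (intro exI[of _ r] conjI exI[of _ g])
      show "continuous_on {0..1} g" using g(1) by (simp add: path_def)
      show "\<forall>z\<in>E. \<forall>s\<in>{0..1}. 4 * r \<le> norm (z - g s)"
      proof (intro ballI)
        fix z and s :: real assume "z \<in> E" "s \<in> {0..1}"
        then show "4 * r \<le> norm (z - g s)"
          using \<delta>(2)[of "g s" z] r by (auto simp: path_image_def dist_norm norm_minus_commute)
      qed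
      have "cball (g 1) (2 * r) \<subseteq> cball (g 1) e" using r by auto
      then show "A' \<inter> cball (g 1) (2 * r) = {}" using e closure_subset[of A'] by blast
    qed (use g r in auto)
  qed
  then have "\<exists>R. \<forall>p\<in>W - E. R p > 0 \<and> (\<exists>g :: real \<Rightarrow> 'a. continuous_on {0..1} g \<and> g 0 = p \<and> (\<forall>s\<in>{0..1}. xdir (g s - g 0)) \<and>
    (\<forall>z\<in>E. \<forall>s\<in>{0..1}. 4 * R p \<le> norm (z - g s)) \<and> A' \<inter> cball (g 1) (2 * R p) = {})"
    by (intro bchoice) blast
  then obtain r where r: "\<And>p. p \<in> W - E \<Longrightarrow> r p > 0"
    "\<And>p. p \<in> W - E \<Longrightarrow> \<exists>g :: real \<Rightarrow> 'a. continuous_on {0..1} g \<and> g 0 = p \<and> (\<forall>s\<in>{0..1}. xdir (g s - g 0)) \<and>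
    (\<forall>z\<in>E. \<forall>s\<in>{0..1}. 4 * r p \<le> norm (z - g s)) \<and> A' \<inter> cball (g 1) (2 * r p) = {}"
    by blast
  obtain F S0 where F: "finite F" "F \<subseteq> W - E"
    "\<forall>S>S0. \<exists>C. \<forall>f. sol W f \<longrightarrow> (\<forall>z\<in>W. cmod (f z) \<le> 1) \<longrightarrow>
      (\<exists>u. (\<forall>p\<in>F. sol (cube S - cball p (r p)) (u p) \<and> (\<forall>z. cmod (u p z) \<le> C)) \<and>
        (\<forall>z\<in>E. f z = (\<Sum>p\<in>F. u p z)))"
    by (rule decomposition[OF W E, of r]) (rule r(1), assumption, rule that)
  have "bounded (E \<union> A')" using E A' by (auto intro: compact_imp_bounded)
  then obtain S1 where S1: "\<And>z. z \<in> E \<union> A' \<Longrightarrow> norm z \<le> S1" unfolding bounded_iff by blast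
  define S where "S = S1 + 3"
  have "\<exists>N::nat. approx E (cube (S + 2 * real N) - cball p (r p)) A'" if p: "p \<in> F" for p
  proof -
    have pW: "p \<in> W - E" using F(2) p by blast
    obtain g :: "real \<Rightarrow> 'a" where g: "continuous_on {0..1} g" "g 0 = p" "\<And>s. s \<in> {0..1} \<Longrightarrow> xdir (g s - g 0)"
      "\<And>z s. z \<in> E \<Longrightarrow> s \<in> {0..1} \<Longrightarrow> 4 * r p \<le> norm (z - g s)" "A' \<inter> cball (g 1) (2 * r p) = {}"
      using r(2)[OF pW] by blast
    have "\<bar>z \<bullet> b\<bar> + 3 \<le> S" if "z \<in> E" "b \<in> Basis" for z b
      using S1[of z] Basis_le_norm[OF that(2), of z] that(1) by (simp add: S_def)
    then obtain N :: nat where N: "approx E (cube (S + 2 * real N) - cball (g 0) (r p)) (cube S - cball (g 1) (2 * r p))"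
      using approx_move_pole[OF g(1,3) r(1)[OF pW] g(4), where S = S] by blast
    have "z \<in> cube S" if "z \<in> A'" for z
      unfolding mem_cube
    proof
      fix b :: 'a assume "b \<in> Basis"
      then show "\<bar>z \<bullet> b\<bar> < S" using S1[of z] Basis_le_norm[of b z] that by (simp add: S_def)
    qed
    then have "A' \<subseteq> cube S - cball (g 1) (2 * r p)" using g(5) by blast
    then show ?thesis using approx_mono[OF N subset_refl _ subset_refl] g(2) by blast
  qed
  then have "\<forall>p\<in>F. \<exists>N::nat. approx E (cube (S + 2 * real N) - cball p (r p)) A'" by blast
  from bchoice[OF this] obtain N :: "'a \<Rightarrow> nat" where N: "\<forall>p\<in>F. approx E (cube (S + 2 * real (N p)) - cball p (r p)) A'" by blast
  \<comment> \<open>The one cube on which all pieces are solutions must contain the starting cube of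
    every path; \<open>decomposition\<close> allows any cube beyond \<open>S0\<close>.\<close>
  define S2 where "S2 = \<bar>S0\<bar> + 1 + \<bar>S\<bar> + 2 * (\<Sum>p\<in>F. real (N p))"
  have S2: "S2 > S0" unfolding S2_def using sum_nonneg[of F "\<lambda>p. real (N p)"] by linarith
  have opn: "open (cube S2 - cball p (r p))" for p by (intro open_Diff open_box closed_cball)
  have ap: "approx E (cube S2 - cball p (r p)) A'" if p: "p \<in> F" for p
  proof (rule approx_mono)
    show "approx E (cube (S + 2 * real (N p)) - cball p (r p)) A'" using N p by blast
    have "real (N p) \<le> (\<Sum>p\<in>F. real (N p))" using F(1) p by (intro member_le_sum) auto
    then have "S + 2 * real (N p) \<le> S2" unfolding S2_def by linarith
    then have "x \<in> cube S2" if "x \<in> cube (S + 2 * real (N p))" for x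
      using that unfolding mem_cube by (meson order_less_le_trans)
    then have "cube (S + 2 * real (N p)) \<subseteq> cube S2" by blast
    then show "cube (S + 2 * real (N p)) - cball p (r p) \<subseteq> cube S2 - cball p (r p)" by blast
  qed auto
  obtain C0 where C0: "\<And>f. sol W f \<Longrightarrow> (\<forall>z\<in>W. cmod (f z) \<le> 1) \<Longrightarrow>
      (\<exists>u. (\<forall>p\<in>F. sol (cube S2 - cball p (r p)) (u p) \<and> (\<forall>z. cmod (u p z) \<le> C0)) \<and>
        (\<forall>z\<in>E. f z = (\<Sum>p\<in>F. u p z)))"
    using F(3)[rule_format, OF S2] by blast
  define B where "B = \<bar>C0\<bar> + 1"
  have B: "B \<ge> 1" "C0 \<le> B" by (auto simp: B_def)
  have "\<forall>p\<in>F. \<exists>Cs. fst Cs > 0 \<and> snd Cs > 0 \<and> (\<forall>\<epsilon> u. 0 < \<epsilon> \<longrightarrow> \<epsilon> < 1 \<longrightarrow> sol (cube S2 - cball p (r p)) u \<longrightarrow>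
      (\<forall>z. cmod (u z) \<le> B) \<longrightarrow>
      (\<exists>u'. sol A' u' \<and> (\<forall>z\<in>E. cmod (u z - u' z) \<le> \<epsilon> * B) \<and> (\<forall>z\<in>A'. cmod (u' z) \<le> fst Cs * \<epsilon> powr (- snd Cs) * B)))"
  proof
    fix p assume p: "p \<in> F"
    obtain C s where Cs: "C > 0" "s > 0" "\<And>\<epsilon> u B. 0 < \<epsilon> \<Longrightarrow> \<epsilon> < 1 \<Longrightarrow> sol (cube S2 - cball p (r p)) u \<Longrightarrow> 0 < B \<Longrightarrow>
        (\<And>z. z \<in> cube S2 - cball p (r p) \<Longrightarrow> cmod (u z) \<le> B) \<Longrightarrow>
      \<exists>u'. sol A' u' \<and> (\<forall>z\<in>E. cmod (u z - u' z) \<le> \<epsilon> * B) \<and> (\<forall>z\<in>A'. cmod (u' z) \<le> C * \<epsilon> powr (- s) * B)"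
      using approx_scaled[OF ap[OF p] opn A'(1)] by blast
    show "\<exists>Cs. fst Cs > 0 \<and> snd Cs > 0 \<and> (\<forall>\<epsilon> u. 0 < \<epsilon> \<longrightarrow> \<epsilon> < 1 \<longrightarrow> sol (cube S2 - cball p (r p)) u \<longrightarrow>
      (\<forall>z. cmod (u z) \<le> B) \<longrightarrow>
      (\<exists>u'. sol A' u' \<and> (\<forall>z\<in>E. cmod (u z - u' z) \<le> \<epsilon> * B) \<and> (\<forall>z\<in>A'. cmod (u' z) \<le> fst Cs * \<epsilon> powr (- snd Cs) * B)))"
      using Cs B(1) by (intro exI[of _ "(C, s)"]) auto
  qed
  from bchoice[OF this] obtain Cs where Cs: "\<And>p. p \<in> F \<Longrightarrow> fst (Cs p) > 0" "\<And>p. p \<in> F \<Longrightarrow> snd (Cs p) > 0"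
    "\<And>p \<epsilon> u. p \<in> F \<Longrightarrow> 0 < \<epsilon> \<Longrightarrow> \<epsilon> < 1 \<Longrightarrow> sol (cube S2 - cball p (r p)) u \<Longrightarrow> (\<forall>z. cmod (u z) \<le> B) \<Longrightarrow>
      (\<exists>u'. sol A' u' \<and> (\<forall>z\<in>E. cmod (u z - u' z) \<le> \<epsilon> * B) \<and> (\<forall>z\<in>A'. cmod (u' z) \<le> fst (Cs p) * \<epsilon> powr (- snd (Cs p)) * B))"
    by blast
  define n where "n = real (card F) + 1"
  define s where "s = 1 + (\<Sum>p\<in>F. snd (Cs p))"
  define C where "C = 1 + (\<Sum>p\<in>F. fst (Cs p)) * B * (B * n) powr s"
  have s: "s > 0" unfolding s_def using Cs(2) by (intro add_pos_nonneg sum_nonneg) (auto simp: less_imp_le)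
  have n: "n \<ge> 1" by (simp add: n_def)
  have Bn: "B * n \<ge> 1" using mult_mono[of 1 B 1 n] B n by simp
  have C: "C > 0" unfolding C_def using Cs(1) B by (intro add_pos_nonneg mult_nonneg_nonneg sum_nonneg) (auto simp: less_imp_le)
  have "\<exists>u'. sol A' u' \<and> (\<forall>z\<in>E. cmod (f z - u' z) \<le> \<epsilon>) \<and> (\<forall>z\<in>A'. cmod (u' z) \<le> C * \<epsilon> powr (- s))"
    if \<epsilon>: "\<epsilon> \<in> {0<..<1}" and f: "sol W f" "\<forall>z\<in>W. cmod (f z) \<le> 1" for \<epsilon> f
  proof -
    obtain u where u: "\<And>p. p \<in> F \<Longrightarrow> sol (cube S2 - cball p (r p)) (u p)" "\<And>p z. p \<in> F \<Longrightarrow> cmod (u p z) \<le> C0"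
      "\<And>z. z \<in> E \<Longrightarrow> f z = (\<Sum>p\<in>F. u p z)" using C0[OF f] by blast
    \<comment> \<open>The error is shared among the pieces, each bounded by B. As \<open>n\<close>
      is one more than the number of poles, it is positive even if there are none.\<close>
    define \<epsilon>' where "\<epsilon>' = \<epsilon> / (B * n)"
    have \<epsilon>': "0 < \<epsilon>'" "\<epsilon>' < 1" using \<epsilon> Bn by (auto simp: \<epsilon>'_def divide_simps)
    have "\<forall>p\<in>F. \<exists>u'. sol A' u' \<and> (\<forall>z\<in>E. cmod (u p z - u' z) \<le> \<epsilon>' * B) \<and> (\<forall>z\<in>A'. cmod (u' z) \<le> fst (Cs p) * \<epsilon>' powr (- snd (Cs p)) * B)"
      using Cs(3)[OF _ \<epsilon>' u(1)] order_trans[OF u(2) B(2)] by blast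
    from bchoice[OF this] obtain u' where u': "\<And>p. p \<in> F \<Longrightarrow> sol A' (u' p)" "\<And>p z. p \<in> F \<Longrightarrow> z \<in> E \<Longrightarrow> cmod (u p z - u' p z) \<le> \<epsilon>' * B"
      "\<And>p z. p \<in> F \<Longrightarrow> z \<in> A' \<Longrightarrow> cmod (u' p z) \<le> fst (Cs p) * \<epsilon>' powr (- snd (Cs p)) * B" by blast
    have "sol A' (\<lambda>z. \<Sum>p\<in>F. u' p z)" by (rule sol_sum[OF A'(1) u'(1)])
    moreover have "cmod (f z - (\<Sum>p\<in>F. u' p z)) \<le> \<epsilon>" if z: "z \<in> E" for z
    proof -
      have "cmod (f z - (\<Sum>p\<in>F. u' p z)) = cmod (\<Sum>p\<in>F. u p z - u' p z)" by (simp add: u(3)[OF z] sum_subtractf)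
      also have "\<dots> \<le> (\<Sum>p\<in>F. \<epsilon>' * B)" by (intro sum_norm_le u'(2) z)
      also have "\<dots> = \<epsilon> * (real (card F) / n)" using B by (simp add: \<epsilon>'_def)
      also have "\<dots> \<le> \<epsilon> * 1" using \<epsilon> by (intro mult_left_mono) (auto simp: n_def)
      finally show ?thesis by simp
    qed
    moreover have "cmod (\<Sum>p\<in>F. u' p z) \<le> C * \<epsilon> powr (- s)" if z: "z \<in> A'" for z
    proof -
      have "cmod (\<Sum>p\<in>F. u' p z) \<le> (\<Sum>p\<in>F. fst (Cs p) * (\<epsilon>' powr (- s) * B))"
      proof (intro sum_norm_le)
        fix p assume p: "p \<in> F"
        have "snd (Cs p) \<le> (\<Sum>p\<in>F. snd (Cs p))" using F(1) p Cs(2) by (intro member_le_sum) (auto simp: less_imp_le)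
        then have "\<epsilon>' powr (- snd (Cs p)) \<le> \<epsilon>' powr (- s)" using \<epsilon>' by (intro powr_mono') (auto simp: s_def)
        then have "fst (Cs p) * \<epsilon>' powr (- snd (Cs p)) * B \<le> fst (Cs p) * (\<epsilon>' powr (- s) * B)"
          unfolding mult.assoc using Cs(1)[OF p] B by (intro mult_left_mono mult_right_mono) auto
        then show "cmod (u' p z) \<le> fst (Cs p) * (\<epsilon>' powr (- s) * B)" using u'(3)[OF p z] by linarith
      qed
      also have "\<dots> = (\<Sum>p\<in>F. fst (Cs p)) * B * \<epsilon>' powr (- s)" unfolding sum_distrib_right[symmetric] by (simp add: mult_ac)
      also have "\<epsilon>' powr (- s) = (B * n) powr s * \<epsilon> powr (- s)"
        unfolding \<epsilon>'_def using \<epsilon> Bn by (simp add: powr_divide powr_minus field_simps)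
      also have "(\<Sum>p\<in>F. fst (Cs p)) * B * ((B * n) powr s * \<epsilon> powr (- s)) \<le> C * \<epsilon> powr (- s)"
        unfolding C_def by (simp add: algebra_simps)
      finally show ?thesis .
    qed
    ultimately show ?thesis by blast
  qed
  then show ?thesis unfolding approx_def using C s by blast
qed

end

subsection \<open>Passage to the limit\<close>

lemma smooth_on_local:
  assumes "\<And>x. x \<in> X \<Longrightarrow> \<exists>Y. open Y \<and> x \<in> Y \<and> smooth_on Y f"
  shows "smooth_on X f"
proof -
  have Ck: "\<lbrakk>\<And>x. x \<in> X \<Longrightarrow> \<exists>Y. open Y \<and> x \<in> Y \<and> Ck_on k Y f\<rbrakk> \<Longrightarrow> Ck_on k X f" for k f
  proof (induction k arbitrary: f)
    case 0
    have "continuous (at x) f" if "x \<in> X" for x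
      using 0[OF that] by (auto simp: continuous_on_eq_continuous_at)
    then show ?case by (simp add: continuous_at_imp_continuous_on)
  next
    case (Suc k)
    show ?case unfolding Ck_on_Suc_iff
    proof (intro conjI ballI)
      show "f differentiable (at x)" if "x \<in> X" for x
        using Suc.prems[OF that] unfolding Ck_on_Suc_iff by blast
      show "Ck_on k X (pd b f)" if "b \<in> Basis" for b
      proof (rule Suc.IH)
        fix x assume "x \<in> X"
        then obtain Y where "open Y" "x \<in> Y" "Ck_on (Suc k) Y f" using Suc.prems[of x] by blast
        then show "\<exists>Y. open Y \<and> x \<in> Y \<and> Ck_on k Y (pd b f)"
          using that unfolding Ck_on_Suc_iff by (intro exI[of _ Y]) simp
      qed
    qed
  qed
  show ?thesis unfolding smooth_on_def
  proof (intro allI Ck)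
    fix k x assume "x \<in> X"
    then obtain Y where "open Y" "x \<in> Y" "smooth_on Y f" using assms[of x] by blast
    then show "\<exists>Y. open Y \<and> x \<in> Y \<and> Ck_on k Y f" by (auto simp: smooth_on_def)
  qed
qed

context semielliptic
begin

lemma sol_local:
  assumes "\<And>x. x \<in> X \<Longrightarrow> \<exists>Y. open Y \<and> x \<in> Y \<and> sol Y f"
  shows "sol X f"
  unfolding sol_def
proof
  show "smooth_on X f" using assms unfolding sol_def by (intro smooth_on_local) blast
  show "\<forall>z\<in>X. op 1 f z = 0" using assms unfolding sol_def by blast
qed

text \<open>Successive corrections with errors \<eta> / 2^(i + 1) on growing sets add up to at most
  \<eta> on \<open>E k\<close>. The growth bound of \<open>approx\<close> keeps each iterate
  bounded, so that the next approximation applies to it.\<close>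

lemma mittag_leffler:
  fixes D E :: "nat \<Rightarrow> 'a set"
  assumes op: "\<And>i. open (D i)" and DE: "\<And>i. D i \<subseteq> E i" and ED: "\<And>i. E i \<subseteq> D (Suc i)"
    and ap: "\<And>i. approx (E i) (D (Suc i)) (D (Suc (Suc i)))"
    and u: "sol (D (Suc k)) u" and bd: "\<And>z. z \<in> D (Suc k) \<Longrightarrow> cmod (u z) \<le> B" and \<eta>: "\<eta> > 0"
  obtains h where "sol (\<Union>i. D i) h" "\<And>z. z \<in> E k \<Longrightarrow> cmod (u z - h z) \<le> \<eta>"
proof -
  have Dmono: "D i \<subseteq> D j" and Emono: "E i \<subseteq> E j" if "i \<le> j" for i j
  proof -
    have "D n \<subseteq> D (Suc n)" "E n \<subseteq> E (Suc n)" for n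
      using DE[of n] ED[of n] DE[of "Suc n"] by auto
    then show "D i \<subseteq> D j" "E i \<subseteq> E j"
      using lift_Suc_mono_le[of D i j] lift_Suc_mono_le[of E i j] that by auto
  qed
  define P where "P i v \<longleftrightarrow> sol (D (Suc (k + i))) v \<and> (\<exists>B. \<forall>z\<in>D (Suc (k + i)). cmod (v z) \<le> B)" for i v
  define Q where "Q i v v' \<longleftrightarrow> (\<forall>z\<in>E (k + i). cmod (v z - v' z) \<le> \<eta> / 2 ^ Suc i)" for i and v v' :: "'a \<Rightarrow> complex"
  have "\<exists>f. \<forall>i. (P i (f i) \<and> (i = 0 \<longrightarrow> f i = u)) \<and> Q i (f i) (f (Suc i))"
  proof (rule dependent_nat_choice)
    show "\<exists>v. P 0 v \<and> (0 = 0 \<longrightarrow> v = u)" using u bd by (auto simp: P_def)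
    fix v i assume "P i v \<and> (i = 0 \<longrightarrow> v = u)"
    then obtain B where v: "sol (D (Suc (k + i))) v" "\<And>z. z \<in> D (Suc (k + i)) \<Longrightarrow> cmod (v z) \<le> B"
      by (auto simp: P_def)
    define B' where "B' = \<bar>B\<bar> + 1"
    have B': "B' > 0" "\<And>z. z \<in> D (Suc (k + i)) \<Longrightarrow> cmod (v z) \<le> B'" using v(2) by (fastforce simp: B'_def)+
    obtain C s where Cs: "C > 0" "s > 0" "\<And>\<epsilon> u B. 0 < \<epsilon> \<Longrightarrow> \<epsilon> < 1 \<Longrightarrow> sol (D (Suc (k + i))) u \<Longrightarrow> 0 < B \<Longrightarrow>
      (\<And>z. z \<in> D (Suc (k + i)) \<Longrightarrow> cmod (u z) \<le> B) \<Longrightarrow>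
      \<exists>u'. sol (D (Suc (Suc (k + i)))) u' \<and> (\<forall>z\<in>E (k + i). cmod (u z - u' z) \<le> \<epsilon> * B) \<and>
        (\<forall>z\<in>D (Suc (Suc (k + i))). cmod (u' z) \<le> C * \<epsilon> powr (- s) * B)"
      using approx_scaled[OF ap op op] by blast
    \<comment> \<open>Relative to the bound B' the accuracy is \<eta> / 2^(i + 1); the minimum with
      1 / 2 keeps it below 1, as \<open>approx\<close> requires.\<close>
    define \<epsilon> where "\<epsilon> = min (1 / 2) (\<eta> / 2 ^ Suc i / B')"
    have \<epsilon>: "0 < \<epsilon>" "\<epsilon> < 1" "\<epsilon> * B' \<le> \<eta> / 2 ^ Suc i"
      using \<eta> B'(1) by (auto simp: \<epsilon>_def min_def field_simps)
    obtain v' where v': "sol (D (Suc (Suc (k + i)))) v'" "\<forall>z\<in>E (k + i). cmod (v z - v' z) \<le> \<epsilon> * B'"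
        "\<forall>z\<in>D (Suc (Suc (k + i))). cmod (v' z) \<le> C * \<epsilon> powr (- s) * B'"
      using Cs(3)[OF \<epsilon>(1,2) v(1) B'] by blast
    have "P (Suc i) v'" using v'(1,3) by (auto simp: P_def)
    moreover have "Q i v v'" unfolding Q_def using v'(2) \<epsilon>(3) by force
    ultimately show "\<exists>v'. (P (Suc i) v' \<and> (Suc i = 0 \<longrightarrow> v' = u)) \<and> Q i v v'" by blast
  qed
  then obtain f where f: "\<And>i. P i (f i)" "f 0 = u" "\<And>i. Q i (f i) (f (Suc i))" by blast
  have solf: "sol (D (Suc (k + i))) (f i)" for i using f(1) by (simp add: P_def)
  have tail: "cmod (f i z - f j z) \<le> \<eta> / 2 ^ i" if "i \<le> j" "z \<in> E (k + i)" for i j z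
  proof -
    have "cmod (f i z - f j z) \<le> \<eta> / 2 ^ i - \<eta> / 2 ^ j"
      using that(1)
    proof (induction j rule: dec_induct)
      case (step j)
      have "z \<in> E (k + j)" using Emono[of "k + i" "k + j"] that(2) step by auto
      then have "cmod (f j z - f (Suc j) z) \<le> \<eta> / 2 ^ Suc j" using f(3) by (simp add: Q_def)
      moreover have "cmod (f i z - f (Suc j) z) \<le> cmod (f i z - f j z) + cmod (f j z - f (Suc j) z)"
        using norm_triangle_ineq[of "f i z - f j z" "f j z - f (Suc j) z"] by simp
      moreover have "\<eta> / 2 ^ j = \<eta> / 2 ^ Suc j + \<eta> / 2 ^ Suc j" by simp
      ultimately show ?case using step.IH by linarith
    qed simp
    moreover have "\<eta> / 2 ^ j > 0" using \<eta> by simp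
    ultimately show ?thesis by linarith
  qed
  \<comment> \<open>The iterate \<open>f i\<close> is controlled only on the domain of its own
    index, so on a fixed set the sequence is shifted by N.\<close>
  have cauchy: "uniformly_Cauchy_on (E (k + N)) (\<lambda>i. f (i + N))" for N
  proof (rule uniformly_Cauchy_onI)
    fix e :: real assume e: "e > 0"
    obtain n where n: "\<eta> / e < 2 ^ n" using real_arch_pow[of 2 "\<eta> / e"] by auto
    then have ne: "\<eta> / 2 ^ n < e" using e by (simp add: field_simps)
    have "dist (f (i + N) z) (f (j + N) z) < e" if z: "z \<in> E (k + N)" and ij: "i \<ge> Suc n" "j \<ge> Suc n" for z i j
    proof -
      have z': "z \<in> E (k + (Suc n + N))" using Emono[of "k + N" "k + (Suc n + N)"] z by auto
      have "cmod (f (Suc n + N) z - f (i + N) z) \<le> \<eta> / 2 ^ (Suc n + N)" "cmod (f (Suc n + N) z - f (j + N) z) \<le> \<eta> / 2 ^ (Suc n + N)"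
        using ij by (intro tail z'; simp)+
      moreover have "dist (f (i + N) z) (f (j + N) z) \<le> cmod (f (Suc n + N) z - f (i + N) z) + cmod (f (Suc n + N) z - f (j + N) z)"
        using dist_triangle3[of "f (i + N) z" "f (j + N) z" "f (Suc n + N) z"] by (simp add: dist_norm)
      moreover have "\<eta> / 2 ^ (Suc n + N) \<le> \<eta> / 2 ^ Suc n" using \<eta> by (intro divide_left_mono) (auto intro!: power_increasing)
      moreover have "\<eta> / 2 ^ n = \<eta> / 2 ^ Suc n + \<eta> / 2 ^ Suc n" by simp
      ultimately show ?thesis using ne by linarith
    qed
    then show "\<exists>M. \<forall>x\<in>E (k + N). \<forall>m\<ge>M. \<forall>n\<ge>M. dist (f (m + N) x) (f (n + N) x) < e" by blast
  qed
  define h where "h z = lim (\<lambda>i. f i z)" for z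
  have lims: "\<exists>g. sol (D (k + N)) g \<and> (\<forall>x\<in>D (k + N). (\<lambda>i. f (i + N) x) \<longlonglongrightarrow> g x)" for N
  proof -
    have 1: "sol (D (k + N)) (f (i + N))" for i
      by (rule sol_subset[OF solf]) (intro Dmono, simp)
    have 2: "uniformly_Cauchy_on S (\<lambda>i. f (i + N))" if "S \<subseteq> D (k + N)" for S
      using cauchy[of N] that DE unfolding uniformly_Cauchy_on_def by (meson subset_iff)
    show ?thesis by (rule sol_limit[of "D (k + N)" "\<lambda>i. f (i + N)", OF op 1 2]) auto
  qed
  have hl: "sol (D (k + N)) h" "\<And>x. x \<in> D (k + N) \<Longrightarrow> (\<lambda>i. f i x) \<longlonglongrightarrow> h x" for N
  proof -
    obtain g where g: "sol (D (k + N)) g" "\<And>x. x \<in> D (k + N) \<Longrightarrow> (\<lambda>i. f (i + N) x) \<longlonglongrightarrow> g x" using lims by blast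
    have gh: "g x = h x" "(\<lambda>i. f i x) \<longlonglongrightarrow> h x" if "x \<in> D (k + N)" for x
    proof -
      have "(\<lambda>i. f i x) \<longlonglongrightarrow> g x" using g(2)[OF that] by (rule LIMSEQ_offset)
      then show "g x = h x" "(\<lambda>i. f i x) \<longlonglongrightarrow> h x" unfolding h_def by (auto simp: limI)
    qed
    show "sol (D (k + N)) h" by (rule sol_cong[OF op gh(1) g(1)])
    show "\<And>x. x \<in> D (k + N) \<Longrightarrow> (\<lambda>i. f i x) \<longlonglongrightarrow> h x" by (rule gh(2))
  qed
  show ?thesis
  proof (rule that)
    show "sol (\<Union>i. D i) h"
    proof (rule sol_local)
      fix x assume "x \<in> (\<Union>i. D i)"
      then obtain i where "x \<in> D i" by blast
      then have "x \<in> D (k + i)" using Dmono[of i "k + i"] by auto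
      then show "\<exists>Y. open Y \<and> x \<in> Y \<and> sol Y h" using hl(1) op by blast
    qed
    fix z assume z: "z \<in> E k"
    then have "z \<in> D (k + 1)" using ED by auto
    then have "(\<lambda>i. f i z) \<longlonglongrightarrow> h z" by (rule hl(2))
    then have "(\<lambda>i. cmod (f 0 z - f i z)) \<longlonglongrightarrow> cmod (f 0 z - h z)" by (intro tendsto_intros)
    moreover have "cmod (f 0 z - f i z) \<le> \<eta>" for i using tail[of 0 i z] z by simp
    ultimately show "cmod (u z - h z) \<le> \<eta>" unfolding f(2) by (intro LIMSEQ_le_const2) auto
  qed
qed

end

subsection \<open>Exhaustion of an open set\<close>

text \<open>Stating the distance to the complement by a quantifier over its points covers G = UNIV
  as well.\<close>

definition exhaustion :: "'b::euclidean_space set \<Rightarrow> nat \<Rightarrow> 'b set" where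
  "exhaustion G k = {x. norm x \<le> real k \<and> (\<forall>y. y \<notin> G \<longrightarrow> 1 / real (Suc k) \<le> dist x y)}"

lemma compact_exhaustion:
  fixes G :: "'b::euclidean_space set"
  shows "compact (exhaustion G k)"
proof -
  have "exhaustion G k = cball 0 (real k) \<inter> (\<Inter>y\<in>- G. {x. 1 / real (Suc k) \<le> dist x y})"
    by (auto simp: exhaustion_def)
  moreover have "closed {x. 1 / real (Suc k) \<le> dist x y}" for y :: 'b
    by (intro closed_Collect_le continuous_intros)
  ultimately show ?thesis by (auto intro!: compact_Int_closed closed_INT)
qed

lemma exhaustion_subset: "exhaustion G k \<subseteq> G"
proof
  fix x assume "x \<in> exhaustion G k"
  then have "x \<notin> G \<Longrightarrow> 1 / real (Suc k) \<le> dist x x" unfolding exhaustion_def by blast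
  moreover have "0 < 1 / real (Suc k)" by simp
  ultimately show "x \<in> G" by fastforce
qed

lemma exhaustion_interior: "exhaustion G k \<subseteq> interior (exhaustion G (Suc k))"
proof
  fix x assume x: "x \<in> exhaustion G k"
  define e where "e = min 1 (1 / real (Suc k) - 1 / real (Suc (Suc k)))"
  have "1 / real (Suc (Suc k)) < 1 / real (Suc k)" by (intro divide_strict_left_mono) auto
  then have e: "e > 0" "e \<le> 1" "e \<le> 1 / real (Suc k) - 1 / real (Suc (Suc k))"
    by (auto simp: e_def simp del: of_nat_Suc)
  have "ball x e \<subseteq> exhaustion G (Suc k)"
  proof
    fix y assume y: "y \<in> ball x e"
    have "norm y \<le> norm x + dist x y" using norm_triangle_ineq[of x "y - x"] by (simp add: dist_norm norm_minus_commute)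
    then have "norm y \<le> real (Suc k)" using x y e by (auto simp: exhaustion_def)
    moreover have "1 / real (Suc (Suc k)) \<le> dist y z" if "z \<notin> G" for z
    proof -
      have "1 / real (Suc k) \<le> dist x z" using x that by (auto simp: exhaustion_def)
      moreover have "dist x z \<le> dist x y + dist y z" by (rule dist_triangle)
      moreover have "dist x y < e" using y by simp
      ultimately show ?thesis using e(3) by linarith
    qed
    ultimately show "y \<in> exhaustion G (Suc k)" by (simp add: exhaustion_def)
  qed
  then show "x \<in> interior (exhaustion G (Suc k))" using e(1) by (meson centre_in_ball interiorI open_ball)
qed

lemma exhaustion_mono:
  assumes "i \<le> j"
  shows "exhaustion G i \<subseteq> exhaustion G j"
proof (rule lift_Suc_mono_le[OF _ assms])
  show "exhaustion G n \<subseteq> exhaustion G (Suc n)" for n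
    by (rule order_trans[OF exhaustion_interior interior_subset])
qed

lemma compact_subset_exhaustion:
  assumes "compact S" "S \<subseteq> G" "open G"
  obtains k where "S \<subseteq> exhaustion G k"
proof -
  obtain R where R: "\<And>x. x \<in> S \<Longrightarrow> norm x \<le> R" using compact_imp_bounded[OF assms(1)] by (auto simp: bounded_iff)
  have "closed (- G)" "S \<inter> - G = {}" using assms by auto
  from separate_compact_closed[OF assms(1) this]
  obtain d where d: "d > 0" "\<forall>x\<in>S. \<forall>y\<in>- G. d \<le> dist x y" by blast
  obtain k where k: "max R (1 / d) \<le> real k" using real_arch_simple by blast
  have "1 / d \<le> real (Suc k)" using k by simp
  then have "1 / real (Suc k) \<le> d" using d(1) by (simp add: field_simps)
  then have "S \<subseteq> exhaustion G k" using R d(2) k by (force simp: exhaustion_def)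
  then show ?thesis by (rule that)
qed

text \<open>A point off the exhaustion can be so for two reasons. If its norm exceeds k, the ray
  outwards avoids the exhaustion and makes the component unbounded. If it is close to some y not in
  G, the whole ball around y avoids the exhaustion, so the component contains y. Thus the sets of
  the exhaustion satisfy the topological hypothesis made on K.\<close>

lemma exhaustion_components:
  assumes C: "C \<in> components (- exhaustion G k)" "bounded C"
  shows "\<not> C \<subseteq> G"
proof
  assume CG: "C \<subseteq> G"
  obtain x where x: "x \<in> C" using in_components_nonempty[OF C(1)] by blast
  then have "x \<notin> exhaustion G k" using in_components_subset[OF C(1)] by blast
  then consider "norm x > real k" | y where "y \<notin> G" "dist x y < 1 / real (Suc k)"
    unfolding exhaustion_def by fastforce
  then show False
  proof cases
    case 1
    define T where "T = (\<lambda>s. s *\<^sub>R x) ` {1..}"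
    have "connected T" unfolding T_def by (intro connected_continuous_image continuous_intros) simp
    moreover have "T \<subseteq> - exhaustion G k"
    proof
      fix y assume "y \<in> T"
      then obtain s where s: "s \<ge> 1" "y = s *\<^sub>R x" by (auto simp: T_def)
      have "1 * norm x \<le> s * norm x" using s by (intro mult_right_mono) auto
      then have "norm y > real k" using s 1 by simp
      then show "y \<in> - exhaustion G k" by (simp add: exhaustion_def)
    qed
    moreover have "x \<in> T" unfolding T_def by (auto intro!: image_eqI[of _ _ 1])
    ultimately have "T \<subseteq> C" using components_maximal[OF C(1)] x by blast
    then have "bounded T" using C(2) bounded_subset by blast
    then obtain B where B: "\<And>y. y \<in> T \<Longrightarrow> norm y \<le> B" by (auto simp: bounded_iff)
    have x0: "norm x > 0" using 1 by linarith
    define s where "s = max 1 ((B + 1) / norm x)"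
    have "s *\<^sub>R x \<in> T" by (auto simp: T_def s_def)
    then have "s * norm x \<le> B" using B[of "s *\<^sub>R x"] by (simp add: s_def)
    moreover have "(B + 1) / norm x * norm x \<le> s * norm x" using x0 by (intro mult_right_mono) (auto simp: s_def)
    ultimately show False using x0 by simp
  next
    case 2
    have "ball y (1 / real (Suc k)) \<subseteq> - exhaustion G k"
    proof
      fix z assume "z \<in> ball y (1 / real (Suc k))"
      then have "\<not> 1 / real (Suc k) \<le> dist z y" by (simp add: dist_commute)
      then show "z \<in> - exhaustion G k" using 2(1) unfolding exhaustion_def by blast
    qed
    moreover have "C \<inter> ball y (1 / real (Suc k)) \<noteq> {}" using x 2(2) by (auto simp: dist_commute)
    ultimately have "ball y (1 / real (Suc k)) \<subseteq> C" by (rule components_maximal[OF C(1) connected_ball])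
    moreover have "y \<in> ball y (1 / real (Suc k))" by simp
    ultimately have "y \<in> C" by blast
    then show False using CG 2(1) by blast
  qed
qed

subsection \<open>The operator \<open>\<alpha> D\<^sub>t\<^sup>r - Q(D\<^sub>x)\<close>\<close>

definition et :: "'n::finite spacetime" where
  "et = (1, 0)"

definition ex :: "'n::finite \<Rightarrow> 'n spacetime" where
  "ex j = (0, axis j 1)"

lemma Basis_spacetime: "(Basis :: 'n::finite spacetime set) = insert et (range ex)"
  by (auto simp: Basis_prod_def Basis_vec_def et_def ex_def image_iff)

lemma et_Basis [simp]: "et \<in> Basis" and ex_Basis [simp]: "ex j \<in> Basis"
  by (auto simp: Basis_spacetime)

lemma ex_neq_et [simp]: "ex j \<noteq> et"
  by (simp add: et_def ex_def)

lemma inner_et [simp]: "z \<bullet> et = fst z" and inner_ex [simp]: "z \<bullet> ex j = snd z $ j"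
  by (auto simp: et_def ex_def inner_prod_def inner_axis)

lemma inj_ex: "inj ex"
  by (auto simp: inj_def ex_def axis_eq_axis)

lemma sum_Basis_spacetime: "sum f (Basis :: 'n::finite spacetime set) = f et + (\<Sum>j\<in>UNIV. f (ex j))"
  unfolding Basis_spacetime using inj_ex
  by (subst sum.insert) (auto simp: sum.reindex[OF inj_ex] image_iff dest: ex_neq_et[THEN notE, OF sym])

section \<open>Monomials and the principal part\<close>

definition monom_eval :: "('n::finite \<Rightarrow>\<^sub>0 nat) \<Rightarrow> real^'n \<Rightarrow> complex" where
  "monom_eval k \<xi> = (\<Prod>j\<in>UNIV. complex_of_real (\<xi> $ j) ^ Poly_Mapping.lookup k j)"

lemma monom_eval_scale: "monom_eval k (s *\<^sub>R \<xi>) = of_real s ^ mdegree k * monom_eval k \<xi>"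
  by (simp add: monom_eval_def mdegree_def power_mult_distrib prod.distrib power_sum)

lemma mdegree_le_total_degree: "k \<in> Poly_Mapping.keys Q \<Longrightarrow> mdegree k \<le> total_degree Q"
  unfolding total_degree_def by (intro Max_ge) auto

lemma lookup_homogeneous_part:
  "Poly_Mapping.lookup (homogeneous_part d Q) k =
    (if k \<in> Poly_Mapping.keys Q \<and> mdegree k = d then Poly_Mapping.lookup Q k else 0)"
  by (simp add: homogeneous_part_def lookup_sum lookup_single when_def)

lemma eval_principal_part:
  "eval_poly (principal_part Q) \<xi> =
    (\<Sum>k\<in>{k \<in> Poly_Mapping.keys Q. mdegree k = total_degree Q}. Poly_Mapping.lookup Q k * monom_eval k \<xi>)"
proof -
  have "Poly_Mapping.keys (principal_part Q) = {k \<in> Poly_Mapping.keys Q. mdegree k = total_degree Q}"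
    by (auto simp: in_keys_iff principal_part_def lookup_homogeneous_part split: if_splits)
  then show ?thesis unfolding eval_poly_def monom_eval_def[symmetric]
    by (intro sum.cong) (auto simp: principal_part_def lookup_homogeneous_part)
qed

lemma continuous_monom_eval [continuous_intros]:
  "continuous_on S f \<Longrightarrow> continuous_on S (\<lambda>x. monom_eval k (f x))"
  unfolding monom_eval_def by (intro continuous_intros)

text \<open>Replacing (\<tau>, \<xi>) by (l^m \<tau>, l^r \<xi>) multiplies both sides by l^(m r),
  so the minimum over the compact set where the weighted size is 1 decides. It is positive: for
  \<xi> = 0 because \<alpha> is not 0, otherwise by the disjointness of the two sets of
  values.\<close>

lemma principal_lower_bound:
  fixes Q :: "'n::finite cpoly" and r :: nat
  defines "m \<equiv> total_degree Q"
  assumes r: "1 \<le> r" "r < m" and \<alpha>: "\<alpha> \<noteq> 0"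
    and disj: "{eval_poly (principal_part Q) x | x. x \<noteq> 0} \<inter> {\<alpha> * complex_of_real t ^ r | t. True} = {}"
  obtains c where "c > 0"
    "\<And>\<tau> \<xi>. c * (\<bar>\<tau>\<bar> ^ r + norm \<xi> ^ m) \<le> cmod (\<alpha> * of_real \<tau> ^ r - eval_poly (principal_part Q) \<xi>)"
proof -
  define q where "q = eval_poly (principal_part Q)"
  have q: "q \<xi> = (\<Sum>k\<in>{k \<in> Poly_Mapping.keys Q. mdegree k = m}. Poly_Mapping.lookup Q k * monom_eval k \<xi>)" for \<xi>
    by (simp add: q_def eval_principal_part m_def)
  have qs: "q (s *\<^sub>R \<xi>) = of_real s ^ m * q \<xi>" for s \<xi>
    unfolding q sum_distrib_left by (intro sum.cong) (auto simp: monom_eval_scale)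
  define h where "h z = cmod (\<alpha> * of_real (fst z) ^ r - q (snd z))" for z :: "'n spacetime"
  define n where "n z = \<bar>fst z\<bar> ^ r + norm (snd z) ^ m" for z :: "'n spacetime"
  define K where "K = {z :: 'n spacetime. n z = 1}"
  have cn: "continuous_on UNIV n" unfolding n_def by (intro continuous_intros)
  have ch: "continuous_on UNIV h" unfolding h_def q by (intro continuous_intros)
  have "closed K"
    using continuous_closed_preimage[OF cn closed_UNIV, of "{1}"] by (simp add: K_def vimage_def)
  moreover have "bounded K"
  proof (rule boundedI[of _ "1 + 1"])
    fix z assume "z \<in> K"
    then have nz: "\<bar>fst z\<bar> ^ r + norm (snd z) ^ m = 1" by (simp add: K_def n_def)
    have "0 \<le> \<bar>fst z\<bar> ^ r" "0 \<le> norm (snd z) ^ m" by simp_all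
    then have "\<bar>fst z\<bar> ^ r \<le> 1" "norm (snd z) ^ m \<le> 1" using nz by linarith+
    then have "\<bar>fst z\<bar> \<le> 1" "norm (snd z) \<le> 1"
      using power_le_one_iff[of "\<bar>fst z\<bar>" r] power_le_one_iff[of "norm (snd z)" m] r by auto
    then show "norm z \<le> 1 + 1" using norm_Pair_le[of "fst z" "snd z"] by simp
  qed
  ultimately have K: "compact K" by (simp add: compact_eq_bounded_closed)
  have "(1, 0) \<in> K" using r by (simp add: K_def n_def)
  then obtain z0 where z0: "z0 \<in> K" "\<And>z. z \<in> K \<Longrightarrow> h z0 \<le> h z"
    using continuous_attains_inf[OF K _ continuous_on_subset[OF ch]] by blast
  have q0: "q 0 = 0" using qs[of 0 0] r by (simp add: power_0_left)
  have "h z0 > 0"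
  proof (rule ccontr)
    assume "\<not> h z0 > 0"
    then have e: "q (snd z0) = \<alpha> * of_real (fst z0) ^ r" by (simp add: h_def)
    show False
    proof (cases "snd z0 = 0")
      case True
      then have "fst z0 \<noteq> 0" using z0(1) r by (auto simp: K_def n_def power_0_left)
      then show False using e True q0 \<alpha> by simp
    next
      case False
      then show False using e disj unfolding q_def by blast
    qed
  qed
  moreover have "h z0 * (\<bar>\<tau>\<bar> ^ r + norm \<xi> ^ m) \<le> cmod (\<alpha> * of_real \<tau> ^ r - q \<xi>)" for \<tau> \<xi>
  proof (cases "\<bar>\<tau>\<bar> ^ r + norm \<xi> ^ m = 0")
    case False
    define N where "N = \<bar>\<tau>\<bar> ^ r + norm \<xi> ^ m"
    have N: "N > 0" using False unfolding N_def by (simp add: order_less_le)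
    define l where "l = root (m * r) N"
    have mr: "0 < m * r" using r by simp
    have l: "l > 0" "l ^ (m * r) = N" using N mr by (auto simp: l_def)
    define z where "z = (\<tau> / l ^ m, (1 / l ^ r) *\<^sub>R \<xi>)"
    have lm: "(l ^ m) ^ r = N" "(l ^ r) ^ m = N" using l(2) by (simp_all add: power_mult[symmetric] mult.commute)
    have "n z = \<bar>\<tau>\<bar> ^ r / N + norm \<xi> ^ m / N"
      using l(1) by (simp add: n_def z_def power_divide lm power_mult_distrib)
    also have "\<dots> = 1" using N by (simp add: N_def add_divide_distrib[symmetric])
    finally have "h z0 \<le> h z" by (intro z0(2)) (simp add: K_def)
    also have "h z = cmod ((\<alpha> * of_real \<tau> ^ r - q \<xi>) / of_real N)"
    proof -
      have "complex_of_real (\<tau> / l ^ m) ^ r = of_real \<tau> ^ r / of_real N"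
        by (simp add: power_divide lm flip: of_real_power)
      moreover have "complex_of_real (1 / l ^ r) ^ m = 1 / of_real N"
        by (simp add: power_divide lm flip: of_real_power)
      ultimately have "\<alpha> * of_real (fst z) ^ r - q (snd z) = (\<alpha> * of_real \<tau> ^ r - q \<xi>) / of_real N"
        unfolding z_def fst_conv snd_conv qs by (simp add: diff_divide_distrib)
      then show ?thesis by (simp add: h_def)
    qed
    also have "\<dots> = cmod (\<alpha> * of_real \<tau> ^ r - q \<xi>) / N" using N by (simp add: norm_divide)
    finally show ?thesis using N by (simp add: N_def[symmetric] pos_le_divide_eq)
  qed simp
  ultimately show ?thesis unfolding q_def by (rule that)
qed

section \<open>Encoding of P(D) by weights, words and coefficients\<close>

definition wtP :: "nat \<Rightarrow> nat \<Rightarrow> 'n::finite spacetime \<Rightarrow> real" where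
  "wtP m r b = (if b = et then real m / real r else 1)"

definition xword :: "('n::{finite,linorder} \<Rightarrow>\<^sub>0 nat) \<Rightarrow> 'n spacetime list" where
  "xword k = concat (map (\<lambda>j. replicate (Poly_Mapping.lookup k j) (ex j)) (sorted_list_of_set UNIV))"

text \<open>\<open>None\<close> indexes the time derivative and \<open>Some k\<close> the monomials
  of Q.\<close>

fun wdP :: "nat \<Rightarrow> ('n::{finite,linorder} \<Rightarrow>\<^sub>0 nat) option \<Rightarrow> 'n spacetime list" where
  "wdP r None = replicate r et"
| "wdP r (Some k) = xword k"

text \<open>The powers of - \<i> convert partial derivatives into D = - \<i> times the partial
  derivative; in the symbol they cancel against the powers of \<i> in \<open>isym\<close>.\<close>

fun cfP :: "complex \<Rightarrow> nat \<Rightarrow> 'n::finite cpoly \<Rightarrow> ('n \<Rightarrow>\<^sub>0 nat) option \<Rightarrow> complex" where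
  "cfP \<alpha> r Q None = \<alpha> * (- \<i>) ^ r"
| "cfP \<alpha> r Q (Some k) = - Poly_Mapping.lookup Q k * (- \<i>) ^ mdegree k"

definition idx :: "'n::finite cpoly \<Rightarrow> ('n \<Rightarrow>\<^sub>0 nat) option set" where
  "idx Q = insert None (Some ` Poly_Mapping.keys Q)"

lemma sum_idx: "sum f (idx Q) = f None + (\<Sum>k\<in>Poly_Mapping.keys Q. f (Some k))"
  unfolding idx_def by (subst sum.insert) (auto simp: sum.reindex)

lemma mdegree_sum_list: "sum_list (map (Poly_Mapping.lookup k) (sorted_list_of_set UNIV)) = mdegree k"
  for k :: "'n::{finite,linorder} \<Rightarrow>\<^sub>0 nat"
  by (simp add: mdegree_def sum_list_distinct_conv_sum_set)

lemma set_xword: "set (xword k) \<subseteq> Basis"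
  by (auto simp: xword_def)

lemma wl_xword: "wl (wtP m r) (xword k) = real (mdegree k)"
proof -
  have "wl (wtP m r) (concat (map (\<lambda>j. replicate (Poly_Mapping.lookup k j) (ex j)) L)) =
      real (sum_list (map (Poly_Mapping.lookup k) L))" for L
    by (induction L) (auto simp: wl_def wtP_def sum_list_replicate)
  then show ?thesis by (simp add: xword_def mdegree_sum_list)
qed

lemma minus_i_power: "(- \<i>) ^ n * \<i> ^ n = 1"
  by (simp add: power_mult_distrib[symmetric])

lemma isym_xword: "isym (xword k) \<zeta> = \<i> ^ mdegree k * monom_eval k (snd \<zeta>)"
proof -
  have "isym (concat (map (\<lambda>j. replicate (Poly_Mapping.lookup k j) (ex j)) L)) \<zeta> =
      (\<Prod>j\<in>set L. (\<i> * of_real (snd \<zeta> $ j)) ^ Poly_Mapping.lookup k j)" if "distinct L" for L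
    using that by (induction L) (auto simp: isym_def)
  from this[of "sorted_list_of_set UNIV"]
  have "isym (xword k) \<zeta> = (\<Prod>j\<in>UNIV. (\<i> * of_real (snd \<zeta> $ j)) ^ Poly_Mapping.lookup k j)"
    by (simp add: xword_def)
  then show ?thesis by (simp add: power_mult_distrib prod.distrib monom_eval_def mdegree_def power_sum)
qed

lemma symbol_P:
  fixes Q :: "'n::{finite,linorder} cpoly"
  assumes "d > 0" "r > 0"
  shows "(\<Sum>i\<in>idx Q. cfP \<alpha> r Q i * of_real (d powr (real m - wl (wtP m r) (wdP r i))) * isym (wdP r i) \<zeta>) =
    \<alpha> * of_real (fst \<zeta>) ^ r - (\<Sum>k\<in>Poly_Mapping.keys Q. Poly_Mapping.lookup Q k * of_real (d powr (real m - real (mdegree k))) * monom_eval k (snd \<zeta>))"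
proof -
  have "wl (wtP m r) (replicate r (et :: 'n spacetime)) = real m" using assms(2) by (simp add: wl_def wtP_def sum_list_replicate)
  moreover have "isym (replicate r et) \<zeta> = \<i> ^ r * of_real (fst \<zeta>) ^ r"
    by (simp add: isym_def power_mult_distrib)
  ultimately have 1: "cfP \<alpha> r Q None * of_real (d powr (real m - wl (wtP m r) (wdP r (None :: ('n \<Rightarrow>\<^sub>0 nat) option)))) * isym (wdP r None) \<zeta> =
      \<alpha> * of_real (fst \<zeta>) ^ r"
    using assms(1) minus_i_power[of r] by (simp add: mult_ac)
  have 2: "cfP \<alpha> r Q (Some k) * of_real (d powr (real m - wl (wtP m r) (wdP r (Some k)))) * isym (wdP r (Some k)) \<zeta> =
      - (Poly_Mapping.lookup Q k * of_real (d powr (real m - real (mdegree k))) * monom_eval k (snd \<zeta>))" for k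
    using minus_i_power[of "mdegree k"] by (simp add: wl_xword isym_xword mult_ac)
  show ?thesis unfolding sum_idx 1 2 by (simp add: sum_negf)
qed

text \<open>The terms of weight m are bounded below by \<open>principal_lower_bound\<close>. A
  monomial of lower degree is at most \<rho>^(m - 1), and its power of d is at most 1, so for large
  \<rho> the lower terms lose against \<rho>^m uniformly in d. Along \<open>et\<close> the symbol is
  \<alpha> x^r minus a constant, which has finitely many zeros.\<close>

lemma semielliptic_P:
  fixes Q :: "'n::{finite,linorder} cpoly" and r :: nat
  defines "m \<equiv> total_degree Q"
  assumes r: "1 \<le> r" "r < m" and \<alpha>: "\<alpha> \<noteq> 0"
    and disj: "{eval_poly (principal_part Q) x | x. x \<noteq> 0} \<inter> {\<alpha> * complex_of_real t ^ r | t. True} = {}"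
  shows "semielliptic (wtP m r) (idx Q) (cfP \<alpha> r Q) (wdP r) (real m) et"
proof
  let ?wt = "wtP m r :: 'n spacetime \<Rightarrow> real"
  have rp: "r > 0" using r by simp
  show "1 \<le> ?wt b" for b using r by (simp add: wtP_def)
  show "finite (idx Q)" by (simp add: idx_def)
  show "set (wdP r i) \<subseteq> Basis" for i :: "('n \<Rightarrow>\<^sub>0 nat) option"
    using set_xword by (cases i) auto
  show "wl ?wt (wdP r i) \<le> real m" if "i \<in> idx Q" for i
    using that mdegree_le_total_degree r unfolding idx_def m_def
    by (auto simp: wl_xword) (simp add: wl_def wtP_def sum_list_replicate)
  obtain c where c: "c > 0"
    "\<And>\<tau> \<xi>. c * (\<bar>\<tau>\<bar> ^ r + norm \<xi> ^ m) \<le> cmod (\<alpha> * of_real \<tau> ^ r - eval_poly (principal_part Q) \<xi>)"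
    using principal_lower_bound[OF r[unfolded m_def] \<alpha> disj] unfolding m_def by blast
  \<comment> \<open>\<open>rho\<close> has a summand for each of the n coordinates of x, one for t
    and the constant 1, each at most the maximum \<open>M\<close> below.\<close>
  define \<nu> where "\<nu> = real CARD('n) + 2"
  have \<nu>: "\<nu> > 0" by (simp add: \<nu>_def)
  have rho: "rho ?wt \<zeta> = 1 + \<bar>fst \<zeta>\<bar> powr (real r / real m) + (\<Sum>j\<in>UNIV. \<bar>snd \<zeta> $ j\<bar>)" for \<zeta>
    by (simp add: rho_def sum_Basis_spacetime wtP_def)
  have rho1: "1 \<le> rho ?wt \<zeta>" for \<zeta> by (simp add: rho sum_nonneg)
  have main: "(rho ?wt \<zeta> / \<nu>) ^ m \<le> 1 + \<bar>fst \<zeta>\<bar> ^ r + norm (snd \<zeta>) ^ m" for \<zeta>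
  proof -
    define a where "a = \<bar>fst \<zeta>\<bar> powr (real r / real m)"
    define M where "M = max 1 (max a (norm (snd \<zeta>)))"
    have "(\<Sum>j\<in>UNIV. \<bar>snd \<zeta> $ j\<bar>) \<le> (\<Sum>j\<in>(UNIV::'n set). M)"
      by (intro sum_mono) (use component_le_norm_cart[of "snd \<zeta>"] in \<open>auto simp: M_def le_max_iff_disj\<close>)
    then have "rho ?wt \<zeta> \<le> M + M + real CARD('n) * M" unfolding rho a_def[symmetric] by (simp add: M_def)
    then have "rho ?wt \<zeta> / \<nu> \<le> M" using \<nu> by (simp add: \<nu>_def field_simps)
    then have "(rho ?wt \<zeta> / \<nu>) ^ m \<le> M ^ m" using rho1[of \<zeta>] \<nu> by (intro power_mono) auto
    also have "M ^ m \<le> 1 + a ^ m + norm (snd \<zeta>) ^ m"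
    proof -
      have "0 \<le> a ^ m" "0 \<le> norm (snd \<zeta>) ^ m" by (auto simp: a_def)
      moreover have "M = 1 \<or> M = a \<or> M = norm (snd \<zeta>)" by (auto simp: M_def max_def)
      ultimately show ?thesis by auto
    qed
    also have "a ^ m = \<bar>fst \<zeta>\<bar> ^ r"
    proof (cases "fst \<zeta> = 0")
      case True
      then show ?thesis using r by (simp add: a_def power_0_left)
    next
      case False
      then have "a ^ m = \<bar>fst \<zeta>\<bar> powr (real r / real m * real m)" by (simp add: a_def powr_realpow[symmetric] powr_powr)
      then show ?thesis using r False by (simp add: powr_realpow)
    qed
    finally show ?thesis .
  qed
  define low where "low = {k \<in> Poly_Mapping.keys Q. mdegree k < m}"
  have mono: "cmod (monom_eval k (snd \<zeta>)) \<le> rho ?wt \<zeta> ^ mdegree k" for k and \<zeta> :: "'n spacetime"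
  proof -
    have "\<bar>snd \<zeta> $ j\<bar> \<le> rho ?wt \<zeta>" for j
    proof -
      have "\<bar>snd \<zeta> $ j\<bar> \<le> (\<Sum>j\<in>UNIV. \<bar>snd \<zeta> $ j\<bar>)" by (intro member_le_sum) auto
      moreover have "0 \<le> \<bar>fst \<zeta>\<bar> powr (real r / real m)" by simp
      ultimately show ?thesis unfolding rho by linarith
    qed
    then have "(\<Prod>j\<in>UNIV. \<bar>snd \<zeta> $ j\<bar> ^ Poly_Mapping.lookup k j) \<le> (\<Prod>j\<in>UNIV. rho ?wt \<zeta> ^ Poly_Mapping.lookup k j)"
      by (intro prod_mono) (auto intro!: power_mono)
    then show ?thesis by (simp add: monom_eval_def mdegree_def prod_norm[symmetric] norm_power power_sum)
  qed
  define L where "L = (\<Sum>k\<in>low. cmod (Poly_Mapping.lookup Q k))"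
  have L: "L \<ge> 0" by (simp add: L_def sum_nonneg)
  define c' where "c' = c / \<nu> ^ m"
  have c': "c' > 0" using c(1) \<nu> by (simp add: c'_def)
  \<comment> \<open>From this size on, the lower order terms and the constant c together consume at
    most half of c' \<rho>^m.\<close>
  define R where "R = 1 + 2 * (c + L) / c'"
  have est: "c' / 2 * rho ?wt \<zeta> powr real m \<le> cmod (\<Sum>i\<in>idx Q. cfP \<alpha> r Q i * of_real (d powr (real m - wl ?wt (wdP r i))) * isym (wdP r i) \<zeta>)"
    if d: "0 < d" "d \<le> 1" and R: "R \<le> rho ?wt \<zeta>" for \<zeta> d
  proof -
    define \<rho> where "\<rho> = rho ?wt \<zeta>"
    have \<rho>: "\<rho> \<ge> 1" "R \<le> \<rho>" using rho1 R by (auto simp: \<rho>_def)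
    let ?t = "\<lambda>k. Poly_Mapping.lookup Q k * of_real (d powr (real m - real (mdegree k))) * monom_eval k (snd \<zeta>)"
    have keys: "Poly_Mapping.keys Q = {k \<in> Poly_Mapping.keys Q. mdegree k = m} \<union> low"
      using mdegree_le_total_degree[of _ Q] unfolding low_def m_def by (auto simp: order_less_le)
    have "(\<Sum>k\<in>Poly_Mapping.keys Q. ?t k) = (\<Sum>k\<in>{k \<in> Poly_Mapping.keys Q. mdegree k = m}. ?t k) + (\<Sum>k\<in>low. ?t k)"
      by (subst keys, rule sum.union_disjoint) (auto simp: low_def)
    also have "(\<Sum>k\<in>{k \<in> Poly_Mapping.keys Q. mdegree k = m}. ?t k) = eval_poly (principal_part Q) (snd \<zeta>)"
      unfolding eval_principal_part m_def using d by (intro sum.cong) auto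
    finally have eq: "(\<Sum>i\<in>idx Q. cfP \<alpha> r Q i * of_real (d powr (real m - wl ?wt (wdP r i))) * isym (wdP r i) \<zeta>) =
        (\<alpha> * of_real (fst \<zeta>) ^ r - eval_poly (principal_part Q) (snd \<zeta>)) - (\<Sum>k\<in>low. ?t k)"
      unfolding symbol_P[OF d(1) rp] by simp
    have lowb: "cmod (\<Sum>k\<in>low. ?t k) \<le> L * \<rho> ^ (m - 1)"
      unfolding L_def sum_distrib_right
    proof (rule sum_norm_le)
      fix k assume k: "k \<in> low"
      have "d powr (real m - real (mdegree k)) \<le> 1 powr (real m - real (mdegree k))"
        using d k by (intro powr_mono2) (auto simp: low_def)
      then have d1: "d powr (real m - real (mdegree k)) \<le> 1" by simp
      have "cmod (monom_eval k (snd \<zeta>)) \<le> \<rho> ^ mdegree k" unfolding \<rho>_def by (rule mono)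
      also have "\<dots> \<le> \<rho> ^ (m - 1)" using k \<rho> by (intro power_increasing) (auto simp: low_def)
      finally have "d powr (real m - real (mdegree k)) * cmod (monom_eval k (snd \<zeta>)) \<le> 1 * \<rho> ^ (m - 1)"
        using d1 by (intro mult_mono) auto
      then show "cmod (?t k) \<le> cmod (Poly_Mapping.lookup Q k) * \<rho> ^ (m - 1)"
        by (simp add: norm_mult mult.assoc mult_left_mono)
    qed
    have "c' * \<rho> ^ m - c \<le> c * (\<bar>fst \<zeta>\<bar> ^ r + norm (snd \<zeta>) ^ m)"
    proof -
      have "c * (\<rho> / \<nu>) ^ m \<le> c * (1 + \<bar>fst \<zeta>\<bar> ^ r + norm (snd \<zeta>) ^ m)"
        unfolding \<rho>_def using c(1) by (intro mult_left_mono main) auto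
      then show ?thesis by (simp add: c'_def power_divide algebra_simps)
    qed
    also note c(2)[of "fst \<zeta>" "snd \<zeta>"]
    finally have 1: "c' * \<rho> ^ m - c \<le> cmod (\<alpha> * of_real (fst \<zeta>) ^ r - eval_poly (principal_part Q) (snd \<zeta>))" .
    have cX: "c \<le> c * \<rho> ^ (m - 1)" using c(1) \<rho>(1) by (simp add: one_le_power)
    have "(c + L) * \<rho> ^ (m - 1) \<le> (c' / 2 * \<rho>) * \<rho> ^ (m - 1)"
    proof (rule mult_right_mono)
      have "2 * (c + L) / c' \<le> \<rho>" using \<rho>(2) by (simp add: R_def)
      then show "c + L \<le> c' / 2 * \<rho>" using c' by (simp add: field_simps)
    qed (use \<rho> in simp)
    moreover have "\<rho> * \<rho> ^ (m - 1) = \<rho> ^ m" using r by (simp add: power_Suc[symmetric] del: power_Suc)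
    ultimately have "c * \<rho> ^ (m - 1) + L * \<rho> ^ (m - 1) \<le> c' / 2 * \<rho> ^ m"
      by (simp only: distrib_right mult.assoc)
    then have "c' / 2 * \<rho> ^ m \<le> c' * \<rho> ^ m - c - L * \<rho> ^ (m - 1)"
      using cX by linarith
    also have "\<dots> \<le> cmod (\<alpha> * of_real (fst \<zeta>) ^ r - eval_poly (principal_part Q) (snd \<zeta>)) - cmod (\<Sum>k\<in>low. ?t k)"
      using 1 lowb by linarith
    also have "\<dots> \<le> cmod ((\<alpha> * of_real (fst \<zeta>) ^ r - eval_poly (principal_part Q) (snd \<zeta>)) - (\<Sum>k\<in>low. ?t k))"
      by (rule norm_triangle_ineq2)
    finally show ?thesis unfolding eq using \<rho>(1) by (simp add: \<rho>_def[symmetric] powr_realpow)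
  qed
  show "\<exists>c>0. \<exists>R. \<forall>\<zeta> d. 0 < d \<longrightarrow> d \<le> 1 \<longrightarrow> R \<le> rho ?wt \<zeta> \<longrightarrow>
      c * rho ?wt \<zeta> powr real m \<le> cmod (\<Sum>i\<in>idx Q. cfP \<alpha> r Q i * of_real (d powr (real m - wl ?wt (wdP r i))) * isym (wdP r i) \<zeta>)"
    using est c' by (intro exI[of _ "c' / 2"] conjI exI[of _ R]) auto
  show "finite {s. (\<Sum>i\<in>idx Q. cfP \<alpha> r Q i * isym (wdP r i) (\<zeta> + s *\<^sub>R et)) = 0}" for \<zeta>
  proof -
    define w where "w = (\<Sum>k\<in>Poly_Mapping.keys Q. Poly_Mapping.lookup Q k * monom_eval k (snd \<zeta>)) / \<alpha>"
    have "(\<Sum>i\<in>idx Q. cfP \<alpha> r Q i * isym (wdP r i) (\<zeta> + s *\<^sub>R et)) = \<alpha> * of_real (fst \<zeta> + s) ^ r - \<alpha> * w" for s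
      using symbol_P[OF zero_less_one rp, where Q = Q and \<alpha> = \<alpha> and m = m and \<zeta> = "\<zeta> + s *\<^sub>R et"] \<alpha>
      by (simp add: w_def et_def)
    then have "{s. (\<Sum>i\<in>idx Q. cfP \<alpha> r Q i * isym (wdP r i) (\<zeta> + s *\<^sub>R et)) = 0} = (\<lambda>s. complex_of_real (fst \<zeta> + s)) -` {x. x ^ r = w}"
      using \<alpha> by auto
    moreover have "finite ((\<lambda>s. complex_of_real (fst \<zeta> + s)) -` {x. x ^ r = w})"
      by (intro finite_vimageI finite_nth_roots rp injI) simp
    ultimately show ?thesis by simp
  qed
qed

section \<open>P(D) as a sum of derivatives along words\<close>

lemma D_power_word:
  assumes X: "open X" "smooth_on X f" and b: "b \<in> Basis" and w: "set w \<subseteq> Basis"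
    and D: "\<And>h. D h = (\<lambda>z. - \<i> * pd b h z)"
    and g: "\<And>z. z \<in> X \<Longrightarrow> g z = c * pdw w f z" and z: "z \<in> X"
  shows "(D ^^ k) g z = c * (- \<i>) ^ k * pdw (replicate k b @ w) f z"
  using z
proof (induction k arbitrary: z)
  case 0
  then show ?case using g by simp
next
  case (Suc k)
  have s: "smooth_on X (pdw (replicate k b @ w) f)"
    using b w by (intro smooth_on_pdw X) auto
  have "(D ^^ Suc k) g z = - \<i> * pd b ((D ^^ k) g) z" by (simp add: D)
  also have "pd b ((D ^^ k) g) z = pd b (\<lambda>z. c * (- \<i>) ^ k * pdw (replicate k b @ w) f z) z"
    by (rule pd_cong[OF X(1) Suc.IH Suc.prems])
  also have "\<dots> = c * (- \<i>) ^ k * pd b (pdw (replicate k b @ w) f) z"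
    by (rule pd_cmult[OF smooth_on_differentiable[OF s Suc.prems]])
  finally show ?case by (simp add: mult_ac)
qed

lemma D_x_power_word:
  fixes f :: "'n::{finite,linorder} spacetime \<Rightarrow> complex"
  assumes X: "open X" "smooth_on X f" and z: "z \<in> X"
  shows "D_x_power k f z = (- \<i>) ^ mdegree k * pdw (xword k) f z"
proof -
  have "foldr (\<lambda>j. D_x j ^^ Poly_Mapping.lookup k j) L f z =
      (- \<i>) ^ sum_list (map (Poly_Mapping.lookup k) L) * pdw (concat (map (\<lambda>j. replicate (Poly_Mapping.lookup k j) (ex j)) L)) f z"
    if "z \<in> X" for L z
    using that
  proof (induction L arbitrary: z)
    case (Cons j L)
    have "(D_x j ^^ Poly_Mapping.lookup k j) (foldr (\<lambda>j. D_x j ^^ Poly_Mapping.lookup k j) L f) z =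
      (- \<i>) ^ sum_list (map (Poly_Mapping.lookup k) L) * (- \<i>) ^ Poly_Mapping.lookup k j *
      pdw (replicate (Poly_Mapping.lookup k j) (ex j) @ concat (map (\<lambda>j. replicate (Poly_Mapping.lookup k j) (ex j)) L)) f z"
      by (rule D_power_word[OF X _ _ _ Cons.IH Cons.prems]) (auto simp: D_x_def pd_def ex_def[symmetric])
    then show ?case by (simp add: power_add mult_ac)
  qed simp
  from this[OF z, of "sorted_list_of_set UNIV"] show ?thesis
    by (simp add: D_x_power_def xword_def mdegree_sum_list)
qed

lemma P_op_word:
  fixes f :: "'n::{finite,linorder} spacetime \<Rightarrow> complex"
  assumes X: "open X" "smooth_on X f" and z: "z \<in> X"
  shows "P_op \<alpha> r Q f z = (\<Sum>i\<in>idx Q. cfP \<alpha> r Q i * pdw (wdP r i) f z)"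
proof -
  have "(D_t ^^ r) f z = 1 * (- \<i>) ^ r * pdw (replicate r et @ []) f z"
    by (rule D_power_word[OF X _ _ _ _ z]) (auto simp: D_t_def pd_def et_def[symmetric])
  then show ?thesis
    unfolding P_op_def poly_D_x_def sum_idx D_x_power_word[OF X z] by (simp add: sum_negf mult.assoc)
qed

subsection \<open>Space-time cylinders\<close>

text \<open>Poles travel at constant time. A component of the complement of K inside closure G'
  would be bounded and contained in G, which is excluded; so every point off K can leave closure G'
  without meeting K. Leaving closure G' in space means leaving the closed cylinder, whatever T
  is.\<close>

lemma runge_cylinder:
  fixes K U G G' :: "(real^'n::{finite,linorder}) set"
  assumes "semielliptic (wtP m r) I cf wd M e0"
    and K: "compact K" "K \<subseteq> U" and U: "open U"
    and G: "\<not> (\<exists>C \<in> components (UNIV - K). bounded C \<and> C \<subseteq> G)"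
    and G': "open G'" "bounded G'" "closure G' \<subseteq> G" and t: "a < t1" "t1 \<le> t2" "t2 < b"
  shows "semielliptic.approx (wtP m r) I cf wd M ({t1..t2} \<times> K) ({a<..<b} \<times> U) ({-T<..<T} \<times> G')"
proof -
  interpret semielliptic "wtP m r :: 'n spacetime \<Rightarrow> real" I cf wd M e0 by fact
  have cl: "closure ({-T<..<T} \<times> G') \<subseteq> UNIV \<times> closure G'" unfolding closure_Times by auto
  show ?thesis
  proof (rule runge_theorem)
    show "open ({a<..<b} \<times> U)" using U by (intro open_Times) auto
    show "compact ({t1..t2} \<times> K)" using K by (intro compact_Times) auto
    show "{t1..t2} \<times> K \<subseteq> {a<..<b} \<times> U" using K t by auto
    show "open ({-T<..<T} \<times> G')" using G' by (intro open_Times) auto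
    show "bounded ({-T<..<T} \<times> G')" using G' by (intro bounded_Times) auto
    fix p assume p: "p \<in> {a<..<b} \<times> U - {t1..t2} \<times> K"
    obtain \<tau> y where py: "p = (\<tau>, y)" by (cases p)
    have "\<exists>\<gamma> y'. path \<gamma> \<and> pathstart \<gamma> = y \<and> pathfinish \<gamma> = y' \<and> y' \<notin> closure G' \<and> (\<tau> \<in> {t1..t2} \<longrightarrow> path_image \<gamma> \<inter> K = {})"
    proof (cases "y \<in> K")
      case True
      \<comment> \<open>The pole is separated from \<open>[t1, t2] \<times> K\<close> in time, so its path may cross \<open>K\<close>.\<close>
      then have "\<tau> \<notin> {t1..t2}" using p py by auto
      have "\<not> bounded (UNIV :: (real, 'n) vec set)" by simp
      then have "closure G' \<noteq> UNIV" using bounded_closure[OF G'(2)] by metis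
      then obtain y' where "y' \<notin> closure G'" by blast
      then show ?thesis using \<open>\<tau> \<notin> {t1..t2}\<close> by (intro exI[of _ "linepath y y'"] exI[of _ y']) auto
    next
      case False
      define C where "C = connected_component_set (UNIV - K) y"
      have Cc: "C \<in> components (UNIV - K)" unfolding C_def using False by (intro componentsI) auto
      have "\<not> C \<subseteq> closure G'"
      proof
        assume "C \<subseteq> closure G'"
        then have "bounded C" "C \<subseteq> G" using bounded_subset[OF bounded_closure[OF G'(2)]] G'(3) by auto
        then show False using G Cc by blast
      qed
      then obtain y' where y': "y' \<in> C" "y' \<notin> closure G'" by blast
      have "open (UNIV - K)" using K(1) by (simp add: compact_imp_closed open_Diff)
      then have "path_component (UNIV - K) y y'"
        using y'(1) unfolding C_def by (simp add: open_path_connected_component)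
      then obtain \<gamma> where \<gamma>: "path \<gamma>" "path_image \<gamma> \<subseteq> UNIV - K" "pathstart \<gamma> = y" "pathfinish \<gamma> = y'"
        unfolding path_component_def by blast
      then show ?thesis using y'(2) by (intro exI[of _ \<gamma>] exI[of _ y']) auto
    qed
    then obtain \<gamma> where \<gamma>: "path \<gamma>" "pathstart \<gamma> = y" "pathfinish \<gamma> \<notin> closure G'" "\<tau> \<in> {t1..t2} \<Longrightarrow> path_image \<gamma> \<inter> K = {}" by blast
    define g where "g s = (\<tau>, \<gamma> s)" for s
    have "path g" using \<gamma>(1) unfolding path_def g_def by (intro continuous_intros)
    moreover have "pathstart g = p" using \<gamma>(2) by (simp add: pathstart_def g_def py)
    moreover have "pathfinish g \<notin> closure ({-T<..<T} \<times> G')"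
      using \<gamma>(3) cl by (auto simp: pathfinish_def g_def)
    moreover have "path_image g \<inter> {t1..t2} \<times> K = {}"
      using \<gamma>(4) unfolding path_image_def g_def by blast
    moreover have "xdir (g s - p)" for s
      unfolding xdir_def by (auto simp: wtP_def g_def py)
    ultimately show "\<exists>g. path g \<and> pathstart g = p \<and> pathfinish g \<notin> closure ({-T<..<T} \<times> G') \<and>
      path_image g \<inter> {t1..t2} \<times> K = {} \<and> (\<forall>s\<in>{0..1}. xdir (g s - p))" by blast
  qed
qed

section \<open>Sup norms and the final estimate\<close>

lemma sup_norm_le: "0 \<le> c \<Longrightarrow> (\<And>z. z \<in> S \<Longrightarrow> cmod (f z) \<le> c) \<Longrightarrow> sup_norm S f \<le> c"
  unfolding sup_norm_def by (auto intro: cSUP_least)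

lemma le_sup_norm:
  assumes "compact S" "continuous_on S f" "z \<in> S"
  shows "cmod (f z) \<le> sup_norm S f"
proof -
  have "bounded ((\<lambda>z. cmod (f z)) ` S)"
    by (intro compact_imp_bounded compact_continuous_image continuous_intros assms)
  then show ?thesis unfolding sup_norm_def using assms(3) by (auto intro!: cSUP_upper bounded_imp_bdd_above)
qed

lemma sup_norm_nonneg:
  assumes "compact S" "continuous_on S f"
  shows "0 \<le> sup_norm S f"
proof (cases "S = {}")
  case False
  then obtain z where "z \<in> S" by blast
  from order_trans[OF norm_ge_zero le_sup_norm[OF assms this]] show ?thesis .
qed (simp add: sup_norm_def)

theorem theorem1p3:
  fixes Q :: "'n::{finite,linorder} cpoly"
    and \<alpha> :: complex and m r :: nat
    and G H K :: "(real^'n::{finite,linorder}) set"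
    and J :: "real set" and t\<^sub>1 t\<^sub>2 :: real
  assumes "elliptic Q" and "total_degree Q = m"
    and "1 \<le> r" and "r < m" and "\<alpha> \<noteq> 0"
    and "{eval_poly (principal_part Q) x | x. x \<noteq> 0} \<inter> {\<alpha> * complex_of_real t ^ r | t. True} = {}"
    and "open G" and "compact K" and "K \<subseteq> G"
    and "\<exists>U. open U \<and> continuous_boundary U \<and> K = closure U"
    and "\<not> (\<exists>C \<in> components (UNIV - K). bounded C \<and> C \<subseteq> G)"
    and "t\<^sub>1 \<le> t\<^sub>2"
    and "open H" and "K \<subseteq> H" and "H \<subseteq> G"
    and "open J" and "is_interval J" and "{t\<^sub>1..t\<^sub>2} \<subseteq> J"
  shows "\<forall>L \<delta> M. compact L \<and> L \<subseteq> H \<and> K \<subseteq> interior L \<and>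
           0 < \<delta> \<and> {t\<^sub>1 - \<delta>..t\<^sub>2 + \<delta>} \<subseteq> J \<and>
           compact M \<and> M \<subseteq> UNIV \<times> G \<longrightarrow>
         (\<exists>s C :: real. 0 < s \<and> 0 < C \<and>
           (\<forall>f \<in> kernel_on (P_op \<alpha> r Q) (J \<times> H). \<forall>\<epsilon> \<in> {0<..<1}.
             \<exists>h \<in> kernel_on (P_op \<alpha> r Q) (UNIV \<times> G).
               sup_norm ({t\<^sub>1..t\<^sub>2} \<times> K) (\<lambda>z. f z - h z)
                 \<le> \<epsilon> * sup_norm ({t\<^sub>1 - \<delta>..t\<^sub>2 + \<delta>} \<times> L) f \<and>
               sup_norm M h
                 \<le> C / \<epsilon> powr s * sup_norm ({t\<^sub>1 - \<delta>..t\<^sub>2 + \<delta>} \<times> L) f))"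
proof (intro allI impI)
  fix L \<delta> and M :: "'n spacetime set"
  assume prems: "compact L \<and> L \<subseteq> H \<and> K \<subseteq> interior L \<and> 0 < \<delta> \<and> {t\<^sub>1 - \<delta>..t\<^sub>2 + \<delta>} \<subseteq> J \<and>
    compact M \<and> M \<subseteq> UNIV \<times> G"
  note md = assms(2)
  have se: "semielliptic (wtP m r) (idx Q) (cfP \<alpha> r Q) (wdP r) (real m) et"
    using semielliptic_P[of r Q \<alpha>] assms by blast
  interpret semielliptic "wtP m r :: 'n spacetime \<Rightarrow> real" "idx Q" "cfP \<alpha> r Q" "wdP r" "real m" et
    by (rule se)
  have sol_iff: "sol X f \<longleftrightarrow> f \<in> kernel_on (P_op \<alpha> r Q) X" if "open X" for X f
    unfolding sol_def kernel_on_def using P_op_word[OF that] by (auto simp: op_1)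
  define D where "D i = {- real i<..<real i} \<times> interior (exhaustion G i)" for i
  define E where "E i = {- real i..real i} \<times> exhaustion G i" for i
  have opD: "open (D i)" for i unfolding D_def by (intro open_Times) auto
  have DE: "D i \<subseteq> E i" for i unfolding D_def E_def using interior_subset by fastforce
  have ED: "E i \<subseteq> D (Suc i)" for i unfolding D_def E_def using exhaustion_interior[of G i] by auto
  have UD: "(\<Union>i. D i) = UNIV \<times> G"
  proof
    show "(\<Union>i. D i) \<subseteq> UNIV \<times> G" unfolding D_def using interior_subset exhaustion_subset by blast
    show "UNIV \<times> G \<subseteq> (\<Union>i. D i)"
    proof
      fix z assume "z \<in> (UNIV :: real set) \<times> G"
      then obtain t x where z: "z = (t, x)" "x \<in> G" by auto
      obtain k where k: "{x} \<subseteq> exhaustion G k" using compact_subset_exhaustion[of "{x}" G] z assms(7) by auto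
      obtain l where l: "\<bar>t\<bar> \<le> real l" using real_arch_simple by blast
      have "z \<in> E (max k l)" unfolding E_def z(1) using k l exhaustion_mono[of k "max k l" G] by auto
      then show "z \<in> (\<Union>i. D i)" using ED by blast
    qed
  qed
  have cb: "closure (interior (exhaustion G i)) \<subseteq> exhaustion G i" "bounded (interior (exhaustion G i))" for i
    by (rule closure_minimal[OF interior_subset compact_imp_closed[OF compact_exhaustion]],
        rule bounded_subset[OF compact_imp_bounded[OF compact_exhaustion] interior_subset])
  have ap: "approx (E i) (D (Suc i)) (D (Suc (Suc i)))" for i
    unfolding E_def D_def
  proof (rule runge_cylinder[OF se])
    show "\<not> (\<exists>C\<in>components (UNIV - exhaustion G i). bounded C \<and> C \<subseteq> G)"
      using exhaustion_components[of _ G i] by (auto simp: Compl_eq_Diff_UNIV)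
    show "closure (interior (exhaustion G (Suc (Suc i)))) \<subseteq> G" using cb(1) exhaustion_subset by blast
    show "exhaustion G i \<subseteq> interior (exhaustion G (Suc i))" by (rule exhaustion_interior)
  qed (use compact_exhaustion cb in auto)
  have "compact (fst ` M)" "compact (snd ` M)"
    using prems by (auto intro!: compact_continuous_image continuous_intros)
  have "compact (snd ` M \<union> K)" "snd ` M \<union> K \<subseteq> G"
    using \<open>compact (snd ` M)\<close> assms prems by auto
  then obtain k1 where k1: "snd ` M \<union> K \<subseteq> exhaustion G k1" using compact_subset_exhaustion assms(7) by blast
  have "bounded (fst ` M \<union> {t\<^sub>1..t\<^sub>2})" using \<open>compact (fst ` M)\<close> by (auto intro: compact_imp_bounded)
  then obtain T where T: "\<forall>t\<in>fst ` M \<union> {t\<^sub>1..t\<^sub>2}. \<bar>t\<bar> \<le> T"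
    unfolding bounded_iff real_norm_def by blast
  obtain k2 where k2: "T \<le> real k2" using real_arch_simple by blast
  \<comment> \<open>\<open>E k\<close> shall contain both M and the cylinder over K, so that the
    correction in the limit is small on both.\<close>
  define k where "k = max k1 k2"
  have kk: "exhaustion G k1 \<subseteq> exhaustion G k" "real k2 \<le> real k" unfolding k_def by (rule exhaustion_mono, simp_all)
  have ME: "M \<subseteq> E k" "{t\<^sub>1..t\<^sub>2} \<times> K \<subseteq> E k"
  proof -
    have Ek: "z \<in> E k" if "fst z \<in> fst ` M \<union> {t\<^sub>1..t\<^sub>2}" "snd z \<in> snd ` M \<union> K" for z
    proof -
      have "\<bar>fst z\<bar> \<le> real k" using T that(1) k2 kk(2) by force
      moreover have "snd z \<in> exhaustion G k" using that(2) k1 kk(1) by blast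
      ultimately show ?thesis by (simp add: E_def mem_Times_iff abs_le_iff)
    qed
    show "M \<subseteq> E k" by (intro subsetI Ek) auto
    show "{t\<^sub>1..t\<^sub>2} \<times> K \<subseteq> E k" by (intro subsetI Ek) auto
  qed
  \<comment> \<open>On the open set W the solution is bounded by its norm on the compact set Z. The
    hypotheses on L and \<delta> put the cylinder over K inside W.\<close>
  define W where "W = {t\<^sub>1 - \<delta><..<t\<^sub>2 + \<delta>} \<times> interior L"
  define Z where "Z = {t\<^sub>1 - \<delta>..t\<^sub>2 + \<delta>} \<times> L"
  have W: "open W" "W \<subseteq> Z" "Z \<subseteq> J \<times> H" "compact Z" "{t\<^sub>1..t\<^sub>2} \<times> K \<subseteq> Z"
    using prems interior_subset[of L] by (auto simp: W_def Z_def intro!: open_Times compact_Times)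
  have "approx ({t\<^sub>1..t\<^sub>2} \<times> K) W (D (Suc k))"
    unfolding W_def D_def
  proof (rule runge_cylinder[OF se])
    show "closure (interior (exhaustion G (Suc k))) \<subseteq> G" using cb(1) exhaustion_subset by blast
  qed (use assms prems cb in auto)
  then obtain C s where Cs: "C > 0" "s > 0" "\<And>\<epsilon> u B. 0 < \<epsilon> \<Longrightarrow> \<epsilon> < 1 \<Longrightarrow> sol W u \<Longrightarrow> 0 < B \<Longrightarrow> (\<And>z. z \<in> W \<Longrightarrow> cmod (u z) \<le> B) \<Longrightarrow>
    \<exists>u'. sol (D (Suc k)) u' \<and> (\<forall>z\<in>{t\<^sub>1..t\<^sub>2} \<times> K. cmod (u z - u' z) \<le> \<epsilon> * B) \<and> (\<forall>z\<in>D (Suc k). cmod (u' z) \<le> C * \<epsilon> powr (- s) * B)"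
    using approx_scaled[OF _ W(1) opD] by blast
  have opJH: "open (J \<times> H)" and opG: "open (UNIV \<times> G)" using assms by (auto intro: open_Times)
  \<comment> \<open>Approximating with accuracy \<epsilon> / 2 costs the factor 2 powr s; the
    correction in the limit adds at most \<epsilon> / 2 times the norm of f, which accounts for the
    summand 1.\<close>
  have main: "\<exists>h \<in> kernel_on (P_op \<alpha> r Q) (UNIV \<times> G).
      sup_norm ({t\<^sub>1..t\<^sub>2} \<times> K) (\<lambda>z. f z - h z) \<le> \<epsilon> * sup_norm Z f \<and>
      sup_norm M h \<le> (C * 2 powr s + 1) / \<epsilon> powr s * sup_norm Z f"
    if f: "f \<in> kernel_on (P_op \<alpha> r Q) (J \<times> H)" and \<epsilon>: "\<epsilon> \<in> {0<..<1}" for f \<epsilon>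
  proof -
    have sf: "sol (J \<times> H) f" using f sol_iff[OF opJH] by simp
    have cf: "continuous_on Z f"
      using smooth_on_continuous_on[OF sol_smooth[OF sf]] W(3) continuous_on_subset by blast
    define B where "B = sup_norm Z f"
    have B0: "B \<ge> 0" unfolding B_def by (rule sup_norm_nonneg[OF W(4) cf])
    have fB: "cmod (f z) \<le> B" if "z \<in> Z" for z unfolding B_def by (rule le_sup_norm[OF W(4) cf that])
    show ?thesis
    \<comment> \<open>\<open>approx_scaled\<close> needs a positive bound. If the norm is 0, then f
      vanishes on Z and h = 0 has error 0.\<close>
    proof (cases "B = 0")
      case True
      have "sup_norm ({t\<^sub>1..t\<^sub>2} \<times> K) (\<lambda>z. f z - 0) \<le> 0"
        using fB W(5) True by (intro sup_norm_le) auto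
      moreover have "sup_norm M (\<lambda>z. 0) \<le> 0" by (intro sup_norm_le) auto
      moreover have "(\<lambda>z. 0) \<in> kernel_on (P_op \<alpha> r Q) (UNIV \<times> G)"
        using sol_iff[OF opG] sol_zero by blast
      ultimately show ?thesis unfolding B_def[symmetric] True by (intro bexI[of _ "\<lambda>z. 0"]) auto
    next
      case False
      then have B: "B > 0" using B0 by simp
      have e2: "0 < \<epsilon> / 2" "\<epsilon> / 2 < 1" using \<epsilon> by auto
      have sW: "sol W f" using W by (intro sol_subset[OF sf]) auto
      obtain u where u: "sol (D (Suc k)) u" "\<And>z. z \<in> {t\<^sub>1..t\<^sub>2} \<times> K \<Longrightarrow> cmod (f z - u z) \<le> \<epsilon> / 2 * B"
        "\<And>z. z \<in> D (Suc k) \<Longrightarrow> cmod (u z) \<le> C * (\<epsilon> / 2) powr (- s) * B"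
        using Cs(3)[OF e2 sW B] fB W(2) by blast
      have "\<epsilon> / 2 * B > 0" using e2 B by simp
      then obtain h where h: "sol (UNIV \<times> G) h" "\<And>z. z \<in> E k \<Longrightarrow> cmod (u z - h z) \<le> \<epsilon> / 2 * B"
        using mittag_leffler[of D E, OF opD DE ED ap u(1) u(3)] unfolding UD by blast
      have 1: "sup_norm ({t\<^sub>1..t\<^sub>2} \<times> K) (\<lambda>z. f z - h z) \<le> \<epsilon> * B"
      proof (rule sup_norm_le)
        fix z assume z: "z \<in> {t\<^sub>1..t\<^sub>2} \<times> K"
        have "cmod (f z - h z) \<le> cmod (f z - u z) + cmod (u z - h z)"
          using norm_triangle_ineq[of "f z - u z" "u z - h z"] by simp
        also have "\<dots> \<le> \<epsilon> / 2 * B + \<epsilon> / 2 * B" using z ME(2) by (intro add_mono u(2) h(2)) auto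
        finally show "cmod (f z - h z) \<le> \<epsilon> * B" by (simp add: mult.commute)
      qed (use \<epsilon> B in auto)
      have e1: "1 \<le> \<epsilon> powr (- s)" using \<epsilon> Cs(2) powr_mono'[of "- s" 0 \<epsilon>] by simp
      have e3: "(\<epsilon> / 2) powr (- s) = 2 powr s * \<epsilon> powr (- s)" using \<epsilon> by (simp add: powr_divide powr_minus field_simps)
      have 2: "sup_norm M h \<le> (C * 2 powr s + 1) / \<epsilon> powr s * B"
      proof (rule sup_norm_le)
        fix z assume "z \<in> M"
        then have z: "z \<in> E k" "z \<in> D (Suc k)" using ME(1) ED by auto
        have "cmod (h z) \<le> cmod (u z) + cmod (u z - h z)"
          using norm_triangle_ineq4[of "u z" "u z - h z"] by simp
        also have "\<dots> \<le> C * (\<epsilon> / 2) powr (- s) * B + \<epsilon> / 2 * B" by (intro add_mono u(3) h(2) z)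
        also have "\<dots> \<le> C * (\<epsilon> / 2) powr (- s) * B + \<epsilon> powr (- s) * B"
          using e1 \<epsilon> B by (intro add_left_mono mult_right_mono) auto
        also have "\<dots> = (C * 2 powr s + 1) / \<epsilon> powr s * B"
          unfolding e3 by (simp add: powr_minus_divide add_divide_distrib algebra_simps)
        finally show "cmod (h z) \<le> (C * 2 powr s + 1) / \<epsilon> powr s * B" .
      qed (use Cs B in auto)
      show ?thesis using 1 2 h(1) sol_iff[OF opG] unfolding B_def[symmetric] by blast
    qed
  qed
  have "0 < C * 2 powr s + 1" using Cs(1) by (simp add: add_pos_pos)
  then show "\<exists>s C :: real. 0 < s \<and> 0 < C \<and>
           (\<forall>f \<in> kernel_on (P_op \<alpha> r Q) (J \<times> H). \<forall>\<epsilon> \<in> {0<..<1}.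
             \<exists>h \<in> kernel_on (P_op \<alpha> r Q) (UNIV \<times> G).
               sup_norm ({t\<^sub>1..t\<^sub>2} \<times> K) (\<lambda>z. f z - h z)
                 \<le> \<epsilon> * sup_norm ({t\<^sub>1 - \<delta>..t\<^sub>2 + \<delta>} \<times> L) f \<and>
               sup_norm M h
                 \<le> C / \<epsilon> powr s * sup_norm ({t\<^sub>1 - \<delta>..t\<^sub>2 + \<delta>} \<times> L) f)"
    unfolding Z_def[symmetric] using Cs(2) main by blast
qed

end
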